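(* Let $m \geq 0$, $\lambda \in \mathbb{R}$, $\mu \geq 0$, $u_0\in H^{1/2}(\mathbb{R}^3)$, and let $u \in C^0([0,T);H^{1/2}(\mathbb{R}^3))\cap C^1([0,T);H^{-1/2}(\mathbb{R}^3))$ be the unique maximal solution, with maximal existence time $T\in(0,\infty]$, of \[ i \partial_t u = \sqrt{-\Delta+m^2}\, u + \Big( \frac{\lambda e^{-\mu|x|}}{|x|} \ast |u|^2 \Big) u, \qquad u(0)=u_0 \] (where $T<\infty$ implies $\|u(t)\|_{H^{1/2}}\to\infty$ as $t\uparrow T$). Then $T=\infty$ provided one of the following holds: (i) $\lambda \geq 0$; (ii) $\lambda<0$ and $\|u_0\|_2^2 < \|Q\|_2^2$, where $Q \in H^{1/2}(\mathbb{R}^3)$ is a strictly positive solution (ground state) of \[ \sqrt{-\Delta}\, Q + \Big(\frac{\lambda}{|x|}\ast|Q|^2\Big) Q = -Q. \] Moreover, $\|Q\|_2^2 > \frac{4}{\pi|\lambda|}$.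
   Context: $\sqrt{-\Delta+m^2}$ and $\sqrt{-\Delta}$ are Fourier multipliers with symbols $\sqrt{\xi^2+m^2}$ and $|\xi|$; $\ast$ is convolution on $\mathbb{R}^3$; $\|\cdot\|_2$ is the $L^2(\mathbb{R}^3)$ norm. The ground state $Q$ is the (rescaled) optimizer of the functional $K[u] = \|(-\Delta)^{1/4}u\|_2^2\|u\|_2^2 / \int (|x|^{-1}\ast|u|^2)|u|^2\,dx$ over nonzero $u\in H^{1/2}(\mathbb{R}^3)$: a real-valued, radial, strictly positive solution of the displayed equation. *)

theory Defs
  imports "HOL-Analysis.Analysis"
begin

text \<open>Functions on R^3 are modelled as maps real^3 => complex.  Fourier transform
 convention: hat f(xi) = (2 pi)^(-3/2) integral exp(-i x.xi) f(x) dx, so that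
 sqrt(-Delta + m^2) and sqrt(-Delta) have symbols sqrt(|xi|^2+m^2) and |xi|.\<close>

type_synonym fn3 = "real^3 \<Rightarrow> complex"

definition FT1 :: "fn3 \<Rightarrow> fn3" where
  "FT1 f \<xi> = complex_of_real ((2 * pi) powr (-3/2)) *
     (LINT x|lborel. exp (- \<i> * complex_of_real (x \<bullet> \<xi>)) * f x)"

definition L2 :: "fn3 \<Rightarrow> bool" where
  "L2 f \<longleftrightarrow> f \<in> borel_measurable lborel \<and>
     (\<integral>\<^sup>+ x. ennreal ((cmod (f x))\<^sup>2) \<partial>lborel) < \<infinity>"

definition is_fourier :: "fn3 \<Rightarrow> fn3 \<Rightarrow> bool" where
  "is_fourier f g \<longleftrightarrow> L2 f \<and> L2 g \<and>
     ((\<lambda>R::real. \<integral>\<^sup>+ \<xi>. ennreal ((cmod (g \<xi> - FT1 (\<lambda>x. indicator (ball 0 R) x * f x) \<xi>))\<^sup>2) \<partial>lborel)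
        \<longlongrightarrow> 0) at_top"

definition wnorm2 :: "real \<Rightarrow> fn3 \<Rightarrow> ennreal" where
  "wnorm2 s g = (\<integral>\<^sup>+ \<xi>. ennreal ((1 + (norm \<xi>)\<^sup>2) powr s * (cmod (g \<xi>))\<^sup>2) \<partial>lborel)"

definition in_wL2 :: "real \<Rightarrow> fn3 \<Rightarrow> bool" where
  "in_wL2 s g \<longleftrightarrow> g \<in> borel_measurable lborel \<and> wnorm2 s g < \<infinity>"

definition H_half :: "fn3 \<Rightarrow> bool" where
  "H_half f \<longleftrightarrow> (\<exists>g. is_fourier f g \<and> in_wL2 (1/2) g)"

definition H_half_norm :: "fn3 \<Rightarrow> real" where
  "H_half_norm f = sqrt (enn2real (wnorm2 (1/2) (SOME g. is_fourier f g)))"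

definition L2norm2 :: "fn3 \<Rightarrow> real" where
  "L2norm2 f = enn2real (\<integral>\<^sup>+ x. ennreal ((cmod (f x))\<^sup>2) \<partial>lborel)"

definition hartree_pot :: "real \<Rightarrow> real \<Rightarrow> fn3 \<Rightarrow> real^3 \<Rightarrow> real" where
  "hartree_pot lam mu u x =
     (LINT y|lborel. lam * exp (- mu * norm (x - y)) / norm (x - y) * (cmod (u y))\<^sup>2)"

definition nonlin :: "real \<Rightarrow> real \<Rightarrow> fn3 \<Rightarrow> fn3" where
  "nonlin lam mu u x = complex_of_real (hartree_pot lam mu u x) * u x"

text \<open>u in C^0([0,T);H^{1/2}) \<inter> C^1([0,T);H^{-1/2}) solving
 i u_t = sqrt(-Delta+m^2) u + (lam e^{-mu|x|}/|x| * |u|^2) u in H^{-1/2}, u(0)=u0.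
 U t is the Fourier transform of u t, W t that of the time derivative.\<close>
definition is_solution :: "real \<Rightarrow> real \<Rightarrow> real \<Rightarrow> fn3 \<Rightarrow> ereal \<Rightarrow> (real \<Rightarrow> fn3) \<Rightarrow> bool" where
  "is_solution m lam mu u0 T u \<longleftrightarrow> T > 0 \<and> (AE x in lborel. u 0 x = u0 x) \<and>
    (\<exists>U W. \<forall>t \<in> {t. 0 \<le> t \<and> ereal t < T}.
       is_fourier (u t) (U t) \<and> in_wL2 (1/2) (U t) \<and> in_wL2 (-1/2) (W t) \<and>
       ((\<lambda>s. wnorm2 (1/2) (\<lambda>\<xi>. U s \<xi> - U t \<xi>)) \<longlongrightarrow> 0) (at t within {t. 0 \<le> t \<and> ereal t < T}) \<and>
       ((\<lambda>s. wnorm2 (-1/2) (\<lambda>\<xi>. (U s \<xi> - U t \<xi>) / complex_of_real (s - t) - W t \<xi>)) \<longlongrightarrow> 0)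
          (at t within {t. 0 \<le> t \<and> ereal t < T}) \<and>
       ((\<lambda>s. wnorm2 (-1/2) (\<lambda>\<xi>. W s \<xi> - W t \<xi>)) \<longlongrightarrow> 0) (at t within {t. 0 \<le> t \<and> ereal t < T}) \<and>
       (\<exists>G. is_fourier (nonlin lam mu (u t)) G \<and>
          (AE \<xi> in lborel. \<i> * W t \<xi> = complex_of_real (sqrt ((norm \<xi>)\<^sup>2 + m\<^sup>2)) * U t \<xi> + G \<xi>)))"

definition K_functional :: "fn3 \<Rightarrow> real" where
  "K_functional v =
     enn2real (\<integral>\<^sup>+ \<xi>. ennreal (norm \<xi> * (cmod ((SOME g. is_fourier v g) \<xi>))\<^sup>2) \<partial>lborel) * L2norm2 v
     / enn2real (\<integral>\<^sup>+ x. ennreal (hartree_pot 1 0 v x * (cmod (v x))\<^sup>2) \<partial>lborel)"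

text \<open>Ground state: real, radial, strictly positive H^{1/2} solution of
 sqrt(-Delta) Q + (lam/|x| * |Q|^2) Q = -Q (in H^{-1/2}) which optimizes K
 (K is invariant under rescalings a v(b x), so a rescaled optimizer is an optimizer).\<close>
definition ground_state :: "real \<Rightarrow> fn3 \<Rightarrow> bool" where
  "ground_state lam Q \<longleftrightarrow> H_half Q \<and>
     (\<forall>x. Im (Q x) = 0 \<and> Re (Q x) > 0) \<and>
     (\<forall>x y. norm x = norm y \<longrightarrow> Q x = Q y) \<and>
     (\<exists>F G. is_fourier Q F \<and> is_fourier (nonlin lam 0 Q) G \<and>
        (AE \<xi> in lborel. complex_of_real (norm \<xi>) * F \<xi> + G \<xi> = - F \<xi>)) \<and>
     (\<forall>v. H_half v \<and> \<not> (AE x in lborel. v x = 0) \<longrightarrow> K_functional Q \<le> K_functional v)"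

end

theory Submission
  imports "HOL-Probability.Probability" Defs
begin

text \<open>
  Everything is reduced to one identity: for an \<open>L\<^sup>2\<close> function \<open>f\<close> with Fourier transform \<open>g\<close>, the heat
  kernel average of \<open>\<parallel>f(\<cdot> + h) - f\<parallel>\<^sup>2\<close> over \<open>h\<close> equals \<open>2 \<integral> (1 - exp (- e |\<xi>|\<^sup>2)) |g|\<^sup>2\<close>; integrating it against
  \<open>e\<^bsup>-3/2\<^esup>\<close> in \<open>e\<close> produces the kinetic energy \<open>\<integral> |\<xi>| |g|\<^sup>2\<close>.
  A Schur test for the heat kernel with the weight \<open>1/|x - a|\<close>, whose heat evolution is explicit, then gives Kato's
  inequality \<open>\<integral> |f|\<^sup>2/|x - a| \<le> (\<pi>/2) \<integral> |\<xi>| |g|\<^sup>2\<close> with the sharp constant, and Kato's inequality applied to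
  difference quotients shows that the Hartree nonlinearity maps \<open>H\<^bsup>1/2\<^esup>\<close> to itself.

  This makes the energy flux through a frequency cutoff vanish in the limit, so mass and energy are
  conserved. For \<open>\<lambda> \<ge> 0\<close> the energy controls the \<open>H\<^bsup>1/2\<^esup>\<close> norm. For \<open>\<lambda> < 0\<close> the optimality of \<open>Q\<close>
  controls the potential energy: testing the functional \<open>K\<close> at \<open>Q + \<epsilon> (M \<phi> - B) Q\<close>, with \<open>M\<close> the mass, \<open>\<phi>\<close> the
  Newton potential and \<open>B\<close> the interaction energy of \<open>Q\<^sup>2\<close>, and comparing with the equation for \<open>Q\<close>, forces
  either \<open>M \<phi> = B\<close> or that kinetic energy and mass of \<open>Q\<close> agree; a Newton potential is not constant, so
  \<open>K(Q) = |\<lambda>| M / 2\<close>. Strictness in the lower bound for \<open>M\<close> holds for the same reason.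
\<close>

subsection \<open>Lebesgue integrals on Euclidean spaces\<close>

text \<open>Two obstacles shape the argument. The time derivative lies only in
  \<open>H^(-1/2)\<close>, so pairing the equation with it, the formal route to energy conservation,
  would multiply two elements of \<open>H^(-1/2)\<close>. Its pairing with the nonlinearity makes
  sense once that lies in \<open>H^(1/2)\<close>; the kinetic part has to be cut off. On the side of
  the ground state, \<open>K\<close> is invariant under multiples and dilations, so these directions
  give no information. The equation for \<open>Q\<close> and the Euler-Lagrange equation of
  \<open>K\<close> both combine \<open>sqrt(-Delta) Q\<close>, \<open>Q\<close> and
  \<open>\<phi> Q\<close>; eliminating the first leaves \<open>(A - M) (M \<phi> - B) Q = 0\<close>,
  with \<open>A\<close> the kinetic energy. Testing with the factor \<open>(M \<phi> - B) Q\<close>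
  itself turns this into a weighted square. The constant \<open>4 / (pi |lam|)\<close> comes from
  \<open>2 M = |lam| B < |lam| (pi/2) A M\<close> with \<open>A = M\<close>, hence from the sharp
  constant \<open>pi/2\<close> in Kato's inequality. That one is the quotient of
  \<open>2 sqrt pi\<close>, which belongs to \<open>|xi|\<close>, and \<open>4 / sqrt pi\<close>,
  which belongs to the defect of the Newton potential under the heat flow.\<close>

lemma nn_integral_lborel_translate:
  fixes f :: "'a::euclidean_space \<Rightarrow> ennreal"
  assumes [measurable]: "f \<in> borel_measurable borel"
  shows "(\<integral>\<^sup>+x. f (a + x) \<partial>lborel) = (\<integral>\<^sup>+x. f x \<partial>lborel)"
  by (subst (2) lborel_distr_plus[symmetric, of a]) (simp add: nn_integral_distr)

text \<open>Fubini in coordinates: \<open>lborel\<close> is the image of a finite product of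
  one-dimensional Lebesgue measures. This lifts the Gaussian Fourier integral from one dimension to
  three.\<close>

lemma lborel_prod_integrable:
  fixes F :: "'a::euclidean_space \<Rightarrow> real \<Rightarrow> 'b::{real_normed_field,banach,second_countable_topology}"
  assumes "\<And>b. b \<in> Basis \<Longrightarrow> integrable lborel (F b)"
  shows lborel_integrable_prod: "integrable lborel (\<lambda>x::'a. \<Prod>b\<in>Basis. F b (x \<bullet> b))"
    and lborel_integral_prod: "(LINT x|lborel. (\<Prod>b\<in>Basis. F b ((x::'a) \<bullet> b))) = (\<Prod>b\<in>Basis. LINT x|lborel. F b x)"
proof -
  interpret product_sigma_finite "\<lambda>_::'a. lborel :: real measure" ..
  let ?S = "\<lambda>f. \<Sum>b\<in>Basis. f b *\<^sub>R b :: 'a"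
  have [measurable]: "\<And>b. b \<in> Basis \<Longrightarrow> F b \<in> borel_measurable borel"
    using borel_measurable_integrable[OF assms] by simp
  have i: "integrable (\<Pi>\<^sub>M b\<in>Basis. lborel) (\<lambda>x::'a\<Rightarrow>real. \<Prod>b\<in>Basis. F b (x b))"
    by (intro product_integrable_prod assms) auto
  have eq: "(\<Prod>b\<in>Basis. F b (?S x \<bullet> b)) = (\<Prod>b\<in>Basis. F b (x b))" for x
    by (intro prod.cong) (auto simp: inner_sum_left_Basis)
  have m: "?S \<in> (\<Pi>\<^sub>M b\<in>Basis. lborel) \<rightarrow>\<^sub>M borel" by simp
  have m2: "(\<lambda>x::'a. \<Prod>b\<in>Basis. F b (x \<bullet> b)) \<in> borel_measurable borel"
    by measurable
  show "integrable lborel (\<lambda>x::'a. \<Prod>b\<in>Basis. F b (x \<bullet> b))"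
    by (subst lborel_eq, subst integrable_distr_eq[OF m m2]) (simp add: eq i)
  have "(LINT x|lborel. (\<Prod>b\<in>Basis. F b ((x::'a) \<bullet> b)))
      = (LINT x|(\<Pi>\<^sub>M b\<in>Basis. lborel). (\<Prod>b\<in>Basis. F b (x b)))"
    by (subst lborel_eq, subst integral_distr[OF m m2]) (simp add: eq)
  also have "\<dots> = (\<Prod>b\<in>Basis. LINT x|lborel. F b x)"
    by (intro product_integral_prod assms) auto
  finally show "(LINT x|lborel. (\<Prod>b\<in>Basis. F b ((x::'a) \<bullet> b))) = (\<Prod>b\<in>Basis. LINT x|lborel. F b x)" .
qed

text \<open>Up to scaling this is the characteristic function of the standard normal law at
  \<open>t / sqrt (2 * e)\<close>: the substitution with factor \<open>sqrt (2 * e)\<close> turns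
  \<open>exp (- x^2 / 2)\<close> into \<open>exp (- e * x^2)\<close>.\<close>

lemma gaussian_fourier_1d:
  fixes e t :: real
  assumes e: "e > 0"
  shows "integrable lborel (\<lambda>x. iexp (t * x) * complex_of_real (exp (- e * x\<^sup>2)))"
    and "(LINT x|lborel. iexp (t * x) * complex_of_real (exp (- e * x\<^sup>2)))
       = complex_of_real (sqrt (pi / e) * exp (- t\<^sup>2 / (4 * e)))"
proof -
  let ?s = "1 / sqrt (2 * e)"
  let ?g = "\<lambda>x. std_normal_density x *\<^sub>R iexp ((t * ?s) * x)"
  have s: "?s > 0" using e by simp
  have i: "integrable lborel ?g"
  proof (rule Bochner_Integration.integrable_bound)
    show "integrable lborel std_normal_density" by simp
    show "AE x in lborel. norm (?g x) \<le> norm (std_normal_density x)"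
      by (simp add: norm_exp_i_times)
  qed (auto intro!: borel_measurable_continuous_onI continuous_intros)
  have "complex_of_real (exp (- ((t * ?s)\<^sup>2) / 2)) = char std_normal_distribution (t * ?s)"
    by (simp add: char_std_normal_distribution)
  also have "\<dots> = (LINT x|lborel. ?g x)"
    unfolding char_def
    by (subst integral_density) (auto simp: normal_density_nonneg)
  also have "\<dots> = \<bar>sqrt (2*e)\<bar> *\<^sub>R (LINT x|lborel. ?g (0 + sqrt (2*e) * x))"
    using e by (intro lborel_integral_real_affine) simp
  also have "(\<lambda>x. ?g (0 + sqrt (2*e) * x))
     = (\<lambda>x. (1 / sqrt (2 * pi)) *\<^sub>R (iexp (t * x) * complex_of_real (exp (- e * x\<^sup>2))))"
    using e by (auto simp: std_normal_density_def fun_eq_iff power_mult_distrib scaleR_conv_of_real field_simps)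
  finally have eq: "complex_of_real (exp (- ((t * ?s)\<^sup>2) / 2)) =
     sqrt (2*e) *\<^sub>R (LINT x|lborel. (1 / sqrt (2 * pi)) *\<^sub>R (iexp (t * x) * complex_of_real (exp (- e * x\<^sup>2))))"
    using e by simp
  have "integrable lborel (\<lambda>x. ?g (0 + sqrt (2*e) * x))"
    using e by (intro lborel_integrable_real_affine[OF i]) simp
  then have "integrable lborel (\<lambda>x. sqrt (2*pi) *\<^sub>R ?g (0 + sqrt (2*e) * x))"
    by (rule integrable_scaleR_right)
  also have "(\<lambda>x. sqrt (2*pi) *\<^sub>R ?g (0 + sqrt (2*e) * x)) = (\<lambda>x. iexp (t * x) * complex_of_real (exp (- e * x\<^sup>2)))"
    using e by (auto simp: std_normal_density_def fun_eq_iff power_mult_distrib scaleR_conv_of_real field_simps)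
  finally show i2: "integrable lborel (\<lambda>x. iexp (t * x) * complex_of_real (exp (- e * x\<^sup>2)))" .
  have "(t * ?s)\<^sup>2 / 2 = t\<^sup>2 / (4 * e)" using e by (simp add: power_mult_distrib power_divide)
  then show "(LINT x|lborel. iexp (t * x) * complex_of_real (exp (- e * x\<^sup>2)))
       = complex_of_real (sqrt (pi / e) * exp (- t\<^sup>2 / (4 * e)))"
    using eq e i2 by (simp add: scaleR_conv_of_real real_sqrt_mult real_sqrt_divide field_simps)
qed

subsection \<open>The heat kernel\<close>

text \<open>The kernel of \<open>exp (s Delta)\<close>, with Fourier symbol
  \<open>exp (- s |xi|^2)\<close>. Both \<open>|xi|\<close> and \<open>1 / |x|\<close> are recovered
  from it by integration over time.\<close>

definition heat :: "real \<Rightarrow> real^3 \<Rightarrow> real" where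
  "heat s z = (4 * pi * s) powr (-3/2) * exp (- (norm z)\<^sup>2 / (4 * s))"

lemma powr_minus_three_halves: "a > 0 \<Longrightarrow> a powr (-3/2) = inverse (sqrt a ^ 3)"
proof -
  assume a: "a > 0"
  then have "a powr (-3/2) = (sqrt a) powr (- 3)"
    by (simp add: powr_half_sqrt[symmetric] powr_powr)
  also have "\<dots> = inverse (sqrt a ^ 3)"
    using a by (simp add: powr_minus powr_numeral)
  finally show ?thesis .
qed

lemma heat_eq: "s > 0 \<Longrightarrow> heat s z = inverse (sqrt (4 * pi * s) ^ 3) * exp (- (norm z)\<^sup>2 / (4 * s))"
  unfolding heat_def by (subst powr_minus_three_halves) auto

lemma heat_nonneg [simp]: "heat s z \<ge> 0"
  by (simp add: heat_def)

lemma heat_minus [simp]: "heat s (- z) = heat s z"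
  by (simp add: heat_def)

lemma heat_commute: "heat s (x - y) = heat s (y - x)"
  by (simp add: heat_def norm_minus_commute)

lemma measurable_heat [measurable (raw)]:
  assumes [measurable]: "f \<in> borel_measurable M" "g \<in> borel_measurable M"
  shows "(\<lambda>x. heat (f x) (g x)) \<in> borel_measurable M"
  unfolding heat_def by measurable

text \<open>Phase and Gaussian both factor over the coordinates. The factor
  \<open>(2 * pi) ^ 3\<close> appears because the integral is the inverse transform of the heat
  symbol without its normalisation.\<close>

lemma gaussian_fourier:
  fixes z :: "real^3" and e :: real
  assumes e: "e > 0"
  shows "integrable lborel (\<lambda>\<xi>::real^3. iexp (z \<bullet> \<xi>) * complex_of_real (exp (- e * (norm \<xi>)\<^sup>2)))"
    and "(LINT \<xi>|lborel. iexp (z \<bullet> \<xi>) * complex_of_real (exp (- e * (norm \<xi>)\<^sup>2)))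
       = complex_of_real ((2 * pi) ^ 3 * heat e z)"
proof -
  let ?F = "\<lambda>b x. iexp ((z \<bullet> b) * x) * complex_of_real (exp (- e * x\<^sup>2))"
  have n: "(norm \<xi>)\<^sup>2 = (\<Sum>b\<in>Basis. (\<xi> \<bullet> b)\<^sup>2)" for \<xi> :: "real^3"
    unfolding power2_norm_eq_inner euclidean_inner[of \<xi> \<xi>] by (simp add: power2_eq_square)
  have eq: "iexp (z \<bullet> \<xi>) * complex_of_real (exp (- e * (norm \<xi>)\<^sup>2)) = (\<Prod>b\<in>Basis. ?F b (\<xi> \<bullet> b))" for \<xi>
    by (simp add: n euclidean_inner[of z \<xi>] prod.distrib exp_sum[symmetric] sum_distrib_left of_real_sum exp_of_real[symmetric] sum_negf)
  have card: "card (Basis :: (real^3) set) = 3" by (simp)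
  have p: "(\<Prod>b\<in>Basis. sqrt (pi / e) * exp (- (z \<bullet> b)\<^sup>2 / (4 * e))) = (2 * pi) ^ 3 * heat e z"
  proof -
    have "(\<Prod>b\<in>Basis. exp (- (z \<bullet> b)\<^sup>2 / (4 * e))) = exp (- (norm z)\<^sup>2 / (4 * e))"
      by (simp add: n exp_sum[symmetric] sum_divide_distrib sum_negf)
    moreover have "sqrt (pi / e) ^ 3 = (2 * pi)^3 * inverse (sqrt (4 * pi * e) ^ 3)"
    proof -
      have "sqrt (4 * pi * e) = 2 * (sqrt pi * sqrt e)" using e by (simp add: real_sqrt_mult)
      moreover have "(2 * pi) = 2 * (sqrt pi * sqrt pi)" by simp
      moreover have "sqrt pi > 0" "sqrt e > 0" using e by auto
      ultimately show ?thesis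
        unfolding real_sqrt_divide by (simp only: power_divide power_mult_distrib) (simp add: field_simps)
    qed
    ultimately show ?thesis
      using e by (simp add: prod.distrib heat_eq card)
  qed
  show "integrable lborel (\<lambda>\<xi>::real^3. iexp (z \<bullet> \<xi>) * complex_of_real (exp (- e * (norm \<xi>)\<^sup>2)))"
    unfolding eq by (intro lborel_integrable_prod gaussian_fourier_1d e)
  have "(LINT \<xi>|lborel. iexp (z \<bullet> \<xi>) * complex_of_real (exp (- e * (norm \<xi>)\<^sup>2)))
      = (\<Prod>b\<in>Basis. LINT x|lborel. ?F b x)"
    unfolding eq by (intro lborel_integral_prod gaussian_fourier_1d e)
  also have "\<dots> = complex_of_real (\<Prod>b\<in>Basis. sqrt (pi / e) * exp (- (z \<bullet> b)\<^sup>2 / (4 * e)))"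
    using gaussian_fourier_1d(2)[OF e] by simp
  finally show "(LINT \<xi>|lborel. iexp (z \<bullet> \<xi>) * complex_of_real (exp (- e * (norm \<xi>)\<^sup>2)))
       = complex_of_real ((2 * pi) ^ 3 * heat e z)" unfolding p .
qed

lemma gaussian_integrable:
  assumes "e > 0"
  shows "integrable lborel (\<lambda>\<xi>::real^3. exp (- e * (norm \<xi>)\<^sup>2))"
  using gaussian_fourier(1)[OF assms, of 0] by (simp add: complex_of_real_integrable_eq)

text \<open>The profile of \<open>heat s\<close> is a Gaussian with parameter
  \<open>1 / (4 * s)\<close>, so its total mass is the previous Fourier integral at
  \<open>z = 0\<close>; the two normalising constants are inverse to each other.\<close>

lemma nn_integral_heat:
  assumes s: "s > 0"
  shows "(\<integral>\<^sup>+z. heat s (z - a) \<partial>lborel) = 1" "(\<integral>\<^sup>+z. heat s z \<partial>lborel) = 1"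
proof -
  let ?e = "1 / (4 * s)"
  have e: "?e > 0" using s by simp
  have i: "integrable lborel (\<lambda>\<xi>::real^3. exp (- ?e * (norm \<xi>)\<^sup>2))" by (rule gaussian_integrable[OF e])
  have "complex_of_real (LINT \<xi>|lborel. exp (- ?e * (norm (\<xi>::real^3))\<^sup>2)) = complex_of_real ((2*pi)^3 * heat ?e 0)"
    using gaussian_fourier(2)[OF e, of 0] by (simp add: integral_complex_of_real[symmetric] del: integral_complex_of_real)
  then have v: "(LINT \<xi>|lborel. exp (- ?e * (norm (\<xi>::real^3))\<^sup>2)) = (2*pi)^3 * heat ?e 0"
    by (simp only: of_real_eq_iff)
  have "heat s = (\<lambda>z. inverse (sqrt (4 * pi * s) ^ 3) * exp (- ?e * (norm z)\<^sup>2))"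
    using s by (simp add: heat_eq fun_eq_iff)
  then have ih: "integrable lborel (heat s)" and vh: "(LINT z|lborel. heat s z) = inverse (sqrt (4 * pi * s) ^ 3) * ((2*pi)^3 * heat ?e 0)"
    using i v by simp_all
  have "inverse (sqrt (4 * pi * s) ^ 3) * ((2*pi)^3 * heat ?e 0) = 1"
  proof -
    have "sqrt (4 * pi * s) * sqrt (4 * pi * ?e) = sqrt ((2 * pi)\<^sup>2)"
      using s unfolding real_sqrt_mult[symmetric] by (simp add: power2_eq_square)
    then have "sqrt (4 * pi * s) * sqrt (4 * pi * ?e) = 2 * pi" by (simp only: real_sqrt_abs) simp
    then have "sqrt (4 * pi * s) ^ 3 * sqrt (4 * pi * ?e) ^ 3 = (2 * pi) ^ 3"
      unfolding power_mult_distrib[symmetric] by (simp only:)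
    moreover have "sqrt (4 * pi * s) > 0" "sqrt (4 * pi * ?e) > 0" using s by auto
    ultimately show ?thesis unfolding heat_eq[OF e] by (simp add: divide_simps)
  qed
  with ih vh show *: "(\<integral>\<^sup>+z. heat s z \<partial>lborel) = 1"
    by (subst nn_integral_eq_integral) auto
  show "(\<integral>\<^sup>+z. heat s (z - a) \<partial>lborel) = 1"
    using nn_integral_lborel_translate[of "\<lambda>z. ennreal (heat s z)" "-a"] * by simp
qed

text \<open>Completing the square in \<open>y\<close>: the product of the kernels is
  \<open>heat (s + e) x\<close> times a heat kernel at time \<open>s * e / (s + e)\<close> centred
  at \<open>s / (s + e)\<close> times \<open>x\<close>, and the latter has integral 1.\<close>

lemma heat_semigroup:
  assumes s: "s > 0" and e: "e > 0"
  shows "(\<integral>\<^sup>+y. ennreal (heat e (x - y)) * ennreal (heat s y) \<partial>lborel) = heat (s + e) x"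
proof -
  let ?c = "s / (s + e)" and ?r = "s * e / (s + e)"
  have r: "?r > 0" and se: "s + e > 0" using s e by simp_all
  have pr: "inverse (sqrt (4 * pi * e) ^ 3) * inverse (sqrt (4 * pi * s) ^ 3)
     = inverse (sqrt (4 * pi * (s + e)) ^ 3) * inverse (sqrt (4 * pi * ?r) ^ 3)"
  proof -
    have "(4 * pi * e) * (4 * pi * s) = (4 * pi * (s + e)) * (4 * pi * ?r)"
      using s e by (simp add: field_simps)
    then show ?thesis
      by (simp only: inverse_mult_distrib[symmetric] power_mult_distrib[symmetric] real_sqrt_mult[symmetric])
  qed
  have ex: "(norm (x - y))\<^sup>2 / (4*e) + (norm y)\<^sup>2 / (4 * s) = (norm x)\<^sup>2 / (4*(s+e)) + (norm (y - ?c *\<^sub>R x))\<^sup>2 / (4*?r)" for y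
  proof -
    have "(norm (x - y))\<^sup>2 = (norm x)\<^sup>2 + (norm y)\<^sup>2 - 2 * (x \<bullet> y)"
      by (simp add: power2_norm_eq_inner inner_diff inner_commute)
    moreover have "(norm (y - ?c *\<^sub>R x))\<^sup>2 = (norm y)\<^sup>2 + ?c\<^sup>2 * (norm x)\<^sup>2 - 2 * ?c * (x \<bullet> y)"
      unfolding power2_norm_eq_inner by (simp add: inner_diff inner_commute power2_eq_square)
    ultimately have st: "(norm (x - y))\<^sup>2 = (norm x)\<^sup>2 + (norm y)\<^sup>2 - 2 * (x \<bullet> y)"
      "(norm (y - ?c *\<^sub>R x))\<^sup>2 = (norm y)\<^sup>2 + ?c\<^sup>2 * (norm x)\<^sup>2 - 2 * ?c * (x \<bullet> y)" .
    have gen: "(X + Y - 2*I) / (4*e) + Y / (4 * s) = X / (4*(s+e)) + (Y + ?c\<^sup>2 * X - 2 * ?c * I) / (4*?r)" for X Y I :: real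
    proof -
      have "s + e \<noteq> 0" "s \<noteq> 0" "e \<noteq> 0" using s e by auto
      then show ?thesis by (simp add: divide_simps) algebra
    qed
    show ?thesis unfolding st by (rule gen)
  qed
  have "heat e (x - y) * heat s y = heat (s+e) x * heat ?r (y - ?c *\<^sub>R x)" for y
  proof -
    have "heat e (x - y) * heat s y = (inverse (sqrt (4 * pi * e) ^ 3) * inverse (sqrt (4 * pi * s) ^ 3)) * exp (- ((norm (x - y))\<^sup>2 / (4*e) + (norm y)\<^sup>2 / (4 * s)))"
      using s e by (simp add: heat_eq exp_add[symmetric] algebra_simps)
    also have "\<dots> = heat (s+e) x * heat ?r (y - ?c *\<^sub>R x)"
      unfolding pr ex heat_eq[OF se] heat_eq[OF r] by (simp only: minus_add_distrib exp_add minus_divide_left mult.assoc mult.left_commute)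
    finally show ?thesis .
  qed
  then have "(\<integral>\<^sup>+y. ennreal (heat e (x - y)) * ennreal (heat s y) \<partial>lborel)
     = (\<integral>\<^sup>+y. ennreal (heat (s+e) x) * ennreal (heat ?r (y - ?c *\<^sub>R x)) \<partial>lborel)"
    by (simp add: ennreal_mult[symmetric])
  also have "\<dots> = heat (s+e) x"
    by (subst nn_integral_cmult) (auto simp: nn_integral_heat(1)[OF r])
  finally show ?thesis .
qed

subsection \<open>Square-integrable functions\<close>

definition ip :: "fn3 \<Rightarrow> fn3 \<Rightarrow> complex" where
  "ip f g = (LINT x|lborel. f x * cnj (g x))"

lemma borel_measurable_cnj [measurable (raw)]:
  "f \<in> borel_measurable M \<Longrightarrow> (\<lambda>x. cnj (f x)) \<in> borel_measurable M"
  by (rule borel_measurable_continuous_on[OF continuous_on_cnj[OF continuous_on_id]])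

lemma L2_iff: "L2 f \<longleftrightarrow> f \<in> borel_measurable borel \<and> integrable lborel (\<lambda>x. (cmod (f x))\<^sup>2)"
  by (auto simp: L2_def integrable_iff_bounded)

lemma L2_measurable: "L2 f \<Longrightarrow> f \<in> borel_measurable borel"
  by (simp add: L2_iff)

lemma L2_integrable: "L2 f \<Longrightarrow> integrable lborel (\<lambda>x. (cmod (f x))\<^sup>2)"
  by (simp add: L2_iff)

lemma L2norm2_eq: "f \<in> borel_measurable borel \<Longrightarrow> L2norm2 f = (LINT x|lborel. (cmod (f x))\<^sup>2)"
  unfolding L2norm2_def by (subst integral_eq_nn_integral) auto

lemma L2norm2_nonneg [simp]: "L2norm2 f \<ge> 0"
  by (simp add: L2norm2_def)

lemma nn_integral_L2: "L2 f \<Longrightarrow> (\<integral>\<^sup>+x. ennreal ((cmod (f x))\<^sup>2) \<partial>lborel) = ennreal (L2norm2 f)"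
  by (simp add: L2norm2_eq L2_measurable nn_integral_eq_integral L2_integrable)

lemma cmod_add_sq_le: "(cmod (a + b))\<^sup>2 \<le> 2 * (cmod a)\<^sup>2 + 2 * (cmod b)\<^sup>2"
  using norm_triangle_ineq[of a b] sum_squares_bound[of "cmod a" "cmod b"]
  by (smt (verit) norm_ge_zero power2_sum power_mono)

lemma L2_bound:
  assumes "L2 f" "g \<in> borel_measurable borel" "\<And>x. cmod (g x) \<le> c * cmod (f x)"
  shows "L2 g"
  unfolding L2_iff
proof
  show "integrable lborel (\<lambda>x. (cmod (g x))\<^sup>2)"
  proof (rule Bochner_Integration.integrable_bound)
    show "integrable lborel (\<lambda>x. c\<^sup>2 * (cmod (f x))\<^sup>2)" using L2_integrable[OF assms(1)] by simp
    show "AE x in lborel. norm ((cmod (g x))\<^sup>2) \<le> norm (c\<^sup>2 * (cmod (f x))\<^sup>2)"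
      using power_mono[OF assms(3) norm_ge_zero, of _ 2] by (auto simp: power_mult_distrib)
  qed (use assms(2) in measurable)
qed fact

lemma L2_add:
  assumes "L2 f" "L2 g" shows "L2 (\<lambda>x. f x + g x)"
proof -
  note [measurable] = L2_measurable[OF assms(1)] L2_measurable[OF assms(2)]
  show ?thesis
    unfolding L2_iff
  proof
    show "integrable lborel (\<lambda>x. (cmod (f x + g x))\<^sup>2)"
    proof (rule Bochner_Integration.integrable_bound)
      show "integrable lborel (\<lambda>x. 2 * (cmod (f x))\<^sup>2 + 2 * (cmod (g x))\<^sup>2)"
        using L2_integrable[OF assms(1)] L2_integrable[OF assms(2)] by simp
    qed (use cmod_add_sq_le in auto)
  qed measurable
qed

lemma L2_cmult: 
  assumes "L2 f" shows "L2 (\<lambda>x. c * f x)"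
proof (rule L2_bound[OF assms, where c="cmod c"])
  note [measurable] = L2_measurable[OF assms]
  show "(\<lambda>x. c * f x) \<in> borel_measurable borel" by measurable
qed (simp add: norm_mult)

lemma L2_diff: "L2 f \<Longrightarrow> L2 g \<Longrightarrow> L2 (\<lambda>x. f x - g x)"
  using L2_add[of f "\<lambda>x. (-1) * g x"] L2_cmult[of g "-1"] by simp

lemma L2norm2_cmult: "f \<in> borel_measurable borel \<Longrightarrow> L2norm2 (\<lambda>x. c * f x) = (cmod c)\<^sup>2 * L2norm2 f"
  by (simp add: L2norm2_eq norm_mult power_mult_distrib)

lemma L2_mult_integrable:
  assumes "L2 f" "L2 g" shows "integrable lborel (\<lambda>x. f x * cnj (g x))"
    "integrable lborel (\<lambda>x. cmod (f x) * cmod (g x))"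
proof -
  note [measurable] = L2_measurable[OF assms(1)] L2_measurable[OF assms(2)]
  have i: "integrable lborel (\<lambda>x. (cmod (f x))\<^sup>2 + (cmod (g x))\<^sup>2)"
    using L2_integrable[OF assms(1)] L2_integrable[OF assms(2)] by simp
  have b: "cmod (f x) * cmod (g x) \<le> (cmod (f x))\<^sup>2 + (cmod (g x))\<^sup>2" for x
    using sum_squares_bound[of "cmod (f x)" "cmod (g x)"] mult_nonneg_nonneg[OF norm_ge_zero[of "f x"] norm_ge_zero[of "g x"]]
    unfolding mult.assoc by linarith
  show "integrable lborel (\<lambda>x. f x * cnj (g x))"
    by (rule Bochner_Integration.integrable_bound[OF i]) (use b in \<open>auto simp: norm_mult\<close>)
  show "integrable lborel (\<lambda>x. cmod (f x) * cmod (g x))"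
    by (rule Bochner_Integration.integrable_bound[OF i]) (use b in \<open>auto simp: norm_mult\<close>)
qed

lemma ip_add_left: "L2 f \<Longrightarrow> L2 g \<Longrightarrow> L2 h \<Longrightarrow> ip (\<lambda>x. f x + g x) h = ip f h + ip g h"
  unfolding ip_def by (simp add: ring_distribs L2_mult_integrable)

lemma ip_add_right: "L2 f \<Longrightarrow> L2 g \<Longrightarrow> L2 h \<Longrightarrow> ip h (\<lambda>x. f x + g x) = ip h f + ip h g"
  unfolding ip_def by (simp add: ring_distribs L2_mult_integrable)

lemma ip_diff_left: "L2 f \<Longrightarrow> L2 g \<Longrightarrow> L2 h \<Longrightarrow> ip (\<lambda>x. f x - g x) h = ip f h - ip g h"
  unfolding ip_def by (simp add: ring_distribs L2_mult_integrable)

lemma ip_diff_right: "L2 f \<Longrightarrow> L2 g \<Longrightarrow> L2 h \<Longrightarrow> ip h (\<lambda>x. f x - g x) = ip h f - ip h g"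
  unfolding ip_def by (simp add: ring_distribs L2_mult_integrable)

lemma ip_cmult_left: "ip (\<lambda>x. c * f x) h = c * ip f h"
  unfolding ip_def by (simp add: mult.assoc)

lemma ip_cmult_right: "ip h (\<lambda>x. c * f x) = cnj c * ip h f"
  unfolding ip_def by (simp add: mult.left_commute)

lemma ip_commute: "ip g f = cnj (ip f g)"
proof -
  have "cnj (ip f g) = (LINT x|lborel. cnj (f x * cnj (g x)))"
    unfolding ip_def by (rule Bochner_Integration.integral_cnj[symmetric])
  then show ?thesis by (simp add: ip_def mult.commute)
qed

lemma ip_self: "f \<in> borel_measurable borel \<Longrightarrow> ip f f = complex_of_real (L2norm2 f)"
  unfolding ip_def L2norm2_eq by (simp add: complex_norm_square[symmetric] flip: of_real_power)

section \<open>Polarisation, Cauchy-Schwarz and convergence in \<open>L2\<close>\<close>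

lemma L2norm2_add:
  assumes "L2 f" "L2 g"
  shows "L2norm2 (\<lambda>x. f x + g x) = L2norm2 f + L2norm2 g + 2 * Re (ip f g)"
proof -
  have "complex_of_real (L2norm2 (\<lambda>x. f x + g x)) = ip (\<lambda>x. f x + g x) (\<lambda>x. f x + g x)"
    by (simp add: ip_self L2_measurable L2_add assms)
  also have "\<dots> = ip f f + ip g g + (ip f g + cnj (ip f g))"
    using assms by (simp add: ip_add_left ip_add_right L2_add ip_commute[of g f])
  also have "\<dots> = complex_of_real (L2norm2 f + L2norm2 g + 2 * Re (ip f g))"
    using assms by (simp add: ip_self L2_measurable complex_add_cnj)
  finally show ?thesis by (simp only: of_real_eq_iff)
qed

lemma L2norm2_diff:
  assumes "L2 f" "L2 g"
  shows "L2norm2 (\<lambda>x. f x - g x) = L2norm2 f + L2norm2 g - 2 * Re (ip f g)"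
  using L2norm2_add[OF assms(1) L2_cmult[OF assms(2), of "-1"]] L2norm2_cmult[OF L2_measurable[OF assms(2)], of "-1"]
    ip_cmult_right[of f "-1" g] by simp

text \<open>The quadratic polynomial obtained by integrating \<open>(s * a x + b x)^2\<close> is
  nonnegative for every \<open>s\<close>; evaluating it at its minimiser gives the
  inequality.\<close>

lemma cauchy_schwarz_integral:
  fixes a b :: "'a \<Rightarrow> real"
  assumes [measurable]: "a \<in> borel_measurable M" "b \<in> borel_measurable M"
    and a: "integrable M (\<lambda>x. (a x)\<^sup>2)" and b: "integrable M (\<lambda>x. (b x)\<^sup>2)"
  shows "integrable M (\<lambda>x. a x * b x)" "(LINT x|M. a x * b x)\<^sup>2 \<le> (LINT x|M. (a x)\<^sup>2) * (LINT x|M. (b x)\<^sup>2)"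
proof -
  show i: "integrable M (\<lambda>x. a x * b x)"
  proof (rule Bochner_Integration.integrable_bound)
    show "integrable M (\<lambda>x. (a x)\<^sup>2 + (b x)\<^sup>2)" using a b by simp
    have "\<bar>a x * b x\<bar> \<le> (a x)\<^sup>2 + (b x)\<^sup>2" for x
      using sum_squares_bound[of "\<bar>a x\<bar>" "\<bar>b x\<bar>"] mult_nonneg_nonneg[OF abs_ge_zero[of "a x"] abs_ge_zero[of "b x"]]
      unfolding abs_mult power2_abs mult.assoc by linarith
    then show "AE x in M. norm (a x * b x) \<le> norm ((a x)\<^sup>2 + (b x)\<^sup>2)" by simp
  qed simp
  define A where "A = (LINT x|M. (a x)\<^sup>2)"
  define B where "B = (LINT x|M. (b x)\<^sup>2)"
  define C where "C = (LINT x|M. a x * b x)"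
  have q: "0 \<le> s\<^sup>2 * A + 2 * s * C + B" for s
  proof -
    have "0 \<le> (LINT x|M. (s * a x + b x)\<^sup>2)" by simp
    also have "(\<lambda>x. (s * a x + b x)\<^sup>2) = (\<lambda>x. s\<^sup>2 * (a x)\<^sup>2 + 2 * s * (a x * b x) + (b x)\<^sup>2)"
      by (auto simp: power2_eq_square algebra_simps)
    also have "(LINT x|M. \<dots> x) = s\<^sup>2 * A + 2 * s * C + B"
      using a b i by (simp add: A_def B_def C_def)
    finally show ?thesis .
  qed
  have A0: "A \<ge> 0" by (simp add: A_def)
  have "C\<^sup>2 \<le> A * B"
  proof (cases "A = 0")
    case True
    have "C = 0"
    proof (rule ccontr)
      assume "C \<noteq> 0"
      \<comment> \<open>With \<open>A = 0\<close> the polynomial is affine in \<open>s\<close>, and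
        at this point it takes the value -1.\<close>
      with q[of "- (B + 1) / (2 * C)"] True show False by (simp add: field_simps)
    qed
    then show ?thesis using True by simp
  next
    case False
    then have "A > 0" using A0 by simp
    with q[of "- C / A"] have "0 \<le> (C\<^sup>2 / A) - 2 * (C\<^sup>2 / A) + B"
      by (simp add: power2_eq_square)
    then have "C\<^sup>2 / A \<le> B" by simp
    then show ?thesis using \<open>A > 0\<close> by (simp add: field_simps)
  qed
  then show "(LINT x|M. a x * b x)\<^sup>2 \<le> (LINT x|M. (a x)\<^sup>2) * (LINT x|M. (b x)\<^sup>2)"
    by (simp add: A_def B_def C_def)
qed

lemma L2_cauchy_schwarz:
  assumes "L2 f" "L2 g"
  shows "(LINT x|lborel. cmod (f x) * cmod (g x)) \<le> sqrt (L2norm2 f * L2norm2 g)"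
    and "cmod (ip f g) \<le> sqrt (L2norm2 f * L2norm2 g)"
proof -
  note [measurable] = L2_measurable[OF assms(1)] L2_measurable[OF assms(2)]
  have "(LINT x|lborel. cmod (f x) * cmod (g x))\<^sup>2 \<le> L2norm2 f * L2norm2 g"
    using cauchy_schwarz_integral(2)[OF _ _ L2_integrable[OF assms(1)] L2_integrable[OF assms(2)]]
    by (simp add: L2norm2_eq)
  then show *: "(LINT x|lborel. cmod (f x) * cmod (g x)) \<le> sqrt (L2norm2 f * L2norm2 g)"
    by (rule real_le_rsqrt)
  have "cmod (ip f g) \<le> (LINT x|lborel. cmod (f x * cnj (g x)))"
    unfolding ip_def by (rule integral_norm_bound)
  also have "\<dots> = (LINT x|lborel. cmod (f x) * cmod (g x))" by (simp add: norm_mult)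
  finally show "cmod (ip f g) \<le> sqrt (L2norm2 f * L2norm2 g)" using * by simp
qed

text \<open>The difference of the pairings splits into one term quadratic in the errors and two
  linear ones, each controlled by Cauchy-Schwarz.\<close>

lemma L2_tendsto_ip:
  assumes f: "L2 f" "\<And>i. L2 (F i)" "((\<lambda>i. L2norm2 (\<lambda>x. F i x - f x)) \<longlongrightarrow> 0) S"
    and g: "L2 g" "\<And>i. L2 (G i)" "((\<lambda>i. L2norm2 (\<lambda>x. G i x - g x)) \<longlongrightarrow> 0) S"
  shows "((\<lambda>i. ip (F i) (G i)) \<longlongrightarrow> ip f g) S"
proof -
  have eq: "ip (F i) (G i) - ip f g = ip (\<lambda>x. F i x - f x) (\<lambda>x. G i x - g x) + ip (\<lambda>x. F i x - f x) g + ip f (\<lambda>x. G i x - g x)" for i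
    using f(1,2) g(1,2) by (simp add: ip_diff_left ip_diff_right L2_diff)
  let ?a = "\<lambda>i. L2norm2 (\<lambda>x. F i x - f x)" and ?b = "\<lambda>i. L2norm2 (\<lambda>x. G i x - g x)"
  have "((\<lambda>i. ip (F i) (G i) - ip f g) \<longlongrightarrow> 0) S"
  proof (rule Lim_null_comparison)
    show "\<forall>\<^sub>F i in S. norm (ip (F i) (G i) - ip f g) \<le> sqrt (?a i * ?b i) + sqrt (?a i * L2norm2 g) + sqrt (L2norm2 f * ?b i)"
      unfolding eq using f(1,2) g(1,2)
      by (intro always_eventually allI order_trans[OF norm_triangle_ineq] add_mono L2_cauchy_schwarz L2_diff) auto
    have "((\<lambda>i. sqrt (?a i * ?b i) + sqrt (?a i * L2norm2 g) + sqrt (L2norm2 f * ?b i)) \<longlongrightarrow>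
        sqrt (0 * 0) + sqrt (0 * L2norm2 g) + sqrt (L2norm2 f * 0)) S"
      by (intro tendsto_intros f g)
    then show "((\<lambda>i. sqrt (?a i * ?b i) + sqrt (?a i * L2norm2 g) + sqrt (L2norm2 f * ?b i)) \<longlongrightarrow> 0) S" by simp
  qed
  then show ?thesis by (simp add: LIM_zero_iff)
qed

lemma L2_tendsto_norm:
  assumes f: "L2 f" "\<And>i. L2 (F i)" "((\<lambda>i. L2norm2 (\<lambda>x. F i x - f x)) \<longlongrightarrow> 0) S"
  shows "((\<lambda>i. L2norm2 (F i)) \<longlongrightarrow> L2norm2 f) S"
  using tendsto_Re[OF L2_tendsto_ip[OF f f]] f by (simp add: ip_self L2_measurable)

lemma L2norm2_eq_0:
  assumes "L2 f" "L2norm2 f = 0" shows "AE x in lborel. f x = 0"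
  using integral_nonneg_eq_0_iff_AE[OF L2_integrable[OF assms(1)]] assms(2)
  by (simp add: L2norm2_eq L2_measurable[OF assms(1)])

lemma L2_translate:
  assumes "L2 f" shows "L2 (\<lambda>x. f (x + h))" "L2norm2 (\<lambda>x. f (x + h)) = L2norm2 f"
proof -
  note [measurable] = L2_measurable[OF assms(1)]
  have *: "(\<integral>\<^sup>+x. ennreal ((cmod (f (x + h)))\<^sup>2) \<partial>lborel) = (\<integral>\<^sup>+x. ennreal ((cmod (f x))\<^sup>2) \<partial>lborel)"
    using nn_integral_lborel_translate[of "\<lambda>x. ennreal ((cmod (f x))\<^sup>2)" h] by (simp add: add.commute)
  show "L2 (\<lambda>x. f (x + h))" using assms * unfolding L2_def by simp
  show "L2norm2 (\<lambda>x. f (x + h)) = L2norm2 f" using * unfolding L2norm2_def by simp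
qed

subsection \<open>Continuity of translations\<close>

text \<open>Regularity of the measure: for a compact \<open>K\<close> inside \<open>A\<close> and an
  open \<open>U\<close> around \<open>K\<close>, both with small excess, short translations carry
  \<open>K\<close> into \<open>U\<close>. So \<open>A\<close> and its translate differ only inside
  \<open>A - K\<close>, \<open>U - K\<close> and their translates, which accounts for the factor
  4.\<close>

lemma L1_translation_indicator:
  fixes A :: "'a::euclidean_space set"
  assumes A: "A \<in> sets lborel" "emeasure lborel A < \<infinity>" and e: "e > 0"
  shows "\<forall>\<^sub>F h in at 0. (\<integral>\<^sup>+x. ennreal \<bar>indicator A (x + h) - indicator A x\<bar> \<partial>lborel) \<le> ennreal (4 * e)"
proof -
  have A': "A \<in> lmeasurable" "A \<in> sets borel" using A by (auto simp: fmeasurable_def)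
  \<comment> \<open>Inner approximation yields a closed set only; intersecting it with a large ball
    makes it compact and costs the second half of \<open>e\<close>.\<close>
  obtain K where K: "compact K" "K \<subseteq> A" "emeasure lborel (A - K) \<le> ennreal e"
  proof -
    obtain S where S: "closed S" "S \<subseteq> A" "emeasure lebesgue (A - S) < ennreal (e / 2)"
      using sets_lebesgue_inner_closed[of A "e / 2"] A' e by (metis fmeasurableD half_gt_zero)
    have [measurable]: "S \<in> sets borel" "A \<in> sets borel" using S(1) A' by auto
    have "(\<lambda>n::nat. emeasure lborel (A - cball 0 (real n))) \<longlonglongrightarrow> emeasure lborel (\<Inter>n::nat. A - cball 0 (real n))"
    proof (rule Lim_emeasure_decseq)
      show "emeasure lborel (A - cball 0 (real n)) \<noteq> \<infinity>" for n
        using A(2) emeasure_mono[of "A - cball 0 (real n)" A lborel] by (auto simp: top_unique)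
    qed (auto simp: decseq_def)
    also have "(\<Inter>n::nat. A - cball 0 (real n)) = {}"
    proof -
      have "\<exists>n::nat. norm x \<le> real n" for x :: 'a by (rule real_arch_simple)
      then show ?thesis by auto
    qed
    finally have l: "(\<lambda>n::nat. emeasure lborel (A - cball 0 (real n))) \<longlonglongrightarrow> 0" by simp
    have "ennreal (e / 2) > 0" using e by simp
    from eventually_happens'[OF _ order_tendstoD(2)[OF l this]]
    obtain n :: nat where n: "emeasure lborel (A - cball 0 (real n)) < ennreal (e / 2)" by auto
    have "emeasure lborel (A - (S \<inter> cball 0 n)) \<le> emeasure lborel ((A - S) \<union> (A - cball 0 (real n)))"
      by (intro emeasure_mono) auto
    also have "\<dots> \<le> emeasure lborel (A - S) + emeasure lborel (A - cball 0 (real n))"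
      by (intro emeasure_subadditive) auto
    also have "\<dots> \<le> ennreal (e / 2) + ennreal (e / 2)"
      using S(3) n by (intro add_mono) auto
    also have "\<dots> = ennreal e" using e by (simp flip: ennreal_plus)
    finally show ?thesis using S that[of "S \<inter> cball 0 n"] by (auto simp: closed_Int_compact)
  qed
  obtain U where U: "open U" "K \<subseteq> U" "U - K \<in> lmeasurable" "emeasure lebesgue (U - K) < ennreal e"
    by (rule sets_lebesgue_outer_open[OF fmeasurableD[OF lmeasurable_compact[OF K(1)]] e])
  obtain d where d: "d > 0" "\<And>x h. x \<in> K \<Longrightarrow> norm h < d \<Longrightarrow> x + h \<in> U"
  proof -
    obtain d where "d > 0" "(\<Union>x\<in>K. ball x d) \<subseteq> U"
      using compact_subset_open_imp_ball_epsilon_subset[OF K(1) U(1,2)] by blast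
    then have "x \<in> K \<Longrightarrow> norm h < d \<Longrightarrow> x + h \<in> U" for x h
    proof -
      assume "x \<in> K" "norm h < d"
      then have "x + h \<in> ball x d" by (simp add: dist_norm)
      with \<open>x \<in> K\<close> \<open>(\<Union>x\<in>K. ball x d) \<subseteq> U\<close> show "x + h \<in> U" by blast
    qed
    with \<open>d > 0\<close> show ?thesis by (rule that)
  qed
  have Kb [measurable]: "K \<in> sets borel" "U \<in> sets borel" "A \<in> sets borel" using K U A by (auto simp: borel_compact)
  have mAK: "emeasure lborel (A - K) \<le> ennreal e"
    by (rule K(3))
  have mUK: "emeasure lborel (U - K) \<le> ennreal e"
    using U(4) by simp
  have tr: "(\<integral>\<^sup>+x. indicator B (x + h) \<partial>lborel) = emeasure lborel B" if [measurable]: "B \<in> sets borel" for B :: "'a set" and h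
    using nn_integral_lborel_translate[of "indicator B" h] by (simp add: add.commute)
  have "(\<integral>\<^sup>+x. ennreal \<bar>indicator A (x + h) - indicator A x\<bar> \<partial>lborel) \<le> ennreal (4 * e)" if h: "norm h < d" for h
  proof -
    have pw: "ennreal \<bar>indicator A (x + h) - indicator A x\<bar>
       \<le> indicator (A - K) (x + h) + indicator (A - K) x + (indicator (U - K) (x + h) + indicator (U - K) x)" for x
    proof -
      have s4: "a \<le> a + b + (c + d)" "b \<le> a + b + (c + d)" "c \<le> a + b + (c + d)" "d \<le> a + b + (c + d)" for a b c d :: ennreal
        by (auto intro: add_increasing add_increasing2)
      have le1: "ennreal \<bar>indicat_real A (x + h) - indicat_real A x\<bar> \<le> 1"
        by (cases "x \<in> A"; cases "x + h \<in> A") simp_all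
      have one: "indicator B y = (1::ennreal)" if "y \<in> B" for B and y :: 'a using that by simp
      have "x \<in> U" if "x + h \<in> K" using d(2)[OF that, of "-h"] h by simp
      moreover have "x + h \<in> U" if "x \<in> K" using d(2)[OF that, of h] h by simp
      \<comment> \<open>If exactly one of \<open>x\<close> and \<open>x + h\<close> lies in
        \<open>A\<close>, that point is either in \<open>A - K\<close>, or in \<open>K\<close>; in
        the latter case the other point is in \<open>U\<close> but outside \<open>A\<close>, hence
        in \<open>U - K\<close>.\<close>
      ultimately consider "indicat_real A (x + h) = indicat_real A x" | "x + h \<in> A - K" | "x \<in> A - K" | "x \<in> U - K" | "x + h \<in> U - K"
        using K(2) by (cases "x \<in> A"; cases "x + h \<in> A") auto
      then show ?thesis
      proof cases
        case 2
        have "ennreal \<bar>indicat_real A (x + h) - indicat_real A x\<bar> \<le> indicator (A - K) (x + h)" unfolding one[OF 2] by (rule le1)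
        then show ?thesis by (rule order_trans[OF _ s4(1)])
      next
        case 3
        have "ennreal \<bar>indicat_real A (x + h) - indicat_real A x\<bar> \<le> indicator (A - K) x" unfolding one[OF 3] by (rule le1)
        then show ?thesis by (rule order_trans[OF _ s4(2)])
      next
        case 4
        have "ennreal \<bar>indicat_real A (x + h) - indicat_real A x\<bar> \<le> indicator (U - K) x" unfolding one[OF 4] by (rule le1)
        then show ?thesis by (rule order_trans[OF _ s4(4)])
      next
        case 5
        have "ennreal \<bar>indicat_real A (x + h) - indicat_real A x\<bar> \<le> indicator (U - K) (x + h)" unfolding one[OF 5] by (rule le1)
        then show ?thesis by (rule order_trans[OF _ s4(3)])
      qed simp
    qed
    have "(\<integral>\<^sup>+x. ennreal \<bar>indicator A (x + h) - indicator A x\<bar> \<partial>lborel) \<le>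
      (\<integral>\<^sup>+x. indicator (A - K) (x + h) + indicator (A - K) x + (indicator (U - K) (x + h) + indicator (U - K) x) \<partial>lborel)"
      by (intro nn_integral_mono pw)
    also have "\<dots> = emeasure lborel (A - K) + emeasure lborel (A - K) + (emeasure lborel (U - K) + emeasure lborel (U - K))"
      by (simp add: nn_integral_add tr)
    also have "\<dots> \<le> (ennreal e + ennreal e) + (ennreal e + ennreal e)"
      by (intro add_mono mAK mUK)
    also have "\<dots> = ennreal (4 * e)" using e by (simp flip: ennreal_plus)
    finally show ?thesis .
  qed
  then have "\<forall>h\<in>UNIV. h \<noteq> 0 \<and> dist h 0 < d \<longrightarrow> (\<integral>\<^sup>+x. ennreal \<bar>indicator A (x + h) - indicator A x\<bar> \<partial>lborel) \<le> ennreal (4 * e)"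
    unfolding dist_0_norm dist_norm diff_0_right by blast
  with d(1) show ?thesis
    unfolding eventually_at by (intro exI[of _ d] conjI)
qed

lemma tendsto_ennreal_zeroI:
  fixes f :: "'a \<Rightarrow> ennreal"
  assumes "\<And>e::real. e > 0 \<Longrightarrow> \<forall>\<^sub>F x in F. f x \<le> ennreal e"
  shows "(f \<longlongrightarrow> 0) F"
proof (rule order_tendstoI)
  fix a :: ennreal assume "0 < a"
  then obtain q where q: "0 < q" "q < a" using dense by blast
  then obtain r :: real where "q = ennreal r" "r \<ge> 0" by (cases q) auto
  with q have r: "ennreal r < a" and "r > 0" by (auto simp: ennreal_less_zero_iff)
  from assms[OF \<open>r > 0\<close>] show "\<forall>\<^sub>F x in F. f x < a"
    by eventually_elim (use r in auto)
qed simp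

text \<open>Induction over integrable functions. In the limit case translation invariance makes the
  approximation error of the translated function independent of \<open>h\<close>, so three thirds of
  \<open>e\<close> suffice.\<close>

lemma L1_translation_continuous:
  fixes f :: "'a::euclidean_space \<Rightarrow> 'b::{banach, second_countable_topology}"
  assumes "integrable lborel f"
  shows "((\<lambda>h. \<integral>\<^sup>+x. ennreal (norm (f (x + h) - f x)) \<partial>lborel) \<longlongrightarrow> 0) (at 0)"
  using assms
proof (induction rule: integrable_induct)
  case (base A c)
  show ?case
  proof (rule tendsto_ennreal_zeroI)
    fix e :: real assume e: "e > 0"
    define e' where "e' = e / (4 * (norm c + 1))"
    have e': "e' > 0" using e by (simp add: e'_def add_nonneg_pos)
    have [measurable]: "A \<in> sets borel" using base by simp
    have "norm c * (4 * e') \<le> e"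
      using e by (simp add: e'_def divide_simps add_nonneg_pos add_pos_nonneg mult_left_mono) 
    then have le: "ennreal (norm c) * ennreal (4 * e') \<le> ennreal e"
      using e' by (simp add: ennreal_mult[symmetric] ennreal_leI)
    show "\<forall>\<^sub>F h in at 0. (\<integral>\<^sup>+x. ennreal (norm (indicat_real A (x + h) *\<^sub>R c - indicat_real A x *\<^sub>R c)) \<partial>lborel) \<le> ennreal e"
      using L1_translation_indicator[OF base e']
    proof eventually_elim
      case (elim h)
      have "(\<integral>\<^sup>+x. ennreal (norm (indicat_real A (x + h) *\<^sub>R c - indicat_real A x *\<^sub>R c)) \<partial>lborel)
         = (\<integral>\<^sup>+x. ennreal (norm c) * ennreal \<bar>indicat_real A (x + h) - indicat_real A x\<bar> \<partial>lborel)"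
        by (intro nn_integral_cong) (simp add: scaleR_left_diff_distrib[symmetric] ennreal_mult[symmetric] mult.commute)
      also have "\<dots> = ennreal (norm c) * (\<integral>\<^sup>+x. ennreal \<bar>indicat_real A (x + h) - indicat_real A x\<bar> \<partial>lborel)"
        by (rule nn_integral_cmult) measurable
      also have "\<dots> \<le> ennreal (norm c) * ennreal (4 * e')"
        by (intro mult_left_mono elim) simp
      finally show ?case using le by (rule order_trans)
    qed
  qed
next
  case (add f g)
  have [measurable]: "f \<in> borel_measurable borel" "g \<in> borel_measurable borel" using add by auto
  show ?case
  proof (rule tendsto_sandwich[OF _ _ tendsto_const])
    show "\<forall>\<^sub>F h in at 0. (\<integral>\<^sup>+x. ennreal (norm (f (x + h) + g (x + h) - (f x + g x))) \<partial>lborel)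
       \<le> (\<integral>\<^sup>+x. ennreal (norm (f (x + h) - f x)) \<partial>lborel) + (\<integral>\<^sup>+x. ennreal (norm (g (x + h) - g x)) \<partial>lborel)"
    proof (intro always_eventually allI)
      fix h
      show "(\<integral>\<^sup>+x. ennreal (norm (f (x + h) + g (x + h) - (f x + g x))) \<partial>lborel)
       \<le> (\<integral>\<^sup>+x. ennreal (norm (f (x + h) - f x)) \<partial>lborel) + (\<integral>\<^sup>+x. ennreal (norm (g (x + h) - g x)) \<partial>lborel)"
        by (subst nn_integral_add[symmetric])
          (auto intro!: nn_integral_mono ennreal_leI simp: add_diff_add norm_triangle_ineq simp flip: ennreal_plus)
    qed
    show "((\<lambda>h. (\<integral>\<^sup>+x. ennreal (norm (f (x + h) - f x)) \<partial>lborel) + (\<integral>\<^sup>+x. ennreal (norm (g (x + h) - g x)) \<partial>lborel)) \<longlongrightarrow> 0) (at 0)"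
      using tendsto_add[OF add(3,4)] by simp
  qed auto
next
  case (lim f s)
  have [measurable]: "f \<in> borel_measurable borel" "\<And>i. s i \<in> borel_measurable borel" using lim by auto
  have l: "(\<lambda>i. \<integral>\<^sup>+x. ennreal (norm (f x - s i x)) \<partial>lborel) \<longlonglongrightarrow> 0"
  proof -
    have "(\<integral>\<^sup>+x. ennreal (2 * norm (f x)) \<partial>lborel) < \<infinity>"
      using lim.hyps by (simp add: ennreal_mult nn_integral_cmult integrable_iff_bounded ennreal_mult_less_top)
    then show ?thesis
      using lim.hyps by (intro nn_integral_dominated_convergence_norm[where w="\<lambda>x. 2 * norm (f x)"]) auto
  qed
  show ?case
  proof (rule tendsto_ennreal_zeroI)
    fix e :: real assume e: "e > 0"
    have "ennreal (e / 3) > 0" using e by simp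
    from order_tendstoD(2)[OF l this] obtain i where i: "(\<integral>\<^sup>+x. ennreal (norm (f x - s i x)) \<partial>lborel) < ennreal (e / 3)"
      by (auto simp: eventually_sequentially)
    have "\<forall>\<^sub>F h in at 0. (\<integral>\<^sup>+x. ennreal (norm (s i (x + h) - s i x)) \<partial>lborel) < ennreal (e / 3)"
      using lim.IH[of i] \<open>ennreal (e / 3) > 0\<close> by (rule order_tendstoD(2))
    then show "\<forall>\<^sub>F h in at 0. (\<integral>\<^sup>+x. ennreal (norm (f (x + h) - f x)) \<partial>lborel) \<le> ennreal e"
    proof eventually_elim
      case (elim h)
      have t: "(\<integral>\<^sup>+x. ennreal (norm (f (x + h) - s i (x + h))) \<partial>lborel) = (\<integral>\<^sup>+x. ennreal (norm (f x - s i x)) \<partial>lborel)"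
        using nn_integral_lborel_translate[of "\<lambda>x. ennreal (norm (f x - s i x))" h] by (simp add: add.commute)
      have pw: "norm (f (x + h) - f x) \<le> norm (f (x + h) - s i (x + h)) + norm (f x - s i x) + norm (s i (x + h) - s i x)" for x
      proof -
        have "f (x + h) - f x = (f (x + h) - s i (x + h)) - (f x - s i x) + (s i (x + h) - s i x)" by simp
        then show ?thesis
          using norm_triangle_ineq[of "(f (x + h) - s i (x + h)) - (f x - s i x)" "s i (x + h) - s i x"]
            norm_triangle_ineq4[of "f (x + h) - s i (x + h)" "f x - s i x"] by simp
      qed
      have "(\<integral>\<^sup>+x. ennreal (norm (f (x + h) - f x)) \<partial>lborel) \<le>
        (\<integral>\<^sup>+x. ennreal (norm (f (x + h) - s i (x + h))) + ennreal (norm (f x - s i x)) + ennreal (norm (s i (x + h) - s i x)) \<partial>lborel)"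
        by (intro nn_integral_mono) (use pw in \<open>simp flip: ennreal_plus\<close>)
      also have "\<dots> = (\<integral>\<^sup>+x. ennreal (norm (f x - s i x)) \<partial>lborel) + (\<integral>\<^sup>+x. ennreal (norm (f x - s i x)) \<partial>lborel)
         + (\<integral>\<^sup>+x. ennreal (norm (s i (x + h) - s i x)) \<partial>lborel)"
        by (simp add: nn_integral_add t)
      also have "\<dots> \<le> ennreal (e/3) + ennreal (e/3) + ennreal (e/3)"
        using i elim by (intro add_mono) auto
      also have "\<dots> = ennreal e" using e by (simp flip: ennreal_plus)
      finally show ?case .
    qed
  qed
qed

subsection \<open>Plancherel's theorem via the heat kernel\<close>

text \<open>For \<open>f\<close> in \<open>L2\<close> this is
  \<open>2 (f, (1 - exp (e Delta)) f)\<close>. Written with differences in \<open>ennreal\<close>,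
  it is meaningful before square-integrable functions have a Fourier theory, and it is visibly
  monotone in the difference quotients.\<close>

definition shift_energy :: "real \<Rightarrow> fn3 \<Rightarrow> ennreal" where
  "shift_energy e f = (\<integral>\<^sup>+h. ennreal (heat e h) * (\<integral>\<^sup>+x. ennreal ((cmod (f (x + h) - f x))\<^sup>2) \<partial>lborel) \<partial>lborel)"

lemma integrable_tensor:
  fixes f g :: "'a::euclidean_space \<Rightarrow> complex"
  assumes "integrable lborel f" "integrable lborel g"
  shows "integrable (lborel \<Otimes>\<^sub>M lborel) (\<lambda>p. f (fst p) * g (snd p))"
proof -
  note [measurable] = borel_measurable_integrable[OF assms(1)] borel_measurable_integrable[OF assms(2)]
  have "integrable (lborel \<Otimes>\<^sub>M lborel) (\<lambda>(x, y). f x * g y)"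
  proof (rule lborel_pair.Fubini_integrable)
    show "integrable lborel (\<lambda>x. \<integral>y. norm (case (x, y) of (x, y) \<Rightarrow> f x * g y) \<partial>lborel)"
      using assms by (simp add: norm_mult)
    show "AE x in lborel. integrable lborel (\<lambda>y. case (x, y) of (x, y) \<Rightarrow> f x * g y)"
      using assms by simp
  qed (simp add: split_beta')
  then show ?thesis by (simp add: split_beta')
qed

lemma shift_energy_eq_pair:
  assumes [measurable]: "f \<in> borel_measurable borel"
  shows "shift_energy e f = (\<integral>\<^sup>+p. ennreal (heat e (fst p - snd p) * (cmod (f (fst p) - f (snd p)))\<^sup>2) \<partial>(lborel \<Otimes>\<^sub>M lborel))"
proof -
  have "shift_energy e f = (\<integral>\<^sup>+h. \<integral>\<^sup>+x. ennreal (heat e h) * ennreal ((cmod (f (x + h) - f x))\<^sup>2) \<partial>lborel \<partial>lborel)"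
    unfolding shift_energy_def by (simp add: nn_integral_cmult)
  also have "\<dots> = (\<integral>\<^sup>+x. \<integral>\<^sup>+h. ennreal (heat e h) * ennreal ((cmod (f (x + h) - f x))\<^sup>2) \<partial>lborel \<partial>lborel)"
    by (rule lborel_pair.Fubini') simp
  also have "\<dots> = (\<integral>\<^sup>+x. \<integral>\<^sup>+y. ennreal (heat e (y - x)) * ennreal ((cmod (f y - f x))\<^sup>2) \<partial>lborel \<partial>lborel)"
  proof (rule nn_integral_cong)
    fix x :: "real^3"
    show "(\<integral>\<^sup>+h. ennreal (heat e h) * ennreal ((cmod (f (x + h) - f x))\<^sup>2) \<partial>lborel)
       = (\<integral>\<^sup>+y. ennreal (heat e (y - x)) * ennreal ((cmod (f y - f x))\<^sup>2) \<partial>lborel)"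
      using nn_integral_lborel_translate[of "\<lambda>y. ennreal (heat e (y - x)) * ennreal ((cmod (f y - f x))\<^sup>2)" x] by simp
  qed
  also have "\<dots> = (\<integral>\<^sup>+p. ennreal (heat e (snd p - fst p)) * ennreal ((cmod (f (snd p) - f (fst p)))\<^sup>2) \<partial>(lborel \<Otimes>\<^sub>M lborel))"
    by (subst lborel.nn_integral_fst[symmetric]) simp_all
  finally show ?thesis
    by (simp add: ennreal_mult heat_commute[of e "fst _"] norm_minus_commute)
qed

lemma nn_integral_heat_pair:
  assumes [measurable]: "g \<in> borel_measurable borel" and e: "e > 0"
  shows "(\<integral>\<^sup>+p. ennreal (heat e (fst p - snd p)) * g (fst p) \<partial>(lborel \<Otimes>\<^sub>M lborel)) = (\<integral>\<^sup>+x. g x \<partial>lborel)"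
    and "(\<integral>\<^sup>+p. ennreal (heat e (fst p - snd p)) * g (snd p) \<partial>(lborel \<Otimes>\<^sub>M lborel)) = (\<integral>\<^sup>+x. g x \<partial>lborel)"
proof -
  have 1: "(\<integral>\<^sup>+y. ennreal (heat e (x - y)) \<partial>lborel) = 1" for x :: "real^3"
    using nn_integral_heat(1)[OF e, of x] by (simp add: heat_commute[of e x])
  show "(\<integral>\<^sup>+p. ennreal (heat e (fst p - snd p)) * g (fst p) \<partial>(lborel \<Otimes>\<^sub>M lborel)) = (\<integral>\<^sup>+x. g x \<partial>lborel)"
    by (subst lborel.nn_integral_fst[symmetric]) (simp_all add: nn_integral_multc 1)
  show "(\<integral>\<^sup>+p. ennreal (heat e (fst p - snd p)) * g (snd p) \<partial>(lborel \<Otimes>\<^sub>M lborel)) = (\<integral>\<^sup>+x. g x \<partial>lborel)"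
    by (subst lborel_pair.nn_integral_snd[symmetric]) (simp_all add: nn_integral_multc nn_integral_heat(1)[OF e])
qed

section \<open>The heat identity for integrable functions\<close>

lemma FT1_measurable [measurable]:
  assumes [measurable]: "f \<in> borel_measurable borel"
  shows "FT1 f \<in> borel_measurable borel"
  unfolding FT1_def[abs_def] by measurable

lemma FT1_bound:
  assumes "integrable lborel f"
  shows "cmod (FT1 f \<xi>) \<le> (LINT x|lborel. cmod (f x))"
proof -
  have "(2 * pi) powr (-3/2) \<le> 1"
  proof -
    have "(2 * pi) powr (-3/2) \<le> (2 * pi) powr 0" using pi_gt3 by (intro powr_mono) auto
    then show ?thesis by simp
  qed
  moreover have "cmod (LINT x|lborel. exp (- \<i> * complex_of_real (x \<bullet> \<xi>)) * f x) \<le> (LINT x|lborel. cmod (f x))"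
    by (rule order_trans[OF integral_norm_bound]) (simp add: norm_mult norm_exp_i_times)
  ultimately show ?thesis
    unfolding FT1_def norm_mult
    by (smt (verit) mult_left_le_one_le norm_ge_zero norm_of_real powr_ge_zero)
qed

text \<open>Writing the square as a double integral isolates the frequency in a phase, which can
  then be integrated against a Gaussian.\<close>

lemma FT1_sq:
  assumes "integrable lborel f"
  shows "complex_of_real ((cmod (FT1 f \<xi>))\<^sup>2) = complex_of_real (inverse ((2 * pi) ^ 3)) *
    (LINT p|(lborel \<Otimes>\<^sub>M lborel). iexp ((snd p - fst p) \<bullet> \<xi>) * (f (fst p) * cnj (f (snd p))))"
proof -
  note [measurable] = borel_measurable_integrable[OF assms]
  let ?e = "\<lambda>x. exp (- \<i> * complex_of_real (x \<bullet> \<xi>)) * f x"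
  have i: "integrable lborel ?e"
    by (rule Bochner_Integration.integrable_bound[OF assms]) (auto simp: norm_mult norm_exp_i_times)
  have "(2 * pi) powr (-3/2) * (2 * pi) powr (-3/2) = (2 * pi) powr (- 3)" by (simp flip: powr_add)
  also have "\<dots> = inverse ((2 * pi) ^ 3)" by (simp add: powr_minus powr_numeral)
  finally have c: "(2 * pi) powr (-3/2) * (2 * pi) powr (-3/2) = inverse ((2 * pi) ^ 3)" .
  have "complex_of_real ((cmod (FT1 f \<xi>))\<^sup>2) = FT1 f \<xi> * cnj (FT1 f \<xi>)"
    by (rule complex_norm_square)
  also have "\<dots> = complex_of_real ((2 * pi) powr (-3/2) * (2 * pi) powr (-3/2)) * ((LINT x|lborel. ?e x) * (LINT x|lborel. cnj (?e x)))"
  proof -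
    have "(LINT x|lborel. cnj (?e x)) = cnj (LINT x|lborel. ?e x)"
      by (rule Bochner_Integration.integral_cnj)
    then show ?thesis unfolding FT1_def complex_cnj_mult by (simp only: complex_cnj_complex_of_real of_real_mult mult_ac)
  qed
  also have "(LINT x|lborel. ?e x) * (LINT x|lborel. cnj (?e x)) = (LINT x|lborel. LINT y|lborel. ?e x * cnj (?e y))"
    by (simp add: mult.commute)
  also have "\<dots> = (LINT p|(lborel \<Otimes>\<^sub>M lborel). ?e (fst p) * cnj (?e (snd p)))"
    using lborel_pair.integral_fst'[OF integrable_tensor[OF i integrable_cnj[OF i]]] by simp
  also have "(\<lambda>p. ?e (fst p) * cnj (?e (snd p))) = (\<lambda>p. iexp ((snd p - fst p) \<bullet> \<xi>) * (f (fst p) * cnj (f (snd p))))"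
    by (auto simp: fun_eq_iff exp_cnj inner_diff_left exp_diff exp_minus field_simps)
  finally show ?thesis unfolding c .
qed

text \<open>The Gaussian factor makes the integrand absolutely integrable in \<open>\<xi>\<close>
  and both space variables together, so Fubini applies and the frequency integral becomes the heat
  kernel.\<close>

lemma FT1_heat:
  assumes f: "integrable lborel f" and e: "e > 0"
  shows "complex_of_real (LINT \<xi>|lborel. exp (- e * (norm \<xi>)\<^sup>2) * (cmod (FT1 f \<xi>))\<^sup>2)
    = (LINT p|(lborel \<Otimes>\<^sub>M lborel). complex_of_real (heat e (fst p - snd p)) * (f (fst p) * cnj (f (snd p))))"
    and "integrable lborel (\<lambda>\<xi>. exp (- e * (norm \<xi>)\<^sup>2) * (cmod (FT1 f \<xi>))\<^sup>2)"
proof -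
  note [measurable] = borel_measurable_integrable[OF f]
  let ?P = "lborel \<Otimes>\<^sub>M lborel :: ((real^3) \<times> (real^3)) measure"
  interpret P: sigma_finite_measure ?P by (simp add: lborel_prod sigma_finite_lborel)
  interpret PP: pair_sigma_finite "lborel :: (real^3) measure" ?P ..
  let ?F = "\<lambda>p. f (fst p) * cnj (f (snd p))"
  let ?g = "\<lambda>\<xi>::real^3. exp (- e * (norm \<xi>)\<^sup>2)"
  let ?K = "\<lambda>\<xi> p. complex_of_real (?g \<xi>) * (iexp ((snd p - fst p) \<bullet> \<xi>) * ?F p)"
  have F: "integrable ?P ?F" using integrable_tensor[OF f integrable_cnj[OF f]] .
  have g: "integrable lborel ?g" by (rule gaussian_integrable[OF e])
  have K: "integrable (lborel \<Otimes>\<^sub>M ?P) (case_prod ?K)"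
  proof (rule PP.Fubini_integrable)
    show "integrable lborel (\<lambda>\<xi>. \<integral>p. norm (case (\<xi>, p) of (\<xi>, p) \<Rightarrow> ?K \<xi> p) \<partial>?P)"
      using g by (simp add: norm_mult norm_exp_i_times del: exp_of_real of_real_exp)
    show "AE \<xi> in lborel. integrable ?P (\<lambda>p. case (\<xi>, p) of (\<xi>, p) \<Rightarrow> ?K \<xi> p)"
    proof (rule AE_I2)
      fix \<xi> :: "real^3"
      show "integrable ?P (\<lambda>p. case (\<xi>, p) of (\<xi>, p) \<Rightarrow> ?K \<xi> p)"
        unfolding prod.case
        by (rule integrable_mult_right, rule Bochner_Integration.integrable_bound[OF F]) (auto simp: norm_mult norm_exp_i_times)
    qed
  qed (simp add: split_beta')
  have gF: "exp (- e * (norm \<xi>)\<^sup>2) * (cmod (FT1 f \<xi>))\<^sup>2 \<le> (LINT x|lborel. cmod (f x))\<^sup>2 * ?g \<xi>" for \<xi>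
    using power_mono[OF FT1_bound[OF f, of \<xi>] norm_ge_zero, of 2] by (simp add: mult.commute)
  show int: "integrable lborel (\<lambda>\<xi>. exp (- e * (norm \<xi>)\<^sup>2) * (cmod (FT1 f \<xi>))\<^sup>2)"
    by (rule Bochner_Integration.integrable_bound[OF integrable_mult_right[OF g, of "(LINT x|lborel. cmod (f x))\<^sup>2"]])
      (use gF in auto)
  have "complex_of_real (LINT \<xi>|lborel. ?g \<xi> * (cmod (FT1 f \<xi>))\<^sup>2)
    = (LINT \<xi>|lborel. complex_of_real (?g \<xi>) * complex_of_real ((cmod (FT1 f \<xi>))\<^sup>2))"
    by (subst integral_complex_of_real[symmetric]) (simp only: of_real_mult)
  also have "\<dots> = complex_of_real (inverse ((2 * pi) ^ 3)) * (LINT \<xi>|lborel. LINT p|?P. ?K \<xi> p)"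
  proof -
    have *: "(LINT \<xi>|lborel. G \<xi> * (c * J \<xi>)) = c * (LINT \<xi>|lborel. G \<xi> * J \<xi>)" for G J :: "real^3 \<Rightarrow> complex" and c
      by (simp add: mult.left_commute[of _ c])
    show ?thesis unfolding FT1_sq[OF f] * by (simp only: integral_mult_right_zero)
  qed
  also have "(LINT \<xi>|lborel. LINT p|?P. ?K \<xi> p) = (LINT p|?P. LINT \<xi>|lborel. ?K \<xi> p)"
    by (rule PP.Fubini_integral[OF K, symmetric])
  also have "\<dots> = (LINT p|?P. complex_of_real ((2 * pi) ^ 3 * heat e (snd p - fst p)) * ?F p)"
  proof (rule Bochner_Integration.integral_cong)
    fix p
    have "(LINT \<xi>|lborel. ?K \<xi> p) = (LINT \<xi>|lborel. (iexp ((snd p - fst p) \<bullet> \<xi>) * complex_of_real (?g \<xi>)) * ?F p)"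
      by (rule Bochner_Integration.integral_cong) (auto simp: mult_ac)
    also have "\<dots> = complex_of_real ((2 * pi) ^ 3 * heat e (snd p - fst p)) * ?F p"
      by (simp only: Bochner_Integration.integral_mult_left_zero gaussian_fourier(2)[OF e])
    finally show "(LINT \<xi>|lborel. ?K \<xi> p) = complex_of_real ((2 * pi) ^ 3 * heat e (snd p - fst p)) * ?F p" .
  qed simp
  also have "complex_of_real (inverse ((2 * pi) ^ 3)) * \<dots> = (LINT p|?P. complex_of_real (heat e (fst p - snd p)) * ?F p)"
    unfolding integral_mult_right_zero[symmetric]
    by (rule Bochner_Integration.integral_cong) (auto simp: heat_commute[of e "snd _"])
  finally show "complex_of_real (LINT \<xi>|lborel. ?g \<xi> * (cmod (FT1 f \<xi>))\<^sup>2)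
    = (LINT p|?P. complex_of_real (heat e (fst p - snd p)) * ?F p)" .
qed

text \<open>Expand the square of \<open>f x - f y\<close>: each pure square gives the mass because
  the kernel has integral 1, and the cross term is \<open>FT1_heat\<close>. The identity is stated
  as a sum to stay clear of subtraction in \<open>ennreal\<close>.\<close>

lemma FT1_shift_energy:
  assumes f: "integrable lborel f" "L2 f" and e: "e > 0"
  shows "shift_energy e f + 2 * (\<integral>\<^sup>+\<xi>. ennreal (exp (- e * (norm \<xi>)\<^sup>2) * (cmod (FT1 f \<xi>))\<^sup>2) \<partial>lborel) = 2 * ennreal (L2norm2 f)"
proof -
  note [measurable] = borel_measurable_integrable[OF f(1)]
  let ?P = "lborel \<Otimes>\<^sub>M lborel :: ((real^3) \<times> (real^3)) measure"
  let ?h = "\<lambda>p::(real^3) \<times> (real^3). heat e (fst p - snd p)"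
  have s1: "(\<integral>\<^sup>+p. ennreal (?h p * (cmod (f (fst p)))\<^sup>2) \<partial>?P) = ennreal (L2norm2 f)"
    using nn_integral_heat_pair(1)[OF _ e, of "\<lambda>x. ennreal ((cmod (f x))\<^sup>2)"] by (simp add: ennreal_mult nn_integral_L2[OF f(2)])
  have s2: "(\<integral>\<^sup>+p. ennreal (?h p * (cmod (f (snd p)))\<^sup>2) \<partial>?P) = ennreal (L2norm2 f)"
    using nn_integral_heat_pair(2)[OF _ e, of "\<lambda>x. ennreal ((cmod (f x))\<^sup>2)"] by (simp add: ennreal_mult nn_integral_L2[OF f(2)])
  have i1: "integrable ?P (\<lambda>p. ?h p * (cmod (f (fst p)))\<^sup>2)" "integrable ?P (\<lambda>p. ?h p * (cmod (f (snd p)))\<^sup>2)"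
    using s1 s2 by (auto intro!: integrableI_nonneg)
  have v1: "(LINT p|?P. ?h p * (cmod (f (fst p)))\<^sup>2) = L2norm2 f" "(LINT p|?P. ?h p * (cmod (f (snd p)))\<^sup>2) = L2norm2 f"
    using s1 s2 by (auto simp: integral_eq_nn_integral)
  have i3: "integrable ?P (\<lambda>p. complex_of_real (?h p) * (f (fst p) * cnj (f (snd p))))"
  proof (rule Bochner_Integration.integrable_bound[OF Bochner_Integration.integrable_add[OF i1]])
    have "norm (complex_of_real (?h p) * (f (fst p) * cnj (f (snd p)))) \<le> ?h p * (cmod (f (fst p)))\<^sup>2 + ?h p * (cmod (f (snd p)))\<^sup>2" for p
    proof -
      have "cmod (f (fst p)) * cmod (f (snd p)) \<le> (cmod (f (fst p)))\<^sup>2 + (cmod (f (snd p)))\<^sup>2"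
        using sum_squares_bound[of "cmod (f (fst p))" "cmod (f (snd p))"] mult_nonneg_nonneg[OF norm_ge_zero[of "f (fst p)"] norm_ge_zero[of "f (snd p)"]]
        unfolding mult.assoc by linarith
      then show ?thesis
        by (simp add: norm_mult distrib_left[symmetric] mult_left_mono)
    qed
    moreover have nn: "0 \<le> ?h p * (cmod (f (fst p)))\<^sup>2 + ?h p * (cmod (f (snd p)))\<^sup>2" for p by simp
    ultimately show "AE p in ?P. norm (complex_of_real (?h p) * (f (fst p) * cnj (f (snd p)))) \<le> norm (?h p * (cmod (f (fst p)))\<^sup>2 + ?h p * (cmod (f (snd p)))\<^sup>2)"
      by (intro AE_I2) (simp only: real_norm_def abs_of_nonneg[OF nn])
  qed measurable
  define I where "I = (LINT \<xi>|lborel. exp (- e * (norm \<xi>)\<^sup>2) * (cmod (FT1 f \<xi>))\<^sup>2)"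
  have I: "(LINT p|?P. Re (complex_of_real (?h p) * (f (fst p) * cnj (f (snd p))))) = I"
    unfolding integral_Re[OF i3] FT1_heat(1)[OF f(1) e, symmetric] I_def by (rule Re_complex_of_real)
  have pw: "?h p * (cmod (f (fst p) - f (snd p)))\<^sup>2 = ?h p * (cmod (f (fst p)))\<^sup>2 + ?h p * (cmod (f (snd p)))\<^sup>2
      - 2 * Re (complex_of_real (?h p) * (f (fst p) * cnj (f (snd p))))" for p
  proof -
    have 1: "(cmod (a - b))\<^sup>2 = (cmod a)\<^sup>2 + (cmod b)\<^sup>2 - 2 * Re (a * cnj b)" for a b
      unfolding cmod_power2 by (simp add: power2_eq_square algebra_simps)
    have 2: "Re (complex_of_real r * z) = r * Re z" for r z by simp
    show ?thesis unfolding 1 2 right_diff_distrib distrib_left by (simp only: mult.left_commute[of 2])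
  qed
  have "integrable ?P (\<lambda>p. ?h p * (cmod (f (fst p) - f (snd p)))\<^sup>2)"
    unfolding pw using i1 i3 by (intro Bochner_Integration.integrable_diff Bochner_Integration.integrable_add integrable_mult_right integrable_Re)
  moreover have "(LINT p|?P. ?h p * (cmod (f (fst p) - f (snd p)))\<^sup>2) = 2 * L2norm2 f - 2 * I"
    unfolding pw using i1 i3 v1 I
    by (subst Bochner_Integration.integral_diff) (auto simp del: times_complex.sel)
  ultimately have se: "shift_energy e f = ennreal (2 * L2norm2 f - 2 * I)"
    unfolding shift_energy_eq_pair[OF L2_measurable[OF f(2)]]
    by (subst nn_integral_eq_integral) auto
  have "2 * L2norm2 f - 2 * I \<ge> 0"
    unfolding \<open>(LINT p|?P. ?h p * (cmod (f (fst p) - f (snd p)))\<^sup>2) = 2 * L2norm2 f - 2 * I\<close>[symmetric] by simp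
  moreover have "(\<integral>\<^sup>+\<xi>. ennreal (exp (- e * (norm \<xi>)\<^sup>2) * (cmod (FT1 f \<xi>))\<^sup>2) \<partial>lborel) = ennreal I" "I \<ge> 0"
    unfolding I_def using FT1_heat(2)[OF f(1) e] by (subst nn_integral_eq_integral) (auto simp: I_def)
  ultimately have "shift_energy e f + 2 * (\<integral>\<^sup>+\<xi>. ennreal (exp (- e * (norm \<xi>)\<^sup>2) * (cmod (FT1 f \<xi>))\<^sup>2) \<partial>lborel) = ennreal ((2 * L2norm2 f - 2 * I) + 2 * I)"
    unfolding se by (subst ennreal_plus) (auto simp: ennreal_mult)
  then show ?thesis by (simp add: ennreal_mult)
qed

section \<open>Continuity of translations in \<open>L2\<close> and the heat energy at small
  times\<close>

lemma L2norm2_add_le: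
  assumes "L2 f" "L2 g"
  shows "L2norm2 (\<lambda>x. f x + g x) \<le> 2 * L2norm2 f + 2 * L2norm2 g"
proof -
  have "L2norm2 (\<lambda>x. f x + g x) + L2norm2 (\<lambda>x. f x - g x) = 2 * L2norm2 f + 2 * L2norm2 g"
    using L2norm2_add[OF assms] L2norm2_diff[OF assms] by simp
  then show ?thesis using L2norm2_nonneg[of "\<lambda>x. f x - g x"] by linarith
qed

lemma L2norm2_diff_le:
  assumes "L2 f" "L2 g"
  shows "L2norm2 (\<lambda>x. f x - g x) \<le> 2 * L2norm2 f + 2 * L2norm2 g"
proof -
  have "L2norm2 (\<lambda>x. f x + g x) + L2norm2 (\<lambda>x. f x - g x) = 2 * L2norm2 f + 2 * L2norm2 g"
    using L2norm2_add[OF assms] L2norm2_diff[OF assms] by simp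
  then show ?thesis using L2norm2_nonneg[of "\<lambda>x. f x + g x"] by linarith
qed

lemma L2_shift_diff:
  assumes "L2 f"
  shows "L2 (\<lambda>x. f (x + h) - f x)" "L2norm2 (\<lambda>x. f (x + h) - f x) \<le> 4 * L2norm2 f"
  using L2_diff[OF L2_translate(1)[OF assms] assms] L2norm2_diff_le[OF L2_translate(1)[OF assms] assms]
    L2_translate(2)[OF assms] by auto

lemma L2_truncate_tendsto:
  assumes f: "L2 f" and S: "\<And>n. S n \<in> sets borel" "\<And>x. \<forall>\<^sub>F n in sequentially. x \<in> S n"
  shows "L2 (\<lambda>x. indicator (S n) x * f x)"
    "(\<lambda>n. L2norm2 (\<lambda>x. indicator (S n) x * f x - f x)) \<longlonglongrightarrow> 0"
proof -
  note [measurable] = L2_measurable[OF f] S(1)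
  show "L2 (\<lambda>x. indicator (S n) x * f x)"
    by (rule L2_bound[OF f, of _ 1]) (auto simp: indicator_def)
  have "(\<lambda>n. LINT x|lborel. (cmod (indicator (S n) x * f x - f x))\<^sup>2) \<longlonglongrightarrow> (LINT x|lborel. (0 * norm (x::real^3)))"
  proof (rule integral_dominated_convergence)
    show "integrable lborel (\<lambda>x. (cmod (f x))\<^sup>2)" by (rule L2_integrable[OF f])
    show "AE x in lborel. (\<lambda>n. (cmod (indicator (S n) x * f x - f x))\<^sup>2) \<longlonglongrightarrow> 0 * norm x"
      unfolding mult_zero_left
    proof (intro AE_I2 tendsto_eventually)
      fix x show "\<forall>\<^sub>F n in sequentially. (cmod (indicator (S n) x * f x - f x))\<^sup>2 = 0"
        using S(2)[of x] by eventually_elim simp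
    qed
  qed (auto simp: indicator_def)
  then show "(\<lambda>n. L2norm2 (\<lambda>x. indicator (S n) x * f x - f x)) \<longlonglongrightarrow> 0"
    by (simp add: L2norm2_eq)
qed

text \<open>Where both \<open>|f|\<close> and \<open>|x|\<close> are at most \<open>n\<close>, the
  function is bounded and integrable, and for differences bounded by \<open>2 * n\<close> the
  \<open>L1\<close> continuity controls the square. The rest has small norm, which a translation
  difference enlarges at most by 4.\<close>

lemma L2_translation_continuous:
  assumes f: "L2 f" and e: "e > 0"
  shows "\<forall>\<^sub>F h in at 0. L2norm2 (\<lambda>x. f (x + h) - f x) \<le> e"
proof -
  note [measurable] = L2_measurable[OF f]
  define S where "S n = {x. cmod (f x) \<le> real n \<and> norm x \<le> real n}" for n
  have S1 [measurable]: "S n \<in> sets borel" for n unfolding S_def by measurable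
  have S2: "\<forall>\<^sub>F n in sequentially. x \<in> S n" for x
    using eventually_ge_at_top[of "nat \<lceil>max (cmod (f x)) (norm x)\<rceil>"]
    by eventually_elim (simp add: S_def nat_ceiling_le_eq)
  define F where "F n x = indicator (S n) x * f x" for n x
  have F: "L2 (F n)" "(\<lambda>n. L2norm2 (\<lambda>x. F n x - f x)) \<longlonglongrightarrow> 0" for n
    unfolding F_def using L2_truncate_tendsto[OF f S1 S2] by auto
  have "e / 16 > 0" using e by simp
  from eventually_happens'[OF _ order_tendstoD(2)[OF F(2) this]]
  obtain n where n: "L2norm2 (\<lambda>x. F n x - f x) < e / 16" by auto
  have [measurable]: "F n \<in> borel_measurable borel" by (rule L2_measurable[OF F(1)])
  have Fn: "cmod (F n x) \<le> real n" for x by (simp add: F_def S_def indicator_def)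
  have int: "integrable lborel (F n)"
  proof (rule Bochner_Integration.integrable_bound)
    have "emeasure lborel (cball (0::real^3) (real n)) < \<infinity>" by (rule emeasure_lborel_cball_finite)
    then show "integrable lborel (\<lambda>x::real^3. real n * indicator (cball 0 (real n)) x)" by (intro integrable_mult_right integrable_real_indicator) auto
    show "AE x in lborel. norm (F n x) \<le> norm (real n * indicator (cball 0 (real n)) x)"
      by (intro AE_I2) (auto simp: F_def S_def indicator_def)
  qed simp
  \<comment> \<open>Chosen so that the bounded part contributes at most \<open>e / 2\<close>; the
    remainder contributes \<open>2 * 4 * (e / 16)\<close>, the other half. The shift to
    \<open>n + 1\<close> covers \<open>n = 0\<close>.\<close>
  have "ennreal (e / (8 * (real n + 1))) > 0" using e by simp
  from order_tendstoD(2)[OF L1_translation_continuous[OF int] this]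
  show ?thesis
  proof eventually_elim
    case (elim h)
    let ?d = "\<lambda>x. F n x - f x"
    have d: "L2 ?d" by (rule L2_diff[OF F(1) f])
    have "L2norm2 (\<lambda>x. f (x + h) - f x) = L2norm2 (\<lambda>x. (F n (x + h) - F n x) - (?d (x + h) - ?d x))"
      by (rule arg_cong[where f=L2norm2]) auto
    also have "\<dots> \<le> 2 * L2norm2 (\<lambda>x. F n (x + h) - F n x) + 2 * L2norm2 (\<lambda>x. ?d (x + h) - ?d x)"
      by (rule L2norm2_diff_le[OF L2_shift_diff(1)[OF F(1)] L2_shift_diff(1)[OF d]])
    also have "L2norm2 (\<lambda>x. ?d (x + h) - ?d x) \<le> 4 * (e / 16)"
      using L2_shift_diff(2)[OF d, of h] n by linarith
    also have "L2norm2 (\<lambda>x. F n (x + h) - F n x) \<le> 2 * real n * (e / (8 * (real n + 1)))"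
    proof -
      have "(\<integral>\<^sup>+x. ennreal ((cmod (F n (x + h) - F n x))\<^sup>2) \<partial>lborel) \<le> (\<integral>\<^sup>+x. ennreal (2 * real n) * ennreal (cmod (F n (x + h) - F n x)) \<partial>lborel)"
      proof (rule nn_integral_mono)
        fix x
        have "cmod (F n (x + h) - F n x) \<le> 2 * real n"
          using norm_triangle_ineq4[of "F n (x + h)" "F n x"] Fn[of "x + h"] Fn[of x] by linarith
        then have "(cmod (F n (x + h) - F n x))\<^sup>2 \<le> 2 * real n * cmod (F n (x + h) - F n x)"
          unfolding power2_eq_square by (rule mult_right_mono) simp
        then show "ennreal ((cmod (F n (x + h) - F n x))\<^sup>2) \<le> ennreal (2 * real n) * ennreal (cmod (F n (x + h) - F n x))"
          by (simp add: ennreal_mult[symmetric] ennreal_leI)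
      qed
      also have "\<dots> = ennreal (2 * real n) * (\<integral>\<^sup>+x. ennreal (cmod (F n (x + h) - F n x)) \<partial>lborel)"
        by (rule nn_integral_cmult) measurable
      also have "\<dots> \<le> ennreal (2 * real n) * ennreal (e / (8 * (real n + 1)))"
        using elim by (intro mult_left_mono) auto
      also have "\<dots> = ennreal (2 * real n * (e / (8 * (real n + 1))))"
        by (rule ennreal_mult[symmetric]) (use e in auto)
      finally show ?thesis
        unfolding nn_integral_L2[OF L2_shift_diff(1)[OF F(1)]] using e by (subst (asm) ennreal_le_iff) auto
    qed
    also have "2 * (2 * real n * (e / (8 * (real n + 1)))) + 2 * (4 * (e / 16)) \<le> e"
    proof -
      have "2 * real n * (e / (8 * (real n + 1))) = (e / 4) * (real n / (real n + 1))" by (simp add: divide_simps)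
      also have "\<dots> \<le> (e / 4) * 1" using e by (intro mult_left_mono) auto
      finally show ?thesis by simp
    qed
    finally show ?case by simp
  qed
qed

text \<open>Half of the exponent pays for the small factor through
  \<open>exp (- y) \<le> 1 / y\<close> at \<open>y = d^2 / (8 * e)\<close>; the other half is the
  kernel at the doubled time. The constant 32 is 8 times 4, the latter bounding
  \<open>sqrt 2 ^ 3\<close>.\<close>

lemma heat_tail:
  assumes e: "e > 0" and d: "d > 0" and h: "norm h \<ge> d"
  shows "heat e h \<le> 32 * e / d\<^sup>2 * heat (2 * e) h"
proof -
  have "(norm h)\<^sup>2 \<ge> d\<^sup>2" using h d by (intro power_mono) auto
  then have 1: "d\<^sup>2 / (8 * e) \<le> (norm h)\<^sup>2 / (8 * e)" using e by (intro divide_right_mono) auto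
  have y: "d\<^sup>2 / (8 * e) > 0" using d e by simp
  have "exp (- (d\<^sup>2 / (8 * e))) \<le> 1 / (d\<^sup>2 / (8 * e))"
  proof -
    have "d\<^sup>2 / (8 * e) \<le> exp (d\<^sup>2 / (8 * e))" using exp_ge_add_one_self[of "d\<^sup>2 / (8 * e)"] by linarith
    from le_imp_inverse_le[OF this y] show ?thesis by (simp only: exp_minus inverse_eq_divide)
  qed
  also have "1 / (d\<^sup>2 / (8 * e)) = 8 * e / d\<^sup>2" by simp
  finally have "exp (- (d\<^sup>2 / (8 * e))) \<le> 8 * e / d\<^sup>2" .
  moreover have "exp (- ((norm h)\<^sup>2 / (8 * e))) \<le> exp (- (d\<^sup>2 / (8 * e)))" using 1 by simp
  ultimately have 2: "exp (- ((norm h)\<^sup>2 / (8 * e))) \<le> 8 * e / d\<^sup>2" by linarith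
  have s: "inverse (sqrt (4 * pi * e) ^ 3) \<le> 4 * inverse (sqrt (4 * pi * (2 * e)) ^ 3)"
  proof -
    have "sqrt (4 * pi * (2 * e)) = sqrt 2 * sqrt (4 * pi * e)" by (simp add: real_sqrt_mult[symmetric])
    then have "sqrt (4 * pi * (2 * e)) ^ 3 = (sqrt 2 ^ 3) * sqrt (4 * pi * e) ^ 3" by (simp add: power_mult_distrib)
    moreover have "sqrt 2 ^ 3 \<le> (4::real)"
      using sqrt2_less_2 by (simp add: power3_eq_cube)
    moreover have "sqrt (4 * pi * e) ^ 3 > 0" using e by simp
    ultimately show ?thesis by (simp add: divide_simps)
  qed
  have "heat e h = inverse (sqrt (4 * pi * e) ^ 3) * (exp (- ((norm h)\<^sup>2 / (8 * e))) * exp (- ((norm h)\<^sup>2 / (8 * e))))"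
    unfolding heat_eq[OF e] exp_add[symmetric] using e by (simp add: field_simps)
  also have "\<dots> \<le> (4 * inverse (sqrt (4 * pi * (2 * e)) ^ 3)) * ((8 * e / d\<^sup>2) * exp (- ((norm h)\<^sup>2 / (8 * e))))"
    using s 2 e by (intro mult_mono mult_right_mono) auto
  also have "\<dots> = 32 * e / d\<^sup>2 * heat (2 * e) h"
    using e by (simp add: heat_eq)
  finally show ?thesis .
qed

text \<open>Short shifts are small by continuity of translations, and long shifts carry little heat:
  by \<open>heat_tail\<close> their weight is \<open>O(e)\<close> times a kernel of mass 1.\<close>

lemma shift_energy_tendsto_0:
  assumes f: "L2 f"
  shows "((\<lambda>e. shift_energy e f) \<longlongrightarrow> 0) (at_right 0)"
proof (rule tendsto_ennreal_zeroI)
  fix c :: real assume c: "c > 0"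
  note [measurable] = L2_measurable[OF f]
  let ?N = "L2norm2 f"
  from L2_translation_continuous[OF f half_gt_zero[OF c]]
  obtain d where d: "d > 0" "\<And>h. h \<noteq> 0 \<Longrightarrow> norm h < d \<Longrightarrow> L2norm2 (\<lambda>x. f (x + h) - f x) \<le> c / 2"
    by (auto simp: eventually_at)
  have D: "L2norm2 (\<lambda>x. f (x + h) - f x) \<le> c / 2" if "norm h < d" for h
    using d(2)[of h] that c by (cases "h = 0") (auto simp: L2norm2_eq)
  \<comment> \<open>With \<open>e < b\<close> the long shifts contribute
    \<open>128 * e * ?N / d^2\<close>, which is at most \<open>c / 2\<close>.\<close>
  define b where "b = c * d\<^sup>2 / (256 * (?N + 1))"
  have b: "b > 0" using c d by (simp add: b_def add_nonneg_pos)
  have N1: "?N + 1 \<noteq> 0" using L2norm2_nonneg[of f] by linarith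
  have main: "shift_energy e f \<le> ennreal c" if e: "0 < e" "e < b" for e
  proof -
    have pw: "ennreal (heat e h) * (\<integral>\<^sup>+x. ennreal ((cmod (f (x + h) - f x))\<^sup>2) \<partial>lborel)
       \<le> ennreal (c / 2) * ennreal (heat e h) + ennreal (32 * e / d\<^sup>2 * (4 * ?N)) * ennreal (heat (2 * e) h)" for h
    proof -
      have "heat e h * L2norm2 (\<lambda>x. f (x + h) - f x) \<le> c / 2 * heat e h + 32 * e / d\<^sup>2 * (4 * ?N) * heat (2 * e) h"
      proof (cases "norm h < d")
        case True
        have "0 \<le> 32 * e / d\<^sup>2 * (4 * ?N) * heat (2 * e) h" using e by simp
        moreover have "heat e h * L2norm2 (\<lambda>x. f (x + h) - f x) \<le> heat e h * (c / 2)"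
          by (intro mult_left_mono D True) simp
        ultimately show ?thesis by (simp add: mult.commute)
      next
        case False
        have "heat e h * L2norm2 (\<lambda>x. f (x + h) - f x) \<le> (32 * e / d\<^sup>2 * heat (2 * e) h) * (4 * ?N)"
          using False e by (intro mult_mono heat_tail L2_shift_diff f d) auto
        moreover have "0 \<le> c / 2 * heat e h" using c by simp
        ultimately show ?thesis by (simp add: mult_ac)
      qed
      then show ?thesis
        unfolding nn_integral_L2[OF L2_shift_diff(1)[OF f]] using c e
        by (simp add: ennreal_mult[symmetric] ennreal_leI flip: ennreal_plus)
    qed
    have "shift_energy e f \<le> (\<integral>\<^sup>+h. ennreal (c / 2) * ennreal (heat e h) + ennreal (32 * e / d\<^sup>2 * (4 * ?N)) * ennreal (heat (2 * e) h) \<partial>lborel)"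
      unfolding shift_energy_def by (intro nn_integral_mono pw)
    also have "\<dots> = ennreal (c / 2) + ennreal (32 * e / d\<^sup>2 * (4 * ?N))"
      using e by (simp add: nn_integral_add nn_integral_cmult nn_integral_heat)
    also have "\<dots> = ennreal (c / 2 + 32 * e / d\<^sup>2 * (4 * ?N))"
      using c e by (simp flip: ennreal_plus)
    also have "\<dots> \<le> ennreal c"
    proof (rule ennreal_leI)
      have "32 * e / d\<^sup>2 * (4 * ?N) \<le> 32 * b / d\<^sup>2 * (4 * ?N)"
        using e by (intro mult_right_mono divide_right_mono) auto
      also have "\<dots> = 128 * ?N * (b / d\<^sup>2)" by simp
      also have "b / d\<^sup>2 = c / (256 * (?N + 1))" using d by (simp add: b_def)
      also have "128 * ?N * (c / (256 * (?N + 1))) = (c / 2) * (?N / (?N + 1))" using N1 by (simp add: divide_simps)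
      also have "\<dots> \<le> (c / 2) * 1" using c by (intro mult_left_mono) (auto simp: divide_le_eq_1 add_nonneg_pos)
      finally show "c / 2 + 32 * e / d\<^sup>2 * (4 * ?N) \<le> c" by simp
    qed
    finally show ?thesis .
  qed
  show "\<forall>\<^sub>F e in at_right 0. shift_energy e f \<le> ennreal c"
    unfolding eventually_at_right_field using b main by auto
qed

text \<open>Let \<open>e\<close> decrease to 0 in the heat identity: the shift energy vanishes and
  the Gaussian weights increase to 1. Square integrability of the transform comes out of the same
  limit, which is why it is taken in \<open>ennreal\<close>.\<close>

lemma FT1_plancherel:
  assumes f: "integrable lborel f" "L2 f"
  shows "L2 (FT1 f)" "L2norm2 (FT1 f) = L2norm2 f"
proof -
  note [measurable] = L2_measurable[OF f(2)]
  let ?e = "\<lambda>n. 1 / real (Suc n)"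
  let ?g = "\<lambda>n \<xi>. ennreal (exp (- ?e n * (norm \<xi>)\<^sup>2) * (cmod (FT1 f \<xi>))\<^sup>2)"
  have e: "filterlim ?e (at_right 0) sequentially"
    unfolding filterlim_at using LIMSEQ_inverse_real_of_nat by (auto simp: inverse_eq_divide)
  have 1: "(\<lambda>n. shift_energy (?e n) f) \<longlonglongrightarrow> 0"
    by (rule filterlim_compose[OF shift_energy_tendsto_0[OF f(2)] e])
  have 2: "(\<lambda>n. \<integral>\<^sup>+\<xi>. ?g n \<xi> \<partial>lborel) \<longlonglongrightarrow> (\<integral>\<^sup>+\<xi>. ennreal ((cmod (FT1 f \<xi>))\<^sup>2) \<partial>lborel)"
  proof (rule nn_integral_LIMSEQ)
    show "incseq ?g"
    proof (intro incseq_SucI le_funI ennreal_leI mult_right_mono)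
      fix n \<xi>
      have "?e (Suc n) \<le> ?e n" by (simp add: frac_le)
      then show "exp (- ?e n * (norm \<xi>)\<^sup>2) \<le> exp (- ?e (Suc n) * (norm \<xi>)\<^sup>2)"
        unfolding exp_le_cancel_iff by (intro mult_right_mono) auto
    qed simp
    show "(\<lambda>n. ?g n \<xi>) \<longlonglongrightarrow> ennreal ((cmod (FT1 f \<xi>))\<^sup>2)" for \<xi>
    proof -
      have "?e \<longlonglongrightarrow> 0" using LIMSEQ_inverse_real_of_nat by (simp add: inverse_eq_divide)
      then have "(\<lambda>n. exp (- ?e n * (norm \<xi>)\<^sup>2) * (cmod (FT1 f \<xi>))\<^sup>2) \<longlonglongrightarrow> exp (- 0 * (norm \<xi>)\<^sup>2) * (cmod (FT1 f \<xi>))\<^sup>2"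
        by (intro tendsto_intros)
      then show ?thesis by (intro tendsto_ennrealI) simp
    qed
  qed measurable
  have "(\<lambda>n. shift_energy (?e n) f + (2::ennreal) * (\<integral>\<^sup>+\<xi>. ?g n \<xi> \<partial>lborel)) \<longlonglongrightarrow> 0 + 2 * (\<integral>\<^sup>+\<xi>. ennreal ((cmod (FT1 f \<xi>))\<^sup>2) \<partial>lborel)"
    by (intro tendsto_add 1 ennreal_tendsto_cmult 2) simp
  moreover have "(\<lambda>n. shift_energy (?e n) f + 2 * (\<integral>\<^sup>+\<xi>. ?g n \<xi> \<partial>lborel)) = (\<lambda>n. 2 * ennreal (L2norm2 f))"
    by (rule ext, rule FT1_shift_energy[OF f]) simp
  ultimately have "(\<lambda>n::nat. 2 * ennreal (L2norm2 f)) \<longlonglongrightarrow> 0 + 2 * (\<integral>\<^sup>+\<xi>. ennreal ((cmod (FT1 f \<xi>))\<^sup>2) \<partial>lborel)"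
    by (simp only:)
  from LIMSEQ_unique[OF tendsto_const this]
  have "2 * ennreal (L2norm2 f) = 2 * (\<integral>\<^sup>+\<xi>. ennreal ((cmod (FT1 f \<xi>))\<^sup>2) \<partial>lborel)"
    by (simp only: add_0)
  then have *: "(\<integral>\<^sup>+\<xi>. ennreal ((cmod (FT1 f \<xi>))\<^sup>2) \<partial>lborel) = ennreal (L2norm2 f)"
    by (simp add: ennreal_mult_cancel_left)
  then show "L2 (FT1 f)" unfolding L2_def by simp
  show "L2norm2 (FT1 f) = L2norm2 f" unfolding L2norm2_def[of "FT1 f"] * by simp
qed

section \<open>From integrable to square-integrable functions\<close>

definition trunc :: "real \<Rightarrow> fn3 \<Rightarrow> fn3" where
  "trunc R f = (\<lambda>x. indicator (ball 0 R) x * f x)"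

lemma L2_trunc:
  assumes f: "L2 f"
  shows "L2 (trunc R f)" "integrable lborel (trunc R f)"
proof -
  note [measurable] = L2_measurable[OF f]
  have [measurable]: "trunc R f \<in> borel_measurable borel"
    unfolding trunc_def by (intro borel_measurable_times borel_measurable_indicator) auto
  show "L2 (trunc R f)"
    by (rule L2_bound[OF f, of _ 1]) (auto simp: indicator_def trunc_def)
  show "integrable lborel (trunc R f)"
  proof (rule Bochner_Integration.integrable_bound)
    have "emeasure lborel (ball (0::real^3) R) < \<infinity>" by (rule emeasure_lborel_ball_finite)
    then show "integrable lborel (\<lambda>x::real^3. indicator (ball 0 R) x + (cmod (f x))\<^sup>2)"
      by (intro Bochner_Integration.integrable_add integrable_real_indicator L2_integrable[OF f]) auto
    have "cmod (f x) \<le> 1 + (cmod (f x))\<^sup>2" for x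
      using sum_squares_bound[of 1 "cmod (f x)"] norm_ge_zero[of "f x"]
      unfolding power_one mult_1_right by linarith
    then show "AE x in lborel. norm (trunc R f x) \<le> norm (indicator (ball 0 R) x + (cmod (f x))\<^sup>2)"
      by (intro AE_I2) (auto simp: trunc_def indicator_def)
  qed simp
qed

lemma is_fourier_L2: "is_fourier f g \<Longrightarrow> L2 f" "is_fourier f g \<Longrightarrow> L2 g"
  by (auto simp: is_fourier_def)

lemma is_fourier_iff:
  "is_fourier f g \<longleftrightarrow> L2 f \<and> L2 g \<and> ((\<lambda>R. L2norm2 (\<lambda>\<xi>. g \<xi> - FT1 (trunc R f) \<xi>)) \<longlongrightarrow> 0) at_top"
proof (cases "L2 f \<and> L2 g")
  case True
  then have "(\<integral>\<^sup>+\<xi>. ennreal ((cmod (g \<xi> - FT1 (\<lambda>x. indicator (ball 0 R) x * f x) \<xi>))\<^sup>2) \<partial>lborel)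
     = ennreal (L2norm2 (\<lambda>\<xi>. g \<xi> - FT1 (trunc R f) \<xi>))" for R
    using nn_integral_L2[OF L2_diff, of g "FT1 (trunc R f)"] FT1_plancherel(1)[OF L2_trunc(2) L2_trunc(1)]
    by (simp add: trunc_def)
  with True show ?thesis unfolding is_fourier_def using tendsto_ennreal_iff[of "\<lambda>R. L2norm2 (\<lambda>\<xi>. g \<xi> - FT1 (trunc R f) \<xi>)" at_top 0] by simp
qed (auto simp: is_fourier_def)

lemma trunc_tendsto:
  assumes "L2 f"
  shows "(\<lambda>n. L2norm2 (\<lambda>x. trunc (real n) f x - f x)) \<longlonglongrightarrow> 0"
  unfolding trunc_def
proof (rule L2_truncate_tendsto(2)[OF assms])
  show "\<forall>\<^sub>F n in sequentially. x \<in> ball 0 (real n)" for x :: "real^3"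
    using eventually_gt_at_top[of "nat \<lceil>norm x\<rceil>"] by eventually_elim (simp, linarith)
qed simp

lemma is_fourier_sequence:
  assumes "is_fourier f g"
  shows "(\<lambda>n. L2norm2 (\<lambda>\<xi>. FT1 (trunc (real n) f) \<xi> - g \<xi>)) \<longlonglongrightarrow> 0"
proof -
  have "(\<lambda>n. L2norm2 (\<lambda>\<xi>. g \<xi> - FT1 (trunc (real n) f) \<xi>)) \<longlonglongrightarrow> 0"
    by (rule filterlim_compose[OF _ filterlim_real_sequentially]) (use assms in \<open>simp add: is_fourier_iff\<close>)
  then show ?thesis unfolding L2norm2_def by (simp add: norm_minus_commute)
qed

theorem plancherel:
  assumes "is_fourier f g" shows "L2norm2 g = L2norm2 f"
proof (rule LIMSEQ_unique)
  note L = is_fourier_L2[OF assms]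
  show "(\<lambda>n. L2norm2 (FT1 (trunc (real n) f))) \<longlonglongrightarrow> L2norm2 g"
    by (rule L2_tendsto_norm[OF L(2) FT1_plancherel(1)[OF L2_trunc(2)[OF L(1)] L2_trunc(1)[OF L(1)]] is_fourier_sequence[OF assms]])
  show "(\<lambda>n. L2norm2 (FT1 (trunc (real n) f))) \<longlonglongrightarrow> L2norm2 f"
    unfolding FT1_plancherel(2)[OF L2_trunc(2)[OF L(1)] L2_trunc(1)[OF L(1)]]
    by (rule L2_tendsto_norm[OF L(1) L2_trunc(1)[OF L(1)] trunc_tendsto[OF L(1)]])
qed

text \<open>Both terms are continuous along the truncations that define the transform: the Gaussian
  multiplier does not increase the \<open>L2\<close> norm, and the shift energies converge by
  dominated convergence in \<open>h\<close> with majorant four times the mass times the heat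
  kernel.\<close>

theorem heat_identity:
  assumes fg: "is_fourier f g" and e: "e > 0"
  shows "shift_energy e f + 2 * (\<integral>\<^sup>+\<xi>. ennreal (exp (- e * (norm \<xi>)\<^sup>2) * (cmod (g \<xi>))\<^sup>2) \<partial>lborel) = 2 * ennreal (L2norm2 f)"
proof -
  note L = is_fourier_L2[OF fg]
  define F where "F n = trunc (real n) f" for n :: nat
  have F: "integrable lborel (F n)" "L2 (F n)" "(\<lambda>n. L2norm2 (\<lambda>x. F n x - f x)) \<longlonglongrightarrow> 0" for n
    using L2_trunc[OF L(1)] trunc_tendsto[OF L(1)] by (auto simp: F_def)
  define G where "G n = FT1 (F n)" for n
  have G: "L2 (G n)" "(\<lambda>n. L2norm2 (\<lambda>x. G n x - g x)) \<longlonglongrightarrow> 0" for n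
    using FT1_plancherel(1)[OF F(1,2)] is_fourier_sequence[OF fg] by (auto simp: F_def G_def)
  note [measurable] = L2_measurable[OF L(1)] L2_measurable[OF L(2)] L2_measurable[OF F(2)] L2_measurable[OF G(1)]
  \<comment> \<open>The square root of the Gaussian weight, so that the weighted integral becomes
    the \<open>L2\<close> norm of a product.\<close>
  let ?w = "\<lambda>\<xi>::real^3. complex_of_real (exp (- e * (norm \<xi>)\<^sup>2 / 2))"
  have w1: "cmod (?w \<xi>) \<le> 1" for \<xi> using e by (simp del: of_real_exp)
  have w2: "ennreal (exp (- e * (norm \<xi>)\<^sup>2) * (cmod z)\<^sup>2) = ennreal ((cmod (?w \<xi> * z))\<^sup>2)" for \<xi> z
    by (simp add: norm_mult power_mult_distrib exp_double[symmetric] del: of_real_exp)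
  have wL: "L2 (\<lambda>\<xi>. ?w \<xi> * k \<xi>)" if "L2 k" for k
  proof (rule L2_bound[OF that, of _ 1])
    note [measurable] = L2_measurable[OF that]
    show "(\<lambda>\<xi>. ?w \<xi> * k \<xi>) \<in> borel_measurable borel" by measurable
    show "cmod (?w \<xi> * k \<xi>) \<le> 1 * cmod (k \<xi>)" for \<xi>
      using mult_right_mono[OF w1 norm_ge_zero] by (simp only: norm_mult)
  qed
  have "(\<lambda>n. L2norm2 (\<lambda>\<xi>. ?w \<xi> * G n \<xi>)) \<longlonglongrightarrow> L2norm2 (\<lambda>\<xi>. ?w \<xi> * g \<xi>)"
  proof (rule L2_tendsto_norm[OF wL[OF L(2)] wL[OF G(1)]])
    show "(\<lambda>n. L2norm2 (\<lambda>\<xi>. ?w \<xi> * G n \<xi> - ?w \<xi> * g \<xi>)) \<longlonglongrightarrow> 0"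
    proof (rule tendsto_sandwich[OF _ _ tendsto_const G(2)])
      show "\<forall>\<^sub>F n in sequentially. L2norm2 (\<lambda>\<xi>. ?w \<xi> * G n \<xi> - ?w \<xi> * g \<xi>) \<le> L2norm2 (\<lambda>x. G n x - g x)"
      proof (intro always_eventually allI)
        fix n
        note D = L2_diff[OF G(1)[of n] L(2)]
        have "(cmod (?w \<xi> * (G n \<xi> - g \<xi>)))\<^sup>2 \<le> (cmod (G n \<xi> - g \<xi>))\<^sup>2" for \<xi>
          using mult_right_mono[OF w1 norm_ge_zero, of \<xi> "G n \<xi> - g \<xi>"] by (intro power_mono norm_ge_zero) (simp only: norm_mult mult_1)
        then show "L2norm2 (\<lambda>\<xi>. ?w \<xi> * G n \<xi> - ?w \<xi> * g \<xi>) \<le> L2norm2 (\<lambda>x. G n x - g x)"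
          unfolding right_diff_distrib[symmetric]
          by (simp only: L2norm2_eq L2_measurable[OF D] L2_measurable[OF wL[OF D]])
            (intro integral_mono L2_integrable[OF wL[OF D]] L2_integrable[OF D])
      qed
    qed simp
  qed
  then have 1: "(\<lambda>n. \<integral>\<^sup>+\<xi>. ennreal (exp (- e * (norm \<xi>)\<^sup>2) * (cmod (G n \<xi>))\<^sup>2) \<partial>lborel) \<longlonglongrightarrow>
     (\<integral>\<^sup>+\<xi>. ennreal (exp (- e * (norm \<xi>)\<^sup>2) * (cmod (g \<xi>))\<^sup>2) \<partial>lborel)"
    unfolding w2 nn_integral_L2[OF wL[OF G(1)]] nn_integral_L2[OF wL[OF L(2)]] by (rule tendsto_ennrealI)
  have 2: "(\<lambda>n. shift_energy e (F n)) \<longlonglongrightarrow> shift_energy e f"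
    unfolding shift_energy_def
  proof (rule nn_integral_dominated_convergence)
    have N: "L2norm2 (F n) \<le> L2norm2 f" for n
      unfolding L2norm2_eq[OF L2_measurable[OF F(2)]] L2norm2_eq[OF L2_measurable[OF L(1)]]
      by (intro integral_mono L2_integrable F L) (auto simp: F_def trunc_def indicator_def)
    show "AE h in lborel. ennreal (heat e h) * (\<integral>\<^sup>+x. ennreal ((cmod (F n (x + h) - F n x))\<^sup>2) \<partial>lborel) \<le> ennreal (4 * L2norm2 f) * ennreal (heat e h)" for n
      unfolding nn_integral_L2[OF L2_shift_diff(1)[OF F(2)]]
    proof (rule AE_I2)
      fix h :: "real^3"
      have "L2norm2 (\<lambda>x. F n (x + h) - F n x) \<le> 4 * L2norm2 f"
        using L2_shift_diff(2)[OF F(2)[of n], of h] N[of n] by linarith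
      then show "ennreal (heat e h) * ennreal (L2norm2 (\<lambda>x. F n (x + h) - F n x)) \<le> ennreal (4 * L2norm2 f) * ennreal (heat e h)"
        by (subst mult.commute) (intro mult_right_mono ennreal_leI, auto)
    qed
    show "(\<integral>\<^sup>+h. ennreal (4 * L2norm2 f) * ennreal (heat e h) \<partial>lborel) < \<infinity>"
      using e by (simp add: nn_integral_cmult nn_integral_heat)
    show "AE h in lborel. (\<lambda>n. ennreal (heat e h) * (\<integral>\<^sup>+x. ennreal ((cmod (F n (x + h) - F n x))\<^sup>2) \<partial>lborel))
      \<longlonglongrightarrow> ennreal (heat e h) * (\<integral>\<^sup>+x. ennreal ((cmod (f (x + h) - f x))\<^sup>2) \<partial>lborel)"
    proof (intro AE_I2 ennreal_tendsto_cmult)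
      fix h :: "real^3"
      show "(\<lambda>n. \<integral>\<^sup>+x. ennreal ((cmod (F n (x + h) - F n x))\<^sup>2) \<partial>lborel) \<longlonglongrightarrow> (\<integral>\<^sup>+x. ennreal ((cmod (f (x + h) - f x))\<^sup>2) \<partial>lborel)"
        unfolding nn_integral_L2[OF L2_shift_diff(1)[OF F(2)]] nn_integral_L2[OF L2_shift_diff(1)[OF L(1)]]
      proof (intro tendsto_ennrealI L2_tendsto_norm L2_shift_diff F L)
        show "(\<lambda>n. L2norm2 (\<lambda>x. F n (x + h) - F n x - (f (x + h) - f x))) \<longlonglongrightarrow> 0"
        proof (rule tendsto_sandwich[OF _ _ tendsto_const])
          show "(\<lambda>n. 4 * L2norm2 (\<lambda>x. F n x - f x)) \<longlonglongrightarrow> 0" using tendsto_mult_right_zero[OF F(3), of 4] by simp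
          show "\<forall>\<^sub>F n in sequentially. L2norm2 (\<lambda>x. F n (x + h) - F n x - (f (x + h) - f x)) \<le> 4 * L2norm2 (\<lambda>x. F n x - f x)"
          proof (intro always_eventually allI)
            fix n
            have "(\<lambda>x. F n (x + h) - F n x - (f (x + h) - f x)) = (\<lambda>x. (F n (x + h) - f (x + h)) - (F n x - f x))" by auto
            then show "L2norm2 (\<lambda>x. F n (x + h) - F n x - (f (x + h) - f x)) \<le> 4 * L2norm2 (\<lambda>x. F n x - f x)"
              using L2_shift_diff(2)[OF L2_diff[OF F(2)[of n] L(1)], of h] by simp
          qed
        qed simp
      qed
    qed simp
  qed measurable
  have "(\<lambda>n. shift_energy e (F n) + (2::ennreal) * (\<integral>\<^sup>+\<xi>. ennreal (exp (- e * (norm \<xi>)\<^sup>2) * (cmod (G n \<xi>))\<^sup>2) \<partial>lborel))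
     \<longlonglongrightarrow> shift_energy e f + 2 * (\<integral>\<^sup>+\<xi>. ennreal (exp (- e * (norm \<xi>)\<^sup>2) * (cmod (g \<xi>))\<^sup>2) \<partial>lborel)"
    by (intro tendsto_add 2 ennreal_tendsto_cmult 1) simp
  moreover have "(\<lambda>n. shift_energy e (F n) + (2::ennreal) * (\<integral>\<^sup>+\<xi>. ennreal (exp (- e * (norm \<xi>)\<^sup>2) * (cmod (G n \<xi>))\<^sup>2) \<partial>lborel))
     \<longlonglongrightarrow> 2 * ennreal (L2norm2 f)"
    unfolding G_def FT1_shift_energy[OF F(1,2) e]
    by (intro ennreal_tendsto_cmult tendsto_ennrealI L2_tendsto_norm L F) simp
  ultimately show ?thesis by (rule LIMSEQ_unique)
qed

subsection \<open>Algebraic properties of the Fourier transform\<close>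

lemma FT1_add: "integrable lborel f \<Longrightarrow> integrable lborel g \<Longrightarrow> FT1 (\<lambda>x. f x + g x) \<xi> = FT1 f \<xi> + FT1 g \<xi>"
proof -
  have i: "integrable lborel (\<lambda>x. exp (- \<i> * complex_of_real (x \<bullet> \<xi>)) * f x)" if "integrable lborel f" for f
  proof -
    note [measurable] = borel_measurable_integrable[OF that]
    show ?thesis
      by (rule Bochner_Integration.integrable_bound[OF that]) (auto simp: norm_mult norm_exp_i_times)
  qed
  assume "integrable lborel f" "integrable lborel g"
  then show ?thesis unfolding FT1_def
    by (simp only: distrib_left Bochner_Integration.integral_add[OF i i])
qed

lemma FT1_cmult: "FT1 (\<lambda>x. c * f x) \<xi> = c * FT1 f \<xi>"
  unfolding FT1_def by (simp only: mult.left_commute[of _ c] integral_mult_right_zero)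

lemma is_fourier_add:
  assumes "is_fourier f1 g1" "is_fourier f2 g2"
  shows "is_fourier (\<lambda>x. f1 x + f2 x) (\<lambda>x. g1 x + g2 x)"
  unfolding is_fourier_iff
proof (intro conjI L2_add is_fourier_L2[OF assms(1)] is_fourier_L2[OF assms(2)])
  note L1 = is_fourier_L2[OF assms(1)] and L2 = is_fourier_L2[OF assms(2)]
  have t: "trunc R (\<lambda>x. f1 x + f2 x) = (\<lambda>x. trunc R f1 x + trunc R f2 x)" for R
    by (simp add: trunc_def distrib_left)
  let ?d1 = "\<lambda>R \<xi>. g1 \<xi> - FT1 (trunc R f1) \<xi>" and ?d2 = "\<lambda>R \<xi>. g2 \<xi> - FT1 (trunc R f2) \<xi>"
  have d: "L2 (?d1 R)" "L2 (?d2 R)" for R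
    using L1 L2 by (auto intro!: L2_diff FT1_plancherel(1) L2_trunc)
  have eq: "(\<lambda>\<xi>. g1 \<xi> + g2 \<xi> - FT1 (trunc R (\<lambda>x. f1 x + f2 x)) \<xi>) = (\<lambda>\<xi>. ?d1 R \<xi> + ?d2 R \<xi>)" for R
    unfolding t using FT1_add[OF L2_trunc(2)[OF L1(1)] L2_trunc(2)[OF L2(1)]] by auto
  show "((\<lambda>R. L2norm2 (\<lambda>\<xi>. g1 \<xi> + g2 \<xi> - FT1 (trunc R (\<lambda>x. f1 x + f2 x)) \<xi>)) \<longlongrightarrow> 0) at_top"
    unfolding eq
  proof (rule tendsto_sandwich[OF _ _ tendsto_const])
    show "((\<lambda>R. 2 * L2norm2 (?d1 R) + 2 * L2norm2 (?d2 R)) \<longlongrightarrow> 0) at_top"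
      using assms unfolding is_fourier_iff by (auto intro!: tendsto_eq_intros)
    show "\<forall>\<^sub>F R in at_top. L2norm2 (\<lambda>\<xi>. ?d1 R \<xi> + ?d2 R \<xi>) \<le> 2 * L2norm2 (?d1 R) + 2 * L2norm2 (?d2 R)"
      by (intro always_eventually allI L2norm2_add_le d)
  qed simp
qed

lemma is_fourier_cmult:
  assumes "is_fourier f g"
  shows "is_fourier (\<lambda>x. c * f x) (\<lambda>x. c * g x)"
  unfolding is_fourier_iff
proof (intro conjI L2_cmult is_fourier_L2[OF assms])
  note L = is_fourier_L2[OF assms]
  have t: "trunc R (\<lambda>x. c * f x) = (\<lambda>x. c * trunc R f x)" for R
    by (auto simp: trunc_def)
  have d: "L2 (\<lambda>\<xi>. g \<xi> - FT1 (trunc R f) \<xi>)" for R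
    using L by (auto intro!: L2_diff FT1_plancherel(1) L2_trunc)
  have eq: "L2norm2 (\<lambda>\<xi>. c * g \<xi> - FT1 (trunc R (\<lambda>x. c * f x)) \<xi>) = (cmod c)\<^sup>2 * L2norm2 (\<lambda>\<xi>. g \<xi> - FT1 (trunc R f) \<xi>)" for R
    unfolding t FT1_cmult right_diff_distrib[symmetric] by (rule L2norm2_cmult[OF L2_measurable[OF d]])
  show "((\<lambda>R. L2norm2 (\<lambda>\<xi>. c * g \<xi> - FT1 (trunc R (\<lambda>x. c * f x)) \<xi>)) \<longlongrightarrow> 0) at_top"
    unfolding eq using assms unfolding is_fourier_iff by (auto intro!: tendsto_eq_intros)
qed

lemma is_fourier_diff:
  assumes "is_fourier f1 g1" "is_fourier f2 g2"
  shows "is_fourier (\<lambda>x. f1 x - f2 x) (\<lambda>x. g1 x - g2 x)"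
  using is_fourier_add[OF assms(1) is_fourier_cmult[OF assms(2), of "-1"]] by simp

text \<open>Polarisation of Plancherel's identity: sums give the real part, and replacing
  \<open>f1\<close> by \<open>- \<i>\<close> times \<open>f1\<close> gives the imaginary
  part.\<close>

theorem parseval:
  assumes "is_fourier f1 g1" "is_fourier f2 g2"
  shows "ip f1 f2 = ip g1 g2"
proof -
  note L1 = is_fourier_L2[OF assms(1)] and L2 = is_fourier_L2[OF assms(2)]
  have re: "Re (ip f1 f2) = Re (ip g1 g2)" if "is_fourier f1 g1" "is_fourier f2 g2" for f1 g1 f2 g2
    using plancherel[OF is_fourier_add[OF that]] plancherel[OF that(1)] plancherel[OF that(2)]
      L2norm2_add[OF is_fourier_L2(1)[OF that(1)] is_fourier_L2(1)[OF that(2)]]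
      L2norm2_add[OF is_fourier_L2(2)[OF that(1)] is_fourier_L2(2)[OF that(2)]] by simp
  have "Im (ip f1 f2) = Im (ip g1 g2)"
    using re[OF is_fourier_cmult[OF assms(1), of "- \<i>"] assms(2)]
    unfolding ip_cmult_left by simp
  with re[OF assms] show ?thesis by (rule complex_eqI)
qed

text \<open>This lets the arbitrary \<open>SOME g\<close> in \<open>H_half_norm\<close> and
  \<open>K_functional\<close> be replaced by whichever transform is at hand.\<close>

lemma is_fourier_unique:
  assumes "is_fourier f g1" "is_fourier f g2"
  shows "AE \<xi> in lborel. g1 \<xi> = g2 \<xi>"
proof -
  have "is_fourier (\<lambda>x. f x - f x) (\<lambda>\<xi>. g1 \<xi> - g2 \<xi>)" by (rule is_fourier_diff[OF assms])
  from plancherel[OF this] have "L2norm2 (\<lambda>\<xi>. g1 \<xi> - g2 \<xi>) = 0" by (simp add: L2norm2_def)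
  then have "AE \<xi> in lborel. g1 \<xi> - g2 \<xi> = 0"
    by (intro L2norm2_eq_0 L2_diff is_fourier_L2(2)[OF assms(1)] is_fourier_L2(2)[OF assms(2)])
  then show ?thesis by simp
qed

subsection \<open>One-dimensional integrals\<close>

text \<open>The substitution rule for absolutely integrable functions is applied from the
  pulled-back side, where the value \<open>b\<close> is already known to be finite. The absolute
  value of \<open>g'\<close> admits decreasing substitutions such as inversion.\<close>

lemma nn_integral_substitution_Ioi:
  fixes f g g' :: "real \<Rightarrow> real"
  assumes [measurable]: "f \<in> borel_measurable borel" "g \<in> borel_measurable borel" "g' \<in> borel_measurable borel"
    and nonneg: "\<And>x. 0 < x \<Longrightarrow> 0 \<le> f x"
    and der: "\<And>v. 0 < v \<Longrightarrow> (g has_field_derivative g' v) (at v)"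
    and inj: "inj_on g {0<..}" and img: "g ` {0<..} = {0<..}"
    and b: "(\<integral>\<^sup>+v. ennreal (\<bar>g' v\<bar> * f (g v)) * indicator {0<..} v \<partial>lborel) = ennreal b" "b \<ge> 0"
  shows "(\<integral>\<^sup>+s. ennreal (f s) * indicator {0<..} s \<partial>lborel) = ennreal b"
proof -
  let ?k = "\<lambda>v. \<bar>g' v\<bar> * f (g v)"
  have k: "?k v \<ge> 0" if "v > 0" for v
  proof -
    have "g v > 0" using that img by blast
    then show ?thesis using nonneg by simp
  qed
  have "((\<lambda>v. ?k v * indicator {0<..} v) has_integral b) UNIV"
  proof (rule nn_integral_has_integral)
    show "(\<integral>\<^sup>+v. ennreal (?k v * indicator {0<..} v) \<partial>lborel) = ennreal b"
      unfolding b(1)[symmetric] by (intro nn_integral_cong) (auto simp: indicator_def)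
    show "0 \<le> ?k v * indicator {0<..} v" for v using k[of v] by (auto simp: indicator_def)
  qed (use b in auto)
  also have "(\<lambda>v. ?k v * indicator {0<..} v) = (\<lambda>v. if v \<in> {0<..} then ?k v else 0)"
    by (auto simp: indicator_def)
  finally have hi: "(?k has_integral b) {0<..}" unfolding has_integral_restrict_UNIV .
  then have 1: "?k absolutely_integrable_on {0<..} \<and> integral {0<..} ?k = b"
    using k by (auto intro!: nonnegative_absolutely_integrable_1 integral_unique)
  have "?k absolutely_integrable_on {0<..} \<and> integral {0<..} ?k = b \<longleftrightarrow> f absolutely_integrable_on (g ` {0<..}) \<and> integral (g ` {0<..}) f = b"
    by (intro has_absolute_integral_change_of_variables_1' inj)
      (auto intro: has_field_derivative_at_within der)
  with 1 have 2: "f absolutely_integrable_on {0<..}" "integral {0<..} f = b"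
    unfolding img by auto
  have "(f has_integral b) {0<..}"
    using integrable_integral[OF set_lebesgue_integral_eq_integral(1)[OF 2(1)]] unfolding 2(2) .
  then show ?thesis by (intro nn_integral_has_integral_lebesgue' nonneg) auto
qed

lemma nn_integral_gaussian_Ioi:
  assumes c: "c > 0"
  shows "(\<integral>\<^sup>+v. ennreal (exp (- c * v\<^sup>2)) * indicator {0<..} v \<partial>lborel) = ennreal (sqrt (pi / c) / 2)"
proof (rule nn_integral_substitution_Ioi[where g="\<lambda>v. v / sqrt c" and g'="\<lambda>v. 1 / sqrt c"])
  have "(\<integral>\<^sup>+v. ennreal (\<bar>1 / sqrt c\<bar> * exp (- c * (v / sqrt c)\<^sup>2)) * indicator {0<..} v \<partial>lborel)
     = (\<integral>\<^sup>+v. ennreal (1 / sqrt c) * ennreal (indicator {0..} v *\<^sub>R exp (- v\<^sup>2)) \<partial>lborel)"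
  proof (rule nn_integral_cong_AE)
    show "AE v in lborel. ennreal (\<bar>1 / sqrt c\<bar> * exp (- c * (v / sqrt c)\<^sup>2)) * indicator {0<..} v
       = ennreal (1 / sqrt c) * ennreal (indicator {0..} v *\<^sub>R exp (- v\<^sup>2))"
      using AE_lborel_singleton[of "0::real"]
      by eventually_elim (use c in \<open>auto simp: indicator_def power_divide ennreal_mult[symmetric]\<close>)
  qed
  also have "\<dots> = ennreal (1 / sqrt c) * ennreal (sqrt pi / 2)"
  proof -
    note g = gaussian_moment_0[unfolded has_bochner_integral_iff]
    have "(\<integral>\<^sup>+v. ennreal (indicator {0..} v *\<^sub>R exp (- v\<^sup>2)) \<partial>lborel) = ennreal (sqrt pi / 2)"
      by (subst nn_integral_eq_integral[OF conjunct1[OF g]]) (auto simp only: conjunct2[OF g] scaleR_nonneg_nonneg indicator_pos_le exp_ge_zero intro!: AE_I2)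
    then show ?thesis by (subst nn_integral_cmult) auto
  qed
  also have "\<dots> = ennreal (sqrt (pi / c) / 2)"
    using c by (simp add: ennreal_mult[symmetric] real_sqrt_divide)
  finally show "(\<integral>\<^sup>+v. ennreal (\<bar>1 / sqrt c\<bar> * exp (- c * (v / sqrt c)\<^sup>2)) * indicator {0<..} v \<partial>lborel) = ennreal (sqrt (pi / c) / 2)" .
  show "(\<lambda>v. v / sqrt c) ` {0<..} = {0<..}"
  proof (intro equalityI subsetI)
    fix y :: real assume "y \<in> {0<..}"
    then have "y = (y * sqrt c) / sqrt c" "y * sqrt c \<in> {0<..}" using c by auto
    then show "y \<in> (\<lambda>v. v / sqrt c) ` {0<..}" by blast
  qed (use c in auto)
  show "((\<lambda>v. v / sqrt c) has_field_derivative 1 / sqrt c) (at v)" for v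
    by (rule DERIV_cdivide[OF DERIV_ident])
qed (use c in \<open>auto simp: inj_on_def\<close>)

lemma nn_integral_exp_Ioi:
  assumes c: "c > 0"
  shows "(\<integral>\<^sup>+v. ennreal (exp (- c * v)) * indicator {0<..} v \<partial>lborel) = ennreal (1 / c)"
proof -
  have "(\<integral>\<^sup>+v. ennreal (exp (- c * v)) * indicator {0<..} v \<partial>lborel) = (\<integral>\<^sup>+v. ennreal (exp (- c * v)) * indicator {0..} v \<partial>lborel)"
    using AE_lborel_singleton[of "0::real"] by (intro nn_integral_cong_AE) (auto elim!: eventually_mono simp: indicator_def)
  also have "\<dots> = ennreal (0 - (- exp (- c * 0) / c))"
  proof (rule nn_integral_FTC_atLeast)
    have "((\<lambda>v. - exp (- c * v) / c) \<longlongrightarrow> - 0 / c) at_top"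
      using c by (intro tendsto_intros filterlim_compose[OF exp_at_bot] filterlim_tendsto_neg_mult_at_bot[OF tendsto_const _ filterlim_ident]) auto
    then show "((\<lambda>v. - exp (- c * v) / c) \<longlongrightarrow> 0) at_top" by simp
  qed (use c in \<open>auto intro!: derivative_eq_intros\<close>)
  finally show ?thesis by simp
qed

lemma image_inverse_Ioi: "inverse ` {0::real<..} = {0<..}"
proof (intro equalityI subsetI)
  fix y :: real assume "y \<in> {0<..}"
  then show "y \<in> inverse ` {0<..}" by (intro image_eqI[of _ _ "inverse y"]) auto
qed auto

lemma image_power2_Ioi: "(\<lambda>v::real. v\<^sup>2) ` {0<..} = {0<..}"
proof (intro equalityI subsetI)
  fix y :: real assume "y \<in> {0<..}"
  then show "y \<in> (\<lambda>v::real. v\<^sup>2) ` {0<..}" by (intro image_eqI[of _ _ "sqrt y"]) auto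
qed auto

lemma inj_power2_Ioi: "inj_on (\<lambda>v::real. v\<^sup>2) {0<..}"
  by (auto simp: inj_on_def power2_eq_iff)

lemma nn_integral_rsqrt_exp:
  assumes c: "c > 0"
  shows "(\<integral>\<^sup>+t. ennreal (exp (- c * t) / sqrt t) * indicator {0<..} t \<partial>lborel) = ennreal (sqrt (pi / c))"
proof (rule nn_integral_substitution_Ioi[where g="\<lambda>v. v\<^sup>2" and g'="\<lambda>v. 2 * v"])
  have "(\<integral>\<^sup>+v. ennreal (\<bar>2 * v\<bar> * (exp (- c * v\<^sup>2) / sqrt (v\<^sup>2))) * indicator {0<..} v \<partial>lborel)
     = (\<integral>\<^sup>+v. 2 * (ennreal (exp (- c * v\<^sup>2)) * indicator {0<..} v) \<partial>lborel)"
    by (intro nn_integral_cong) (auto simp: indicator_def ennreal_mult)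
  also have "\<dots> = 2 * (\<integral>\<^sup>+v. ennreal (exp (- c * v\<^sup>2)) * indicator {0<..} v \<partial>lborel)"
    by (rule nn_integral_cmult) measurable
  also have "\<dots> = 2 * ennreal (sqrt (pi / c) / 2)"
    by (simp only: nn_integral_gaussian_Ioi[OF c])
  also have "\<dots> = ennreal (2 * (sqrt (pi / c) / 2))"
    using c by (subst ennreal_mult) auto
  finally show "(\<integral>\<^sup>+v. ennreal (\<bar>2 * v\<bar> * (exp (- c * v\<^sup>2) / sqrt (v\<^sup>2))) * indicator {0<..} v \<partial>lborel) = ennreal (sqrt (pi / c))"
    by simp
qed (use c in \<open>auto simp: image_power2_Ioi inj_power2_Ioi intro!: derivative_eq_intros\<close>)

text \<open>The inversion \<open>s = 1 / v\<close> turns the first integral into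
  \<open>nn_integral_rsqrt_exp\<close> and the second into a plain exponential integral.\<close>

lemma nn_integral_inverse_exp:
  assumes c: "c > 0"
  shows "(\<integral>\<^sup>+s. ennreal (inverse (sqrt s ^ 3) * exp (- c / s)) * indicator {0<..} s \<partial>lborel) = ennreal (sqrt (pi / c))"
    and "(\<integral>\<^sup>+s. ennreal (inverse (s\<^sup>2) * exp (- c / s)) * indicator {0<..} s \<partial>lborel) = ennreal (1 / c)"
proof -
  have d: "v > 0 \<Longrightarrow> (inverse has_field_derivative - inverse (v\<^sup>2)) (at v)" for v :: real
    by (auto intro!: derivative_eq_intros simp: power2_eq_square)
  show "(\<integral>\<^sup>+s. ennreal (inverse (sqrt s ^ 3) * exp (- c / s)) * indicator {0<..} s \<partial>lborel) = ennreal (sqrt (pi / c))"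
  proof (rule nn_integral_substitution_Ioi[where g=inverse and g'="\<lambda>v. - inverse (v\<^sup>2)"])
    have "\<bar>- inverse (v\<^sup>2)\<bar> * (inverse (sqrt (inverse v) ^ 3) * exp (- c / inverse v)) = exp (- c * v) / sqrt v" if "v > 0" for v
    proof -
      have w: "inverse (w ^ 4) * (inverse (inverse w ^ 3) * E) = E / w" if "w > 0" for w E :: real
        using that by (simp add: field_simps eval_nat_numeral)
      have "sqrt v ^ 4 = (sqrt v ^ 2) ^ 2" by (simp flip: power_mult)
      then have "v\<^sup>2 = sqrt v ^ 4" using that by simp
      moreover have "- c / inverse v = - c * v" by (simp add: divide_inverse)
      ultimately show ?thesis using w[of "sqrt v" "exp (- c * v)"] that by (simp only: real_sqrt_inverse abs_minus abs_of_nonneg zero_le_power real_sqrt_gt_zero inverse_nonnegative_iff_nonnegative real_sqrt_ge_zero less_imp_le)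
    qed
    then have "(\<integral>\<^sup>+v. ennreal (\<bar>- inverse (v\<^sup>2)\<bar> * (inverse (sqrt (inverse v) ^ 3) * exp (- c / inverse v))) * indicator {0<..} v \<partial>lborel)
       = (\<integral>\<^sup>+v. ennreal (exp (- c * v) / sqrt v) * indicator {0<..} v \<partial>lborel)"
      by (intro nn_integral_cong) (auto simp: indicator_def)
    then show "(\<integral>\<^sup>+v. ennreal (\<bar>- inverse (v\<^sup>2)\<bar> * (inverse (sqrt (inverse v) ^ 3) * exp (- c / inverse v))) * indicator {0<..} v \<partial>lborel)
       = ennreal (sqrt (pi / c))" using nn_integral_rsqrt_exp[OF c] by simp
  qed (use c d in \<open>auto simp: image_inverse_Ioi inj_on_def\<close>)
  show "(\<integral>\<^sup>+s. ennreal (inverse (s\<^sup>2) * exp (- c / s)) * indicator {0<..} s \<partial>lborel) = ennreal (1 / c)"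
  proof (rule nn_integral_substitution_Ioi[where g=inverse and g'="\<lambda>v. - inverse (v\<^sup>2)"])
    have "(\<integral>\<^sup>+v. ennreal (\<bar>- inverse (v\<^sup>2)\<bar> * (inverse ((inverse v)\<^sup>2) * exp (- c / inverse v))) * indicator {0<..} v \<partial>lborel)
       = (\<integral>\<^sup>+v. ennreal (exp (- c * v)) * indicator {0<..} v \<partial>lborel)"
      by (intro nn_integral_cong) (auto simp: indicator_def field_simps)
    then show "(\<integral>\<^sup>+v. ennreal (\<bar>- inverse (v\<^sup>2)\<bar> * (inverse ((inverse v)\<^sup>2) * exp (- c / inverse v))) * indicator {0<..} v \<partial>lborel)
       = ennreal (1 / c)" using nn_integral_exp_Ioi[OF c] by simp
  qed (use c d in \<open>auto simp: image_inverse_Ioi inj_on_def\<close>)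
qed

text \<open>\<open>e^(-3/2)\<close> is, up to a constant, the density that represents the square
  root through \<open>1 - exp (- e r^2)\<close>; it therefore turns heat energies into the symbol
  \<open>|xi|\<close>.\<close>

definition weight :: "real \<Rightarrow> real" where
  "weight e = inverse (sqrt e ^ 3)"

lemma weight_measurable [measurable]: "weight \<in> borel_measurable borel"
  unfolding weight_def[abs_def] by measurable

lemma weight_nonneg: "e > 0 \<Longrightarrow> weight e \<ge> 0"
  by (simp add: weight_def)

lemma nn_integral_weight_atLeast:
  assumes t: "t > 0"
  shows "(\<integral>\<^sup>+e. ennreal (weight e) * indicator {t..} e \<partial>lborel) = ennreal (2 / sqrt t)"
proof -
  have "(\<integral>\<^sup>+e. ennreal (weight e) * indicator {t..} e \<partial>lborel) = ennreal (0 - (- 2 / sqrt t))"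
  proof (rule nn_integral_FTC_atLeast)
    have "((\<lambda>x. - 2 / sqrt x) \<longlongrightarrow> 0) at_top"
      by (intro real_tendsto_divide_at_top[OF tendsto_const] sqrt_at_top)
    then show "((\<lambda>x. - 2 / sqrt x) \<longlongrightarrow> 0) at_top" .
    show "DERIV (\<lambda>x. - 2 / sqrt x) x :> weight x" if "t \<le> x" for x
    proof -
      have "x > 0" using t that by simp
      then have "sqrt x * sqrt x = x" "sqrt x > 0" by auto
      with \<open>x > 0\<close> show ?thesis unfolding weight_def
        by (auto intro!: derivative_eq_intros simp: field_simps power3_eq_cube)
    qed
  qed (use t weight_nonneg in auto)
  then show ?thesis by simp
qed

text \<open>Tonelli with the tail integral \<open>2 / sqrt s\<close> of the weight. The same
  exchange is applied to the symbol and to the heat representation of the Newton potential, so the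
  constants on the two sides of Kato's inequality are comparable.\<close>

lemma nn_integral_weight_swap:
  fixes q :: "real \<Rightarrow> ennreal"
  assumes [measurable]: "q \<in> borel_measurable borel"
  shows "(\<integral>\<^sup>+e. ennreal (weight e) * indicator {0<..} e * (\<integral>\<^sup>+s. q s * indicator {0<..e} s \<partial>lborel) \<partial>lborel)
    = (\<integral>\<^sup>+s. q s * ennreal (2 / sqrt s) * indicator {0<..} s \<partial>lborel)"
proof -
  have "(\<integral>\<^sup>+e. ennreal (weight e) * indicator {0<..} e * (\<integral>\<^sup>+s. q s * indicator {0<..e} s \<partial>lborel) \<partial>lborel)
     = (\<integral>\<^sup>+e. \<integral>\<^sup>+s. (q s * indicator {0<..} s) * (ennreal (weight e) * indicator {s..} e) \<partial>lborel \<partial>lborel)"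
  proof (rule nn_integral_cong)
    fix e :: real
    have "ennreal (weight e) * indicator {0<..} e * (\<integral>\<^sup>+s. q s * indicator {0<..e} s \<partial>lborel)
      = (\<integral>\<^sup>+s. ennreal (weight e) * indicator {0<..} e * (q s * indicator {0<..e} s) \<partial>lborel)"
      by (rule nn_integral_cmult[symmetric]) measurable
    also have "\<dots> = (\<integral>\<^sup>+s. (q s * indicator {0<..} s) * (ennreal (weight e) * indicator {s..} e) \<partial>lborel)"
      by (intro nn_integral_cong) (auto simp: indicator_def mult.commute)
    finally show "ennreal (weight e) * indicator {0<..} e * (\<integral>\<^sup>+s. q s * indicator {0<..e} s \<partial>lborel) = \<dots>" .
  qed
  also have "\<dots> = (\<integral>\<^sup>+s. \<integral>\<^sup>+e. (q s * indicator {0<..} s) * (ennreal (weight e) * indicator {s..} e) \<partial>lborel \<partial>lborel)"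
  proof (rule lborel_pair.Fubini')
    have [measurable]: "Measurable.pred (borel \<Otimes>\<^sub>M borel) (\<lambda>p::real\<times>real. snd p \<in> {fst p..})"
      unfolding atLeast_iff by measurable
    show "(\<lambda>(s, e). (q s * indicator {0<..} s) * (ennreal (weight e) * indicator {s..} e)) \<in> borel_measurable (lborel \<Otimes>\<^sub>M lborel)"
      unfolding split_beta' by measurable
  qed
  also have "\<dots> = (\<integral>\<^sup>+s. q s * ennreal (2 / sqrt s) * indicator {0<..} s \<partial>lborel)"
  proof (rule nn_integral_cong)
    fix s :: real
    have "(\<integral>\<^sup>+e. (q s * indicator {0<..} s) * (ennreal (weight e) * indicator {s..} e) \<partial>lborel)
       = (q s * indicator {0<..} s) * (\<integral>\<^sup>+e. ennreal (weight e) * indicator {s..} e \<partial>lborel)"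
      by (rule nn_integral_cmult) measurable
    then show "(\<integral>\<^sup>+e. (q s * indicator {0<..} s) * (ennreal (weight e) * indicator {s..} e) \<partial>lborel) = q s * ennreal (2 / sqrt s) * indicator {0<..} s"
      by (cases "s > 0") (simp_all add: nn_integral_weight_atLeast)
  qed
  finally show ?thesis .
qed

text \<open>Write \<open>1 - exp (- e * r^2)\<close> as the integral over \<open>s\<close> in
  \<open>(0, e]\<close> of \<open>r^2 * exp (- s * r^2)\<close> and exchange the integrals; what
  remains is the Gamma integral of order 1/2.\<close>

lemma nn_integral_weight_symbol:
  assumes r: "r \<ge> 0"
  shows "(\<integral>\<^sup>+e. ennreal (weight e) * indicator {0<..} e * ennreal (1 - exp (- e * r\<^sup>2)) \<partial>lborel) = ennreal (2 * sqrt pi * r)"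
proof (cases "r = 0")
  case False
  then have r: "r > 0" using r by simp
  have i: "ennreal (1 - exp (- e * r\<^sup>2)) = (\<integral>\<^sup>+s. ennreal (r\<^sup>2 * exp (- s * r\<^sup>2)) * indicator {0<..e} s \<partial>lborel)" if e: "e > 0" for e
  proof -
    have "(\<integral>\<^sup>+s. ennreal (r\<^sup>2 * exp (- s * r\<^sup>2)) * indicator {0<..e} s \<partial>lborel)
       = (\<integral>\<^sup>+s. ennreal (r\<^sup>2 * exp (- s * r\<^sup>2)) * indicator {0..e} s \<partial>lborel)"
      using AE_lborel_singleton[of "0::real"] by (intro nn_integral_cong_AE) (auto elim!: eventually_mono simp: indicator_def)
    also have "\<dots> = ennreal (- exp (- e * r\<^sup>2) - (- exp (- 0 * r\<^sup>2)))"
      using e r by (intro nn_integral_FTC_Icc[where F="\<lambda>s. - exp (- s * r\<^sup>2)"]) (auto intro!: derivative_eq_intros)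
    finally show ?thesis by simp
  qed
  have "(\<integral>\<^sup>+e. ennreal (weight e) * indicator {0<..} e * ennreal (1 - exp (- e * r\<^sup>2)) \<partial>lborel)
     = (\<integral>\<^sup>+e. ennreal (weight e) * indicator {0<..} e * (\<integral>\<^sup>+s. ennreal (r\<^sup>2 * exp (- s * r\<^sup>2)) * indicator {0<..e} s \<partial>lborel) \<partial>lborel)"
    using i by (intro nn_integral_cong) (auto simp: indicator_def)
  also have "\<dots> = (\<integral>\<^sup>+s. ennreal (r\<^sup>2 * exp (- s * r\<^sup>2)) * ennreal (2 / sqrt s) * indicator {0<..} s \<partial>lborel)"
    by (rule nn_integral_weight_swap) measurable
  also have "\<dots> = (\<integral>\<^sup>+s. ennreal (2 * r\<^sup>2) * (ennreal (exp (- r\<^sup>2 * s) / sqrt s) * indicator {0<..} s) \<partial>lborel)"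
    by (intro nn_integral_cong) (auto simp: indicator_def ennreal_mult[symmetric] field_simps)
  also have "\<dots> = ennreal (2 * r\<^sup>2) * (\<integral>\<^sup>+s. ennreal (exp (- r\<^sup>2 * s) / sqrt s) * indicator {0<..} s \<partial>lborel)"
    by (rule nn_integral_cmult) measurable
  also have "\<dots> = ennreal (2 * r\<^sup>2) * ennreal (sqrt (pi / r\<^sup>2))"
    using nn_integral_rsqrt_exp[of "r\<^sup>2"] r by (simp only: zero_less_power)
  also have "\<dots> = ennreal (2 * sqrt pi * r)"
    using r by (simp add: ennreal_mult[symmetric] real_sqrt_divide power2_eq_square)
  finally show ?thesis .
qed simp

subsection \<open>The Newton potential as a time integral of the heat kernel\<close>

text \<open>Both follow from \<open>nn_integral_inverse_exp\<close>. The first integral is the Green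
  function of \<open>-Delta\<close>; the second is what the weight makes of the short-time part of
  that function. Their quotient, \<open>4 / (sqrt pi |x|)\<close>, supplies the potential in Kato's
  inequality.\<close>

lemma heat_newton:
  assumes x: "x \<noteq> 0"
  shows "(\<integral>\<^sup>+s. ennreal (heat s x) * indicator {0<..} s \<partial>lborel) = ennreal (1 / (4 * pi * norm x))"
    and "(\<integral>\<^sup>+s. ennreal (heat s x) * ennreal (2 / sqrt s) * indicator {0<..} s \<partial>lborel) = ennreal (1 / (pi * sqrt pi * (norm x)\<^sup>2))"
proof -
  let ?c = "(norm x)\<^sup>2 / 4" and ?k = "inverse (8 * (pi * sqrt pi))"
  have c: "?c > 0" using x by simp
  have k: "inverse (sqrt (4 * pi * s) ^ 3) = ?k * inverse (sqrt s ^ 3)" if "s > 0" for s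
  proof -
    have "sqrt pi ^ 3 = pi * sqrt pi" by (simp add: power3_eq_cube)
    then show ?thesis using that by (simp add: real_sqrt_mult power_mult_distrib)
  qed
  have "(\<integral>\<^sup>+s. ennreal (heat s x) * indicator {0<..} s \<partial>lborel)
     = (\<integral>\<^sup>+s. ennreal ?k * (ennreal (inverse (sqrt s ^ 3) * exp (- ?c / s)) * indicator {0<..} s) \<partial>lborel)"
    by (intro nn_integral_cong) (auto simp: indicator_def ennreal_mult[symmetric] heat_eq k)
  also have "\<dots> = ennreal ?k * ennreal (sqrt (pi / ?c))"
    using nn_integral_inverse_exp(1)[OF c] by (subst nn_integral_cmult) auto
  also have "\<dots> = ennreal (1 / (4 * pi * norm x))"
    using x by (simp add: ennreal_mult[symmetric] real_sqrt_divide real_sqrt_mult field_simps)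
  finally show "(\<integral>\<^sup>+s. ennreal (heat s x) * indicator {0<..} s \<partial>lborel) = ennreal (1 / (4 * pi * norm x))" .
  have "(\<integral>\<^sup>+s. ennreal (heat s x) * ennreal (2 / sqrt s) * indicator {0<..} s \<partial>lborel)
     = (\<integral>\<^sup>+s. ennreal (2 * ?k) * (ennreal (inverse (s\<^sup>2) * exp (- ?c / s)) * indicator {0<..} s) \<partial>lborel)"
  proof (intro nn_integral_cong)
    fix s :: real
    have "heat s x * (2 / sqrt s) = 2 * ?k * (inverse (s\<^sup>2) * exp (- ?c / s))" if "s > 0"
    proof -
      have "sqrt s ^ 3 * sqrt s = (sqrt s * sqrt s) * (sqrt s * sqrt s)" unfolding power3_eq_cube by (simp only: mult_ac)
      also have "\<dots> = s\<^sup>2" using that by (simp add: power2_eq_square)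
      finally have s2: "inverse (s\<^sup>2) = inverse (sqrt s ^ 3) * inverse (sqrt s)"
        using that by (simp add: inverse_mult_distrib[symmetric])
      have "- (norm x)\<^sup>2 / (4 * s) = - ?c / s" by simp
      then show ?thesis unfolding heat_eq[OF that] k[OF that] s2 divide_inverse[of 2] by (simp only: mult_ac)
    qed
    then show "ennreal (heat s x) * ennreal (2 / sqrt s) * indicator {0<..} s = ennreal (2 * ?k) * (ennreal (inverse (s\<^sup>2) * exp (- ?c / s)) * indicator {0<..} s)"
      by (cases "s > 0") (auto simp: ennreal_mult[symmetric])
  qed
  also have "\<dots> = ennreal (2 * ?k) * ennreal (1 / ?c)"
    using nn_integral_inverse_exp(2)[OF c] by (subst nn_integral_cmult) auto
  also have "\<dots> = ennreal (1 / (pi * sqrt pi * (norm x)\<^sup>2))"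
    using x by (simp add: ennreal_mult[symmetric] field_simps)
  finally show "(\<integral>\<^sup>+s. ennreal (heat s x) * ennreal (2 / sqrt s) * indicator {0<..} s \<partial>lborel) = ennreal (1 / (pi * sqrt pi * (norm x)\<^sup>2))" .
qed

text \<open>The Newton potential after heat evolution for time \<open>e\<close>, given by its heat
  representation; \<open>e = 0\<close> is the potential itself.\<close>

definition tail_potential :: "real \<Rightarrow> real^3 \<Rightarrow> ennreal" where
  "tail_potential e x = (\<integral>\<^sup>+s. ennreal (heat s x) * indicator {e<..} s \<partial>lborel)"

lemma tail_potential_measurable [measurable]: "tail_potential e \<in> borel_measurable borel"
  unfolding tail_potential_def[abs_def] by measurable

lemma tail_potential_0: "x \<noteq> 0 \<Longrightarrow> tail_potential 0 x = ennreal (1 / (4 * pi * norm x))"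
  unfolding tail_potential_def by (rule heat_newton(1))

text \<open>By the semigroup law, running the flow for time \<open>e\<close> merely shifts the time
  variable of the representation.\<close>

lemma heat_tail_potential:
  assumes e: "e > 0"
  shows "(\<integral>\<^sup>+y. ennreal (heat e (x - y)) * tail_potential 0 (y - a) \<partial>lborel) = tail_potential e (x - a)"
proof -
  have sg: "(\<integral>\<^sup>+y. ennreal (heat e (x - y)) * ennreal (heat s (y - a)) \<partial>lborel) = heat (s + e) (x - a)" if "s > 0" for s
    using nn_integral_lborel_translate[of "\<lambda>y. ennreal (heat e (x - y)) * ennreal (heat s (y - a))" a] heat_semigroup[OF that e, of "x - a"]
    by (simp add: diff_diff_eq add.commute)
  have "(\<integral>\<^sup>+y. ennreal (heat e (x - y)) * tail_potential 0 (y - a) \<partial>lborel)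
     = (\<integral>\<^sup>+y. \<integral>\<^sup>+s. ennreal (heat e (x - y)) * (ennreal (heat s (y - a)) * indicator {0<..} s) \<partial>lborel \<partial>lborel)"
    unfolding tail_potential_def by (intro nn_integral_cong nn_integral_cmult[symmetric]) measurable
  also have "\<dots> = (\<integral>\<^sup>+s. \<integral>\<^sup>+y. ennreal (heat e (x - y)) * (ennreal (heat s (y - a)) * indicator {0<..} s) \<partial>lborel \<partial>lborel)"
    by (rule lborel_pair.Fubini') measurable
  also have "\<dots> = (\<integral>\<^sup>+s. ennreal (heat (s + e) (x - a)) * indicator {0<..} s \<partial>lborel)"
    using sg by (intro nn_integral_cong) (simp add: indicator_def)
  also have "\<dots> = (\<integral>\<^sup>+s. ennreal (heat (e + s) (x - a)) * indicator {e<..} (e + s) \<partial>lborel)"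
    by (intro nn_integral_cong) (auto simp: indicator_def add.commute)
  also have "\<dots> = tail_potential e (x - a)"
    unfolding tail_potential_def
    by (rule nn_integral_lborel_translate[where f="\<lambda>s. ennreal (heat s (x - a)) * indicator {e<..} s"]) measurable
  finally show ?thesis .
qed

lemma tail_potential_split:
  assumes e: "e > 0"
  shows "tail_potential 0 x = tail_potential e x + (\<integral>\<^sup>+s. ennreal (heat s x) * indicator {0<..e} s \<partial>lborel)"
  unfolding tail_potential_def using e
  by (subst nn_integral_add[symmetric]) (auto intro!: nn_integral_cong simp: indicator_def)

lemma short_time_potential_measurable [measurable (raw)]:
  fixes f :: "'a \<Rightarrow> real" and g :: "'a \<Rightarrow> real^3"
  assumes [measurable]: "f \<in> borel_measurable M" "g \<in> borel_measurable M"
  shows "(\<lambda>x. \<integral>\<^sup>+s. ennreal (heat s (g x)) * indicator {0<..f x} s \<partial>lborel) \<in> borel_measurable M"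
proof -
  \<comment> \<open>The interval with moving end point is written through the fixed set
    \<open>{0..}\<close> evaluated at \<open>f x - s\<close>, which makes joint measurability
    evident.\<close>
  have "(\<lambda>x. \<integral>\<^sup>+s. ennreal (heat s (g x)) * (indicator {0<..} s * indicator {0..} (f x - s)) \<partial>lborel) \<in> borel_measurable M"
    by measurable
  also have "(\<lambda>x. \<integral>\<^sup>+s. ennreal (heat s (g x)) * (indicator {0<..} s * indicator {0..} (f x - s)) \<partial>lborel)
    = (\<lambda>x. \<integral>\<^sup>+s. ennreal (heat s (g x)) * indicator {0<..f x} s \<partial>lborel)"
    by (intro ext nn_integral_cong) (auto simp: indicator_def)
  finally show ?thesis .
qed

subsection \<open>Kato's inequality\<close>

text \<open>By Plancherel the mass in \<open>heat_identity\<close> is an integral over frequencies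
  too, and the Gaussian part, being finite, can be cancelled in \<open>ennreal\<close>.\<close>

lemma shift_energy_symbol:
  assumes fg: "is_fourier f g" and e: "e > 0"
  shows "shift_energy e f = 2 * (\<integral>\<^sup>+\<xi>. ennreal ((1 - exp (- e * (norm \<xi>)\<^sup>2)) * (cmod (g \<xi>))\<^sup>2) \<partial>lborel)"
proof -
  note L = is_fourier_L2[OF fg]
  note [measurable] = L2_measurable[OF L(1)] L2_measurable[OF L(2)]
  let ?E = "\<integral>\<^sup>+\<xi>. ennreal (exp (- e * (norm \<xi>)\<^sup>2) * (cmod (g \<xi>))\<^sup>2) \<partial>lborel"
  let ?D = "\<integral>\<^sup>+\<xi>. ennreal ((1 - exp (- e * (norm \<xi>)\<^sup>2)) * (cmod (g \<xi>))\<^sup>2) \<partial>lborel"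
  have le1: "exp (- e * (norm \<xi>)\<^sup>2) \<le> 1" for \<xi> :: "real^3" using e by simp
  have "?D + ?E = (\<integral>\<^sup>+\<xi>. ennreal ((cmod (g \<xi>))\<^sup>2) \<partial>lborel)"
  proof (subst nn_integral_add[symmetric], measurable, rule nn_integral_cong)
    fix \<xi>
    show "ennreal ((1 - exp (- e * (norm \<xi>)\<^sup>2)) * (cmod (g \<xi>))\<^sup>2) + ennreal (exp (- e * (norm \<xi>)\<^sup>2) * (cmod (g \<xi>))\<^sup>2) = ennreal ((cmod (g \<xi>))\<^sup>2)"
    proof -
      have "0 \<le> (1 - exp (- e * (norm \<xi>)\<^sup>2)) * (cmod (g \<xi>))\<^sup>2"
        using le1[of \<xi>] by (intro mult_nonneg_nonneg) auto
      from ennreal_plus[symmetric, OF this, of "exp (- e * (norm \<xi>)\<^sup>2) * (cmod (g \<xi>))\<^sup>2"] show ?thesis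
        by (simp add: algebra_simps)
    qed
  qed
  also have "\<dots> = ennreal (L2norm2 f)" using plancherel[OF fg] by (simp add: nn_integral_L2[OF L(2)])
  finally have DE: "?D + ?E = ennreal (L2norm2 f)" .
  then have "?E \<noteq> \<top>" by (metis ennreal_add_eq_top ennreal_neq_top)
  then have "2 * ?E \<noteq> \<top>" by (simp add: ennreal_mult_eq_top_iff)
  moreover have "2 * ?E + shift_energy e f = 2 * ?E + 2 * ?D"
    using heat_identity[OF fg e] unfolding DE[symmetric] by (simp only: distrib_left add.commute)
  ultimately show ?thesis unfolding ennreal_add_left_cancel by simp
qed

lemma weighted_am_gm:
  assumes "A > 0" "B > 0"
  shows "2 * a * b \<le> a\<^sup>2 * (B / A) + b\<^sup>2 * (A / (B::real))"
proof -
  have "0 \<le> (a * B - b * A)\<^sup>2 / (A * B)" using assms by simp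
  also have "\<dots> = a\<^sup>2 * (B / A) + b\<^sup>2 * (A / B) - 2 * a * b"
    using assms by (simp add: power2_eq_square field_simps)
  finally show ?thesis by simp
qed

text \<open>Schur test for the heat kernel with the supersolution \<open>1 / |x - a|\<close>: the defect of this
  function under the heat flow is the short-time part of its heat representation.\<close>
lemma heat_schur:
  assumes f: "L2 f" and e: "e > 0"
  shows "2 * (\<integral>\<^sup>+x. ennreal (4 * pi * norm (x - a) * (cmod (f x))\<^sup>2) * (\<integral>\<^sup>+s. ennreal (heat s (x - a)) * indicator {0<..e} s \<partial>lborel) \<partial>lborel)
    \<le> shift_energy e f"
proof -
  note [measurable] = L2_measurable[OF f]
  \<comment> \<open>\<open>?k\<close> is \<open>|f|^2\<close> divided by the Newton potential
    \<open>?h\<close>, so that \<open>?k x * ?h x\<close> gives back the density almost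
    everywhere.\<close>
  let ?k = "\<lambda>x. ennreal (4 * pi * norm (x - a) * (cmod (f x))\<^sup>2)"
  let ?H = "\<lambda>x y. ennreal (heat e (x - y))"
  let ?h = "\<lambda>x. tail_potential 0 (x - a)"
  define J where "J = (\<integral>\<^sup>+x. ?k x * tail_potential e (x - a) \<partial>lborel)"
  define I where "I = (\<integral>\<^sup>+x. ?k x * (\<integral>\<^sup>+s. ennreal (heat s (x - a)) * indicator {0<..e} s \<partial>lborel) \<partial>lborel)"
  let ?N = "\<integral>\<^sup>+x. ennreal ((cmod (f x))\<^sup>2) \<partial>lborel"
  have N: "?N = J + I"
  proof -
    have "?N = (\<integral>\<^sup>+x. ?k x * ?h x \<partial>lborel)"
    proof (rule nn_integral_cong_AE)
      show "AE x in lborel. ennreal ((cmod (f x))\<^sup>2) = ?k x * ?h x"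
        using AE_lborel_singleton[of a] by eventually_elim (simp add: tail_potential_0 ennreal_mult[symmetric])
    qed
    also have "\<dots> = J + I"
      unfolding J_def I_def tail_potential_split[OF e] by (subst nn_integral_add[symmetric]) (auto simp: distrib_left)
    finally show ?thesis .
  qed
  have Jfin: "J \<noteq> \<top>" using N nn_integral_L2[OF f] by (metis ennreal_add_eq_top ennreal_neq_top)
  have H1: "(\<integral>\<^sup>+y. ?H x y \<partial>lborel) = 1" for x
    using nn_integral_heat(1)[OF e, of x] by (simp add: heat_commute[of e x])
  have H2: "(\<integral>\<^sup>+x. ?H x y \<partial>lborel) = 1" for y
    using nn_integral_heat(1)[OF e, of y] by simp
  have a1: "(\<integral>\<^sup>+x. \<integral>\<^sup>+y. ?H x y * ennreal ((cmod (f x))\<^sup>2) \<partial>lborel \<partial>lborel) = ?N"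
    by (simp add: nn_integral_multc H1)
  have a2: "(\<integral>\<^sup>+x. \<integral>\<^sup>+y. ?H x y * ennreal ((cmod (f y))\<^sup>2) \<partial>lborel \<partial>lborel) = ?N"
    by (subst lborel_pair.Fubini') (simp_all add: nn_integral_multc H2)
  have b1: "(\<integral>\<^sup>+x. \<integral>\<^sup>+y. ?k x * (?H x y * ?h y) \<partial>lborel \<partial>lborel) = J"
    unfolding J_def by (intro nn_integral_cong) (simp add: nn_integral_cmult heat_tail_potential[OF e])
  have b2: "(\<integral>\<^sup>+x. \<integral>\<^sup>+y. ?k y * (?H x y * ?h x) \<partial>lborel \<partial>lborel) = J"
    unfolding J_def by (subst lborel_pair.Fubini')
      (auto intro!: nn_integral_cong simp: nn_integral_cmult heat_tail_potential[OF e] heat_commute[of e _ "_ :: real^3"])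
  have se: "shift_energy e f = (\<integral>\<^sup>+x. \<integral>\<^sup>+y. ennreal (heat e (x - y) * (cmod (f x - f y))\<^sup>2) \<partial>lborel \<partial>lborel)"
    unfolding shift_energy_eq_pair[OF L2_measurable[OF f]] by (subst lborel.nn_integral_fst[symmetric]) simp_all
  \<comment> \<open>The cross term of \<open>(|f x| - |f y|)^2\<close> is split by the
    arithmetic-geometric mean with weights \<open>?h y / ?h x\<close> and
    \<open>?h x / ?h y\<close>; integrating out the variable that enters only through
    \<open>?h\<close> and the kernel then evolves \<open>?h\<close> under the heat flow.\<close>
  have pw: "?H x y * ennreal ((cmod (f x))\<^sup>2) + ?H x y * ennreal ((cmod (f y))\<^sup>2)
     \<le> ennreal (heat e (x - y) * (cmod (f x - f y))\<^sup>2) + (?k x * (?H x y * ?h y) + ?k y * (?H x y * ?h x))"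
    if "x \<noteq> a" "y \<noteq> a" for x y
  proof -
    define A where "A = 1 / (4 * pi * norm (x - a))"
    define B where "B = 1 / (4 * pi * norm (y - a))"
    have AB: "A > 0" "B > 0" using that by (auto simp: A_def B_def)
    have kk: "4 * pi * norm (x - a) = 1 / A" "4 * pi * norm (y - a) = 1 / B" by (auto simp: A_def B_def)
    have hh: "?h x = ennreal A" "?h y = ennreal B" using that by (auto simp: A_def B_def tail_potential_0)
    let ?fx = "cmod (f x)" and ?fy = "cmod (f y)"
    have "(?fx - ?fy)\<^sup>2 \<le> (cmod (f x - f y))\<^sup>2"
      using norm_triangle_ineq3[of "f x" "f y"] by (metis abs_le_square_iff abs_norm_cancel)
    moreover have "(?fx - ?fy)\<^sup>2 = ?fx\<^sup>2 + ?fy\<^sup>2 - 2 * ?fx * ?fy" by (simp add: power2_diff)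
    ultimately have "?fx\<^sup>2 + ?fy\<^sup>2 \<le> (cmod (f x - f y))\<^sup>2 + (?fx\<^sup>2 * (B / A) + ?fy\<^sup>2 * (A / B))"
      using weighted_am_gm[OF AB, of ?fx ?fy] by linarith
    from mult_left_mono[OF this heat_nonneg, of e "x - y"]
    have "heat e (x - y) * ?fx\<^sup>2 + heat e (x - y) * ?fy\<^sup>2
      \<le> heat e (x - y) * (cmod (f x - f y))\<^sup>2 + (1 / A * ?fx\<^sup>2 * (heat e (x - y) * B) + 1 / B * ?fy\<^sup>2 * (heat e (x - y) * A))"
      by (simp add: distrib_left mult_ac)
    then show ?thesis
      unfolding hh kk using AB by (simp add: ennreal_mult[symmetric] ennreal_leI flip: ennreal_plus)
  qed
  have "?N + ?N = (\<integral>\<^sup>+x. \<integral>\<^sup>+y. ?H x y * ennreal ((cmod (f x))\<^sup>2) + ?H x y * ennreal ((cmod (f y))\<^sup>2) \<partial>lborel \<partial>lborel)"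
    using a1 a2 by (simp add: nn_integral_add)
  also have "\<dots> \<le> (\<integral>\<^sup>+x. \<integral>\<^sup>+y. ennreal (heat e (x - y) * (cmod (f x - f y))\<^sup>2) + (?k x * (?H x y * ?h y) + ?k y * (?H x y * ?h x)) \<partial>lborel \<partial>lborel)"
  proof (rule nn_integral_mono_AE)
    show "AE x in lborel. (\<integral>\<^sup>+y. ?H x y * ennreal ((cmod (f x))\<^sup>2) + ?H x y * ennreal ((cmod (f y))\<^sup>2) \<partial>lborel) \<le>
      (\<integral>\<^sup>+y. ennreal (heat e (x - y) * (cmod (f x - f y))\<^sup>2) + (?k x * (?H x y * ?h y) + ?k y * (?H x y * ?h x)) \<partial>lborel)"
      using AE_lborel_singleton[of a]
    proof eventually_elim
      case (elim x)
      show ?case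
        by (rule nn_integral_mono_AE) (use AE_lborel_singleton[of a] in eventually_elim, rule pw[OF elim])
    qed
  qed
  also have "\<dots> = shift_energy e f + (J + J)"
    unfolding se using b1 b2 by (simp add: nn_integral_add)
  \<comment> \<open>Both copies of the mass are \<open>J + I\<close>; the finite part
    \<open>J + J\<close> cancels and the defect \<open>I\<close> of the supersolution
    remains.\<close>
  finally have "(J + J) + 2 * I \<le> (J + J) + shift_energy e f"
    unfolding N by (simp only: mult_2 add_ac)
  then show ?thesis
    using Jfin unfolding I_def[symmetric] ennreal_add_left_cancel_le by simp
qed

lemma nn_integral_weight_kinetic:
  assumes [measurable]: "k \<in> borel_measurable borel"
  shows "(\<integral>\<^sup>+e. ennreal (weight e) * indicator {0<..} e * (\<integral>\<^sup>+\<xi>. ennreal ((1 - exp (- e * (norm \<xi>)\<^sup>2)) * (cmod (k \<xi>))\<^sup>2) \<partial>lborel) \<partial>lborel)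
    = ennreal (2 * sqrt pi) * (\<integral>\<^sup>+\<xi>. ennreal (norm \<xi> * (cmod (k (\<xi>::real^3)))\<^sup>2) \<partial>lborel)"
proof -
  let ?w = "\<lambda>e. ennreal (weight e) * indicator {0<..} e"
  let ?D = "\<lambda>g e. \<integral>\<^sup>+\<xi>. ennreal ((1 - exp (- e * (norm \<xi>)\<^sup>2)) * (cmod (g (\<xi>::real^3)))\<^sup>2) \<partial>lborel"
  have "(\<integral>\<^sup>+e. ?w e * ?D k e \<partial>lborel) = (\<integral>\<^sup>+e. \<integral>\<^sup>+\<xi>. ?w e * ennreal (1 - exp (- e * (norm \<xi>)\<^sup>2)) * ennreal ((cmod (k \<xi>))\<^sup>2) \<partial>lborel \<partial>lborel)"
  proof (rule nn_integral_cong)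
    fix e :: real
    have "?w e * ?D k e = (\<integral>\<^sup>+\<xi>. ?w e * ennreal ((1 - exp (- e * (norm \<xi>)\<^sup>2)) * (cmod (k \<xi>))\<^sup>2) \<partial>lborel)"
      by (rule nn_integral_cmult[symmetric]) measurable
    also have "\<dots> = (\<integral>\<^sup>+\<xi>. ?w e * ennreal (1 - exp (- e * (norm \<xi>)\<^sup>2)) * ennreal ((cmod (k \<xi>))\<^sup>2) \<partial>lborel)"
      by (intro nn_integral_cong) (auto simp: indicator_def ennreal_mult mult.assoc)
    finally show "?w e * ?D k e = \<dots>" .
  qed
  also have "\<dots> = (\<integral>\<^sup>+\<xi>. \<integral>\<^sup>+e. ?w e * ennreal (1 - exp (- e * (norm \<xi>)\<^sup>2)) * ennreal ((cmod (k \<xi>))\<^sup>2) \<partial>lborel \<partial>lborel)"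
    by (rule lborel_pair.Fubini') measurable
  also have "\<dots> = (\<integral>\<^sup>+\<xi>. ennreal (2 * sqrt pi * norm \<xi>) * ennreal ((cmod (k \<xi>))\<^sup>2) \<partial>lborel)"
  proof (rule nn_integral_cong)
    fix \<xi> :: "real^3"
    show "(\<integral>\<^sup>+e. ?w e * ennreal (1 - exp (- e * (norm \<xi>)\<^sup>2)) * ennreal ((cmod (k \<xi>))\<^sup>2) \<partial>lborel) = ennreal (2 * sqrt pi * norm \<xi>) * ennreal ((cmod (k \<xi>))\<^sup>2)"
      by (subst nn_integral_multc) (simp_all add: nn_integral_weight_symbol[OF norm_ge_zero, simplified])
  qed
  also have "\<dots> = ennreal (2 * sqrt pi) * (\<integral>\<^sup>+\<xi>. ennreal (norm \<xi> * (cmod (k \<xi>))\<^sup>2) \<partial>lborel)"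
    by (subst nn_integral_cmult[symmetric]) (simp_all add: ennreal_mult[symmetric] mult.assoc)
  finally show ?thesis .
qed

text \<open>Integrate the Schur bound against the weight. The left side becomes
  \<open>4 / sqrt pi\<close> times the potential integral, from \<open>4 pi |x - a|\<close> times
  \<open>1 / (pi sqrt pi |x - a|^2)\<close>; the right side becomes \<open>2 sqrt pi\<close> times
  the kinetic integral.\<close>

theorem kato_nn:
  assumes fg: "is_fourier f g"
  shows "(\<integral>\<^sup>+x. ennreal ((cmod (f x))\<^sup>2 / norm (x - a)) \<partial>lborel)
    \<le> ennreal (pi / 2) * (\<integral>\<^sup>+\<xi>. ennreal (norm \<xi> * (cmod (g \<xi>))\<^sup>2) \<partial>lborel)"
proof -
  note L = is_fourier_L2[OF fg]
  note [measurable] = L2_measurable[OF L(1)] L2_measurable[OF L(2)]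
  let ?k = "\<lambda>x. ennreal (4 * pi * norm (x - a) * (cmod (f x))\<^sup>2)"
  let ?w = "\<lambda>e. ennreal (weight e) * indicator {0<..} e"
  let ?I = "\<lambda>e. \<integral>\<^sup>+x. ?k x * (\<integral>\<^sup>+s. ennreal (heat s (x - a)) * indicator {0<..e} s \<partial>lborel) \<partial>lborel"
  let ?D = "\<lambda>e. \<integral>\<^sup>+\<xi>. ennreal ((1 - exp (- e * (norm \<xi>)\<^sup>2)) * (cmod (g \<xi>))\<^sup>2) \<partial>lborel"
  let ?A = "\<integral>\<^sup>+\<xi>. ennreal (norm \<xi> * (cmod (g \<xi>))\<^sup>2) \<partial>lborel"
  let ?B = "\<integral>\<^sup>+x. ennreal ((cmod (f x))\<^sup>2 / norm (x - a)) \<partial>lborel"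
  have ID: "?I e \<le> ?D e" if "e > 0" for e
    using heat_schur[OF L(1) that, of a] unfolding shift_energy_symbol[OF fg that]
    by (subst (asm) ennreal_mult_le_mult_iff) auto
  have "ennreal (4 / sqrt pi) * ?B = (\<integral>\<^sup>+x. ?k x * (\<integral>\<^sup>+s. ennreal (heat s (x - a)) * ennreal (2 / sqrt s) * indicator {0<..} s \<partial>lborel) \<partial>lborel)"
  proof (subst nn_integral_cmult[symmetric], measurable, rule nn_integral_cong_AE)
    show "AE x in lborel. ennreal (4 / sqrt pi) * ennreal ((cmod (f x))\<^sup>2 / norm (x - a))
       = ?k x * (\<integral>\<^sup>+s. ennreal (heat s (x - a)) * ennreal (2 / sqrt s) * indicator {0<..} s \<partial>lborel)"
      using AE_lborel_singleton[of a]
    proof eventually_elim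
      case (elim x)
      then have "x - a \<noteq> 0" by simp
      then show ?case unfolding heat_newton(2)[OF \<open>x - a \<noteq> 0\<close>]
        by (simp add: ennreal_mult[symmetric] power2_eq_square field_simps)
    qed
  qed
  also have "\<dots> = (\<integral>\<^sup>+x. ?k x * (\<integral>\<^sup>+e. ?w e * (\<integral>\<^sup>+s. ennreal (heat s (x - a)) * indicator {0<..e} s \<partial>lborel) \<partial>lborel) \<partial>lborel)"
  proof (rule nn_integral_cong)
    fix x
    have "(\<lambda>s. ennreal (heat s (x - a))) \<in> borel_measurable borel" by measurable
    from nn_integral_weight_swap[OF this]
    show "?k x * (\<integral>\<^sup>+s. ennreal (heat s (x - a)) * ennreal (2 / sqrt s) * indicator {0<..} s \<partial>lborel)
      = ?k x * (\<integral>\<^sup>+e. ?w e * (\<integral>\<^sup>+s. ennreal (heat s (x - a)) * indicator {0<..e} s \<partial>lborel) \<partial>lborel)"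
      by (simp only:)
  qed
  also have "\<dots> = (\<integral>\<^sup>+x. \<integral>\<^sup>+e. ?w e * (?k x * (\<integral>\<^sup>+s. ennreal (heat s (x - a)) * indicator {0<..e} s \<partial>lborel)) \<partial>lborel \<partial>lborel)"
  proof (rule nn_integral_cong)
    fix x
    show "?k x * (\<integral>\<^sup>+e. ?w e * (\<integral>\<^sup>+s. ennreal (heat s (x - a)) * indicator {0<..e} s \<partial>lborel) \<partial>lborel)
      = (\<integral>\<^sup>+e. ?w e * (?k x * (\<integral>\<^sup>+s. ennreal (heat s (x - a)) * indicator {0<..e} s \<partial>lborel)) \<partial>lborel)"
      by (subst nn_integral_cmult[symmetric], measurable) (simp only: mult_ac)
  qed
  also have "\<dots> = (\<integral>\<^sup>+e. \<integral>\<^sup>+x. ?w e * (?k x * (\<integral>\<^sup>+s. ennreal (heat s (x - a)) * indicator {0<..e} s \<partial>lborel)) \<partial>lborel \<partial>lborel)"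
  proof (rule lborel_pair.Fubini')
    show "(\<lambda>(e, x). ?w e * (?k x * (\<integral>\<^sup>+s. ennreal (heat s (x - a)) * indicator {0<..e} s \<partial>lborel))) \<in> borel_measurable (lborel \<Otimes>\<^sub>M lborel)"
      unfolding split_beta' by measurable
  qed
  also have "\<dots> = (\<integral>\<^sup>+e. ?w e * ?I e \<partial>lborel)"
  proof (rule nn_integral_cong)
    fix e
    show "(\<integral>\<^sup>+x. ?w e * (?k x * (\<integral>\<^sup>+s. ennreal (heat s (x - a)) * indicator {0<..e} s \<partial>lborel)) \<partial>lborel) = ?w e * ?I e"
      by (rule nn_integral_cmult) measurable
  qed
  also have "\<dots> \<le> (\<integral>\<^sup>+e. ?w e * ?D e \<partial>lborel)"
    using ID by (intro nn_integral_mono) (auto simp: indicator_def intro!: mult_left_mono)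
  also have "\<dots> = ennreal (2 * sqrt pi) * ?A"
    by (rule nn_integral_weight_kinetic) measurable
  finally have "ennreal (sqrt pi / 4) * (ennreal (4 / sqrt pi) * ?B) \<le> ennreal (sqrt pi / 4) * (ennreal (2 * sqrt pi) * ?A)"
    by (intro mult_left_mono) auto
  then show ?thesis
    by (simp add: mult.assoc[symmetric] ennreal_mult[symmetric] field_simps)
qed

subsection \<open>Fractional regularity from difference quotients\<close>

text \<open>The kinetic energy is a positive superposition of the squared norms of translation
  differences, so a comparison for each shift \<open>h\<close> passes to it. This is how membership
  in \<open>H^(1/2)\<close> is proved without differentiating.\<close>

lemma kinetic_shift_comparison:
  assumes fg: "is_fourier f g" and FG: "is_fourier F G" and C: "C \<ge> 0"
    and le: "\<And>h. (\<integral>\<^sup>+x. ennreal ((cmod (F (x + h) - F x))\<^sup>2) \<partial>lborel) \<le> ennreal C * (\<integral>\<^sup>+x. ennreal ((cmod (f (x + h) - f x))\<^sup>2) \<partial>lborel)"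
  shows "(\<integral>\<^sup>+\<xi>. ennreal (norm \<xi> * (cmod (G \<xi>))\<^sup>2) \<partial>lborel) \<le> ennreal C * (\<integral>\<^sup>+\<xi>. ennreal (norm \<xi> * (cmod (g \<xi>))\<^sup>2) \<partial>lborel)"
proof -
  note [measurable] = L2_measurable[OF is_fourier_L2(1)[OF fg]] L2_measurable[OF is_fourier_L2(2)[OF fg]]
    L2_measurable[OF is_fourier_L2(1)[OF FG]] L2_measurable[OF is_fourier_L2(2)[OF FG]]
  let ?w = "\<lambda>e. ennreal (weight e) * indicator {0<..} e"
  let ?D = "\<lambda>g e. \<integral>\<^sup>+\<xi>. ennreal ((1 - exp (- e * (norm \<xi>)\<^sup>2)) * (cmod (g \<xi>))\<^sup>2) \<partial>lborel"
  note sub = nn_integral_weight_kinetic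
  have D: "?D G e \<le> ennreal C * ?D g e" if e: "e > 0" for e
  proof -
    have "shift_energy e F \<le> (\<integral>\<^sup>+h. ennreal C * (ennreal (heat e h) * (\<integral>\<^sup>+x. ennreal ((cmod (f (x + h) - f x))\<^sup>2) \<partial>lborel)) \<partial>lborel)"
      unfolding shift_energy_def
      by (intro nn_integral_mono) (subst mult.left_commute, intro mult_left_mono le zero_le)
    also have "\<dots> = ennreal C * shift_energy e f"
      unfolding shift_energy_def by (rule nn_integral_cmult) measurable
    finally have "2 * ?D G e \<le> 2 * (ennreal C * ?D g e)"
      unfolding shift_energy_symbol[OF fg e] shift_energy_symbol[OF FG e] by (simp only: mult.left_commute)
    then show ?thesis by (subst (asm) ennreal_mult_le_mult_iff) auto
  qed
  have "ennreal (2 * sqrt pi) * (\<integral>\<^sup>+\<xi>. ennreal (norm \<xi> * (cmod (G \<xi>))\<^sup>2) \<partial>lborel) = (\<integral>\<^sup>+e. ?w e * ?D G e \<partial>lborel)"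
    by (rule sub[symmetric]) measurable
  also have "\<dots> \<le> (\<integral>\<^sup>+e. ennreal C * (?w e * ?D g e) \<partial>lborel)"
    using D by (intro nn_integral_mono) (subst mult.left_commute, auto simp: indicator_def intro!: mult_left_mono)
  also have "\<dots> = ennreal C * (\<integral>\<^sup>+e. ?w e * ?D g e \<partial>lborel)"
    by (rule nn_integral_cmult) measurable
  also have "\<dots> = ennreal (2 * sqrt pi) * (ennreal C * (\<integral>\<^sup>+\<xi>. ennreal (norm \<xi> * (cmod (g \<xi>))\<^sup>2) \<partial>lborel))"
    by (subst sub) (auto simp: mult.left_commute)
  finally show ?thesis by (subst (asm) ennreal_mult_le_mult_iff) auto
qed

definition kin :: "fn3 \<Rightarrow> real" where
  "kin g = enn2real (\<integral>\<^sup>+\<xi>. ennreal (norm \<xi> * (cmod (g \<xi>))\<^sup>2) \<partial>lborel)"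

lemma kin_nonneg [simp]: "kin g \<ge> 0"
  by (simp add: kin_def)

lemma norm_le_symbol: "norm \<xi> \<le> (1 + (norm \<xi>)\<^sup>2) powr (1/2)"
proof -
  have "norm \<xi> = sqrt ((norm \<xi>)\<^sup>2)" by simp
  also have "\<dots> \<le> sqrt (1 + (norm \<xi>)\<^sup>2)" by (rule real_sqrt_le_mono) simp
  finally show ?thesis by (simp add: powr_half_sqrt add_nonneg_nonneg)
qed

text \<open>Finiteness is what makes \<open>enn2real\<close> in \<open>kin\<close> faithful.\<close>

lemma in_wL2_kin:
  assumes "in_wL2 (1/2) g"
  shows "(\<integral>\<^sup>+\<xi>. ennreal (norm \<xi> * (cmod (g \<xi>))\<^sup>2) \<partial>lborel) = ennreal (kin g)"
    and "kin g \<le> enn2real (wnorm2 (1/2) g)"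
proof -
  have *: "(\<integral>\<^sup>+\<xi>. ennreal (norm \<xi> * (cmod (g \<xi>))\<^sup>2) \<partial>lborel) \<le> wnorm2 (1/2) g"
    unfolding wnorm2_def by (intro nn_integral_mono ennreal_leI mult_right_mono norm_le_symbol) simp
  have fin: "wnorm2 (1/2) g < \<infinity>" using assms by (simp add: in_wL2_def)
  with * show "(\<integral>\<^sup>+\<xi>. ennreal (norm \<xi> * (cmod (g \<xi>))\<^sup>2) \<partial>lborel) = ennreal (kin g)"
    unfolding kin_def by (simp add: order_le_less_trans)
  show "kin g \<le> enn2real (wnorm2 (1/2) g)"
    unfolding kin_def using * fin by (intro enn2real_mono) auto
qed

subsection \<open>Yukawa potentials\<close>

definition pot :: "real \<Rightarrow> real \<Rightarrow> (real^3 \<Rightarrow> real) \<Rightarrow> real^3 \<Rightarrow> real" where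
  "pot lam mu s x = (LINT y|lborel. lam * exp (- mu * norm (x - y)) / norm (x - y) * s y)"

text \<open>Carries an explicit uniform bound for the Newton potential of \<open>|s|\<close>, as
  Kato's inequality provides it, because the later estimates track constants.\<close>

definition kato_class :: "real \<Rightarrow> (real^3 \<Rightarrow> real) \<Rightarrow> bool" where
  "kato_class B s \<longleftrightarrow> s \<in> borel_measurable borel \<and> integrable lborel s \<and>
    (\<forall>x. integrable lborel (\<lambda>y. \<bar>s y\<bar> / norm (x - y)) \<and> (LINT y|lborel. \<bar>s y\<bar> / norm (x - y)) \<le> B)"

lemma hartree_pot_eq: "hartree_pot lam mu u = pot lam mu (\<lambda>y. (cmod (u y))\<^sup>2)"
  by (simp add: hartree_pot_def[abs_def] pot_def[abs_def])

lemma pot_measurable [measurable]: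
  assumes [measurable]: "s \<in> borel_measurable borel"
  shows "pot lam mu s \<in> borel_measurable borel"
  unfolding pot_def[abs_def] by measurable

lemma kato_classD:
  assumes "kato_class B s"
  shows "s \<in> borel_measurable borel" "integrable lborel s" "integrable lborel (\<lambda>y. \<bar>s y\<bar> / norm (x - y))"
    "(LINT y|lborel. \<bar>s y\<bar> / norm (x - y)) \<le> B"
  using assms by (auto simp: kato_class_def)

lemma kato_class_nonneg: "kato_class B s \<Longrightarrow> B \<ge> 0"
  by (rule order_trans[OF _ kato_classD(4)]) auto

lemma kato_class_dominated:
  assumes t: "kato_class B t" and [measurable]: "s \<in> borel_measurable borel" and le: "\<And>y. \<bar>s y\<bar> \<le> t y"
  shows "kato_class B s"
  unfolding kato_class_def
proof (intro conjI allI)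
  note [measurable] = kato_classD(1)[OF t]
  have t0: "t y \<ge> 0" for y using le[of y] by linarith
  show "integrable lborel s"
    by (rule Bochner_Integration.integrable_bound[OF kato_classD(2)[OF t]]) (use le t0 in auto)
  fix x
  have b: "\<bar>s y\<bar> / norm (x - y) \<le> \<bar>t y\<bar> / norm (x - y)" for y
    using le[of y] by (intro divide_right_mono) auto
  show i: "integrable lborel (\<lambda>y. \<bar>s y\<bar> / norm (x - y))"
    by (rule Bochner_Integration.integrable_bound[OF kato_classD(3)[OF t, of x]]) (use b in auto)
  have "(LINT y|lborel. \<bar>s y\<bar> / norm (x - y)) \<le> (LINT y|lborel. \<bar>t y\<bar> / norm (x - y))"
    by (intro integral_mono i kato_classD(3)[OF t] b)
  then show "(LINT y|lborel. \<bar>s y\<bar> / norm (x - y)) \<le> B" using kato_classD(4)[OF t, of x] by linarith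
qed fact

lemma kato_class_add:
  assumes s: "kato_class B s" and t: "kato_class C t"
  shows "kato_class (B + C) (\<lambda>y. s y + t y)"
proof -
  note [measurable] = kato_classD(1)[OF s] kato_classD(1)[OF t]
  have "kato_class (B + C) (\<lambda>y. \<bar>s y\<bar> + \<bar>t y\<bar>)"
    unfolding kato_class_def
  proof (intro conjI allI)
    show "integrable lborel (\<lambda>y. \<bar>s y\<bar> + \<bar>t y\<bar>)"
      using kato_classD(2)[OF s] kato_classD(2)[OF t] by simp
    fix x
    have eq: "\<bar>\<bar>s y\<bar> + \<bar>t y\<bar>\<bar> / norm (x - y) = \<bar>s y\<bar> / norm (x - y) + \<bar>t y\<bar> / norm (x - y)" for y
      by (simp add: add_divide_distrib)
    show "integrable lborel (\<lambda>y. \<bar>\<bar>s y\<bar> + \<bar>t y\<bar>\<bar> / norm (x - y))"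
      unfolding eq by (intro Bochner_Integration.integrable_add kato_classD(3)[OF s] kato_classD(3)[OF t])
    show "(LINT y|lborel. \<bar>\<bar>s y\<bar> + \<bar>t y\<bar>\<bar> / norm (x - y)) \<le> B + C"
      unfolding eq Bochner_Integration.integral_add[OF kato_classD(3)[OF s] kato_classD(3)[OF t]]
      by (intro add_mono kato_classD(4)[OF s] kato_classD(4)[OF t])
  qed measurable
  then show ?thesis by (rule kato_class_dominated) auto
qed

lemma kato_class_cmult:
  assumes s: "kato_class B s"
  shows "kato_class (\<bar>c\<bar> * B) (\<lambda>y. c * s y)"
  unfolding kato_class_def
proof (intro conjI allI)
  note [measurable] = kato_classD(1)[OF s]
  show "(\<lambda>y. c * s y) \<in> borel_measurable borel" by measurable
  show "integrable lborel (\<lambda>y. c * s y)" using kato_classD(2)[OF s] by simp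
  fix x
  have eq: "\<bar>c * s y\<bar> / norm (x - y) = \<bar>c\<bar> * (\<bar>s y\<bar> / norm (x - y))" for y by (simp add: abs_mult)
  show "integrable lborel (\<lambda>y. \<bar>c * s y\<bar> / norm (x - y))"
    unfolding eq by (intro integrable_mult_right kato_classD(3)[OF s])
  show "(LINT y|lborel. \<bar>c * s y\<bar> / norm (x - y)) \<le> \<bar>c\<bar> * B"
    unfolding eq integral_mult_right_zero by (intro mult_left_mono kato_classD(4)[OF s]) simp
qed

lemma kato_class_translate:
  assumes s: "kato_class B s"
  shows "kato_class B (\<lambda>y. s (y + h))"
  unfolding kato_class_def
proof (intro conjI allI)
  note [measurable] = kato_classD(1)[OF s]
  show "(\<lambda>y. s (y + h)) \<in> borel_measurable borel" by measurable
  have tr: "integrable lborel (\<lambda>y. k (y + h)) \<and> (LINT y|lborel. k (y + h)) = (LINT y|lborel. k y)"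
    if "integrable lborel k" for k :: "real^3 \<Rightarrow> real"
  proof -
    have [measurable]: "k \<in> borel_measurable borel" using that by auto
    have "integrable (distr lborel borel ((+) h)) k" "(LINT y|distr lborel borel ((+) h). k y) = (LINT y|lborel. k y)"
      using that by (simp_all add: lborel_distr_plus)
    then show ?thesis by (simp add: integrable_distr_eq integral_distr add.commute)
  qed
  show "integrable lborel (\<lambda>y. s (y + h))" using tr[OF kato_classD(2)[OF s]] by simp
  fix x
  have eq: "\<bar>s (y + h)\<bar> / norm (x - y) = \<bar>s (y + h)\<bar> / norm ((x + h) - (y + h))" for y by simp
  show "integrable lborel (\<lambda>y. \<bar>s (y + h)\<bar> / norm (x - y))" "(LINT y|lborel. \<bar>s (y + h)\<bar> / norm (x - y)) \<le> B"
    unfolding eq using tr[OF kato_classD(3)[OF s, of "x + h"]] kato_classD(4)[OF s, of "x + h"] by simp_all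
qed

lemma yukawa_bound:
  assumes mu: "mu \<ge> 0"
  shows "\<bar>lam * exp (- mu * norm z) / norm z * r\<bar> \<le> \<bar>lam\<bar> * (\<bar>r\<bar> / norm z)"
proof -
  have "exp (- mu * norm z) \<le> 1" using mu by simp
  then have "\<bar>lam\<bar> * exp (- mu * norm z) * (\<bar>r\<bar> / norm z) \<le> \<bar>lam\<bar> * 1 * (\<bar>r\<bar> / norm z)"
    by (intro mult_right_mono mult_left_mono) auto
  then show ?thesis by (simp add: abs_mult)
qed

lemma pot_integrable:
  assumes s: "kato_class B s" and mu: "mu \<ge> 0"
  shows "integrable lborel (\<lambda>y. lam * exp (- mu * norm (x - y)) / norm (x - y) * s y)"
proof (rule Bochner_Integration.integrable_bound)
  note [measurable] = kato_classD(1)[OF s]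
  show "integrable lborel (\<lambda>y. \<bar>lam\<bar> * (\<bar>s y\<bar> / norm (x - y)))"
    by (intro integrable_mult_right kato_classD(3)[OF s])
  show "(\<lambda>y. lam * exp (- mu * norm (x - y)) / norm (x - y) * s y) \<in> borel_measurable lborel" by measurable
  show "AE y in lborel. norm (lam * exp (- mu * norm (x - y)) / norm (x - y) * s y) \<le> norm (\<bar>lam\<bar> * (\<bar>s y\<bar> / norm (x - y)))"
    using yukawa_bound[OF mu, of lam "x - _" "s _"] by (intro AE_I2) (simp add: abs_mult)
qed

lemma pot_abs_le:
  assumes s: "kato_class B s" and mu: "mu \<ge> 0"
  shows "\<bar>pot lam mu s x\<bar> \<le> \<bar>lam\<bar> * (LINT y|lborel. \<bar>s y\<bar> / norm (x - y))"
proof -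
  have "\<bar>pot lam mu s x\<bar> \<le> (LINT y|lborel. \<bar>lam * exp (- mu * norm (x - y)) / norm (x - y) * s y\<bar>)"
    unfolding pot_def using integral_norm_bound[of lborel "\<lambda>y. lam * exp (- mu * norm (x - y)) / norm (x - y) * s y"] by simp
  also have "\<dots> \<le> (LINT y|lborel. \<bar>lam\<bar> * (\<bar>s y\<bar> / norm (x - y)))"
    by (intro integral_mono integrable_abs pot_integrable[OF s mu] integrable_mult_right kato_classD(3)[OF s] yukawa_bound mu)
  finally show ?thesis by (simp only: integral_mult_right_zero)
qed

lemma pot_bound:
  assumes s: "kato_class B s" and mu: "mu \<ge> 0"
  shows "\<bar>pot lam mu s x\<bar> \<le> \<bar>lam\<bar> * B"
  using pot_abs_le[OF assms, of lam x] mult_left_mono[OF kato_classD(4)[OF s, of x], of "\<bar>lam\<bar>"] by simp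

lemma pot_add:
  assumes "kato_class B s" "kato_class C t" "mu \<ge> 0"
  shows "pot lam mu (\<lambda>y. s y + t y) x = pot lam mu s x + pot lam mu t x"
  unfolding pot_def by (simp only: distrib_left Bochner_Integration.integral_add[OF pot_integrable[OF assms(1,3)] pot_integrable[OF assms(2,3)]])

lemma pot_diff:
  assumes "kato_class B s" "kato_class C t" "mu \<ge> 0"
  shows "pot lam mu (\<lambda>y. s y - t y) x = pot lam mu s x - pot lam mu t x"
  unfolding pot_def by (simp only: right_diff_distrib Bochner_Integration.integral_diff[OF pot_integrable[OF assms(1,3)] pot_integrable[OF assms(2,3)]])

lemma pot_cmult: "pot lam mu (\<lambda>y. c * s y) x = c * pot lam mu s x"
  unfolding pot_def by (simp only: mult.left_commute[of _ c] integral_mult_right_zero)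

lemma pot_mult_integrable:
  assumes s: "kato_class B s" and t: "integrable lborel t" and mu: "mu \<ge> 0"
  shows "integrable lborel (\<lambda>x. pot lam mu s x * t x)"
proof (rule Bochner_Integration.integrable_bound)
  note [measurable] = kato_classD(1)[OF s] borel_measurable_integrable[OF t]
  show "integrable lborel (\<lambda>x. \<bar>lam\<bar> * B * t x)" by (intro integrable_mult_right t)
  show "(\<lambda>x. pot lam mu s x * t x) \<in> borel_measurable lborel" by measurable
  show "AE x in lborel. norm (pot lam mu s x * t x) \<le> norm (\<bar>lam\<bar> * B * t x)"
    using pot_bound[OF s mu, of lam] kato_class_nonneg[OF s]
    by (intro AE_I2) (simp add: abs_mult mult_right_mono)
qed

text \<open>The kernel is even, so this is Fubini; the bounded potential of one density against the
  integrable other density supplies absolute convergence.\<close>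

lemma pot_symmetric:
  assumes s: "kato_class B s" and t: "kato_class C t" and mu: "mu \<ge> 0"
  shows "(LINT x|lborel. pot lam mu s x * t x) = (LINT x|lborel. pot lam mu t x * s x)"
proof -
  note [measurable] = kato_classD(1)[OF s] kato_classD(1)[OF t]
  let ?V = "\<lambda>x y. lam * exp (- mu * norm (x - y)) / norm (x - y)"
  have "integrable (lborel \<Otimes>\<^sub>M lborel) (\<lambda>(x, y). ?V x y * s y * t x)"
  proof (rule lborel_pair.Fubini_integrable)
    show "(\<lambda>(x, y). ?V x y * s y * t x) \<in> borel_measurable (lborel \<Otimes>\<^sub>M lborel)"
      unfolding split_beta' by measurable
    show "AE x in lborel. integrable lborel (\<lambda>y. case (x, y) of (x, y) \<Rightarrow> ?V x y * s y * t x)"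
      unfolding prod.case by (intro AE_I2 integrable_mult_left pot_integrable[OF s mu])
    show "integrable lborel (\<lambda>x. LINT y|lborel. norm (case (x, y) of (x, y) \<Rightarrow> ?V x y * s y * t x))"
      unfolding prod.case
    proof (rule Bochner_Integration.integrable_bound)
      show "integrable lborel (\<lambda>x. \<bar>lam\<bar> * B * t x)" by (intro integrable_mult_right kato_classD(2)[OF t])
      show "(\<lambda>x. LINT y|lborel. norm (?V x y * s y * t x)) \<in> borel_measurable lborel" by measurable
      show "AE x in lborel. norm (LINT y|lborel. norm (?V x y * s y * t x)) \<le> norm (\<bar>lam\<bar> * B * t x)"
      proof (rule AE_I2)
        fix x
        have "norm (?V x y * s y * t x) = \<bar>?V x y * s y\<bar> * \<bar>t x\<bar>" for y
          by (simp only: real_norm_def abs_mult)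
        then have "(LINT y|lborel. norm (?V x y * s y * t x)) = (LINT y|lborel. \<bar>?V x y * s y\<bar>) * \<bar>t x\<bar>"
          by (simp only: Bochner_Integration.integral_mult_left_zero)
        also have "(LINT y|lborel. \<bar>?V x y * s y\<bar>) \<le> (LINT y|lborel. \<bar>lam\<bar> * (\<bar>s y\<bar> / norm (x - y)))"
          by (intro integral_mono integrable_abs pot_integrable[OF s mu] integrable_mult_right kato_classD(3)[OF s] yukawa_bound mu)
        also have "\<dots> \<le> \<bar>lam\<bar> * B"
          unfolding integral_mult_right_zero by (intro mult_left_mono kato_classD(4)[OF s]) simp
        finally have *: "(LINT y|lborel. norm (?V x y * s y * t x)) \<le> \<bar>lam\<bar> * B * \<bar>t x\<bar>" by (simp add: mult_right_mono)
        have "norm (LINT y|lborel. norm (?V x y * s y * t x)) = (LINT y|lborel. norm (?V x y * s y * t x))"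
          by (simp only: real_norm_def) (intro abs_of_nonneg Bochner_Integration.integral_nonneg abs_ge_zero)
        then show "norm (LINT y|lborel. norm (?V x y * s y * t x)) \<le> norm (\<bar>lam\<bar> * B * t x)"
          using * kato_class_nonneg[OF s] by (simp only: real_norm_def abs_mult abs_abs abs_of_nonneg)
      qed
    qed
  qed
  from lborel_pair.Fubini_integral[OF this]
  have "(LINT y|lborel. LINT x|lborel. ?V x y * s y * t x) = (LINT x|lborel. LINT y|lborel. ?V x y * s y * t x)" .
  moreover have "(LINT y|lborel. ?V x y * s y * t x) = pot lam mu s x * t x" for x
    unfolding pot_def by (simp only: Bochner_Integration.integral_mult_left_zero)
  moreover have "(LINT x|lborel. ?V x y * s y * t x) = pot lam mu t y * s y" for y
  proof -
    have "(LINT x|lborel. ?V x y * s y * t x) = (LINT x|lborel. (lam * exp (- mu * norm (y - x)) / norm (y - x) * t x) * s y)"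
      by (intro Bochner_Integration.integral_cong) (simp_all add: norm_minus_commute mult_ac)
    then show ?thesis unfolding pot_def by (simp only: Bochner_Integration.integral_mult_left_zero)
  qed
  ultimately show ?thesis by simp
qed

theorem kato:
  assumes fg: "is_fourier f g" and g: "in_wL2 (1/2) g"
  shows "kato_class (pi / 2 * kin g) (\<lambda>y. (cmod (f y))\<^sup>2)"
  unfolding kato_class_def
proof (intro conjI allI)
  note L = is_fourier_L2[OF fg]
  note [measurable] = L2_measurable[OF L(1)]
  show "(\<lambda>y. (cmod (f y))\<^sup>2) \<in> borel_measurable borel" by measurable
  show "integrable lborel (\<lambda>y. (cmod (f y))\<^sup>2)" by (rule L2_integrable[OF L(1)])
  fix x
  have "(\<integral>\<^sup>+y. ennreal (\<bar>(cmod (f y))\<^sup>2\<bar> / norm (x - y)) \<partial>lborel) \<le> ennreal (pi / 2) * ennreal (kin g)"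
    using kato_nn[OF fg, of x] unfolding in_wL2_kin(1)[OF g] by (simp add: norm_minus_commute)
  also have "\<dots> = ennreal (pi / 2 * kin g)" by (rule ennreal_mult[symmetric]) auto
  finally have le: "(\<integral>\<^sup>+y. ennreal (\<bar>(cmod (f y))\<^sup>2\<bar> / norm (x - y)) \<partial>lborel) \<le> ennreal (pi / 2 * kin g)" .
  then show i: "integrable lborel (\<lambda>y. \<bar>(cmod (f y))\<^sup>2\<bar> / norm (x - y))"
    by (intro integrableI_nonneg) (auto simp: order_le_less_trans)
  have "ennreal (LINT y|lborel. \<bar>(cmod (f y))\<^sup>2\<bar> / norm (x - y)) \<le> ennreal (pi / 2 * kin g)"
    using le by (subst nn_integral_eq_integral[symmetric, OF i]) auto
  then show "(LINT y|lborel. \<bar>(cmod (f y))\<^sup>2\<bar> / norm (x - y)) \<le> pi / 2 * kin g"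
    by (subst (asm) ennreal_le_iff) auto
qed

subsection \<open>The nonlinearity preserves the energy space\<close>

lemma integral_lborel_translate:
  fixes k :: "'a::euclidean_space \<Rightarrow> 'b::{banach, second_countable_topology}"
  assumes [measurable]: "k \<in> borel_measurable borel"
  shows "(LINT y|lborel. k (y + h)) = (LINT y|lborel. k y)"
proof -
  have "(LINT y|lborel. k y) = (LINT y|distr lborel borel ((+) h). k y)"
    by (simp add: lborel_distr_plus)
  then show ?thesis by (simp add: integral_distr add.commute)
qed

text \<open>Moving the difference quotient onto the density and applying Kato's inequality twice avoids any
  estimate on derivatives of the potential.\<close>
lemma nonlin_shift_bound:
  assumes fg: "is_fourier f g" and g: "in_wL2 (1/2) g" and mu: "mu \<ge> 0"
  shows "(\<integral>\<^sup>+x. ennreal ((cmod (nonlin lam mu f (x + h) - nonlin lam mu f x))\<^sup>2) \<partial>lborel)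
    \<le> ennreal (5/2 * pi\<^sup>2 * lam\<^sup>2 * (kin g)\<^sup>2) * (\<integral>\<^sup>+x. ennreal ((cmod (f (x + h) - f x))\<^sup>2) \<partial>lborel)"
proof -
  note L = is_fourier_L2[OF fg]
  note [measurable] = L2_measurable[OF L(1)]
  define A where "A = kin g"
  define \<rho> where "\<rho> y = (cmod (f y))\<^sup>2" for y
  define d where "d y = f (y + h) - f y" for y
  define \<sigma> where "\<sigma> y = (cmod (d y))\<^sup>2" for y
  define \<phi> where "\<phi> = hartree_pot lam mu f"
  have [measurable]: "\<rho> \<in> borel_measurable borel" "d \<in> borel_measurable borel" "\<sigma> \<in> borel_measurable borel"
    unfolding \<rho>_def[abs_def] d_def[abs_def] \<sigma>_def[abs_def] by measurable
  have A0: "A \<ge> 0" by (simp add: A_def)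
  have K: "kato_class (pi / 2 * A) \<rho>" unfolding \<rho>_def A_def by (rule kato[OF fg g])
  note Kh = kato_class_translate[OF K, of h]
  have phi: "\<phi> = pot lam mu \<rho>" by (simp add: \<phi>_def hartree_pot_eq \<rho>_def[abs_def])
  have [measurable]: "\<phi> \<in> borel_measurable borel" unfolding phi by measurable
  have phi_b: "(\<phi> x)\<^sup>2 \<le> (\<bar>lam\<bar> * (pi / 2 * A))\<^sup>2" for x
    using pot_bound[OF K mu, of lam x] unfolding phi by (metis abs_ge_zero power2_abs power_mono)
  \<comment> \<open>\<open>2 * pi * A\<close> is 4 times Kato's \<open>pi / 2 * A\<close>: two
    densities, each with the factor 2 from squaring a sum.\<close>
  have K2: "kato_class (2 * pi * A) (\<lambda>y. (cmod (f (y + h)) + cmod (f y))\<^sup>2)"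
  proof (rule kato_class_dominated)
    show "kato_class (2 * pi * A) (\<lambda>y. 2 * \<rho> (y + h) + 2 * \<rho> y)"
      using kato_class_add[OF kato_class_cmult[OF Kh, of 2] kato_class_cmult[OF K, of 2]] by (simp add: field_simps)
    fix y
    show "\<bar>(cmod (f (y + h)) + cmod (f y))\<^sup>2\<bar> \<le> 2 * \<rho> (y + h) + 2 * \<rho> y"
      using sum_squares_bound[of "cmod (f (y + h))" "cmod (f y)"] by (simp add: \<rho>_def power2_sum)
  qed measurable
  have Ks: "kato_class (2 * pi * A) \<sigma>"
  proof (rule kato_class_dominated[OF K2])
    fix y
    have "(cmod (d y))\<^sup>2 \<le> (cmod (f (y + h)) + cmod (f y))\<^sup>2"
      unfolding d_def by (intro power_mono norm_triangle_ineq4) simp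
    then show "\<bar>\<sigma> y\<bar> \<le> (cmod (f (y + h)) + cmod (f y))\<^sup>2" by (simp add: \<sigma>_def)
  qed measurable
  \<comment> \<open>The density difference is at most \<open>|d|\<close> times
    \<open>|f (y + h)| + |f y|\<close>. Cauchy-Schwarz with respect to \<open>1 / |x - y|\<close>
    separates the factors, and Kato bounds the second one uniformly in \<open>x\<close>.\<close>
  have dphi: "(\<phi> (x + h) - \<phi> x)\<^sup>2 \<le> lam\<^sup>2 * (2 * pi * A) * (LINT y|lborel. \<sigma> y / norm (x - y))" for x
  proof -
    let ?V = "\<lambda>y. lam * exp (- mu * norm (x - y)) / norm (x - y)"
    have "\<phi> (x + h) = (LINT y|lborel. (\<lambda>y. lam * exp (- mu * norm (x + h - y)) / norm (x + h - y) * \<rho> y) (y + h))"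
      unfolding phi pot_def by (rule integral_lborel_translate[symmetric]) measurable
    then have sh: "\<phi> (x + h) = pot lam mu (\<lambda>y. \<rho> (y + h)) x" unfolding pot_def by simp
    have "\<phi> (x + h) - \<phi> x = pot lam mu (\<lambda>y. \<rho> (y + h) - \<rho> y) x"
      unfolding sh unfolding phi by (rule pot_diff[OF Kh K mu, symmetric])
    also have "\<bar>\<dots>\<bar> \<le> \<bar>lam\<bar> * (LINT y|lborel. \<bar>\<rho> (y + h) - \<rho> y\<bar> / norm (x - y))"
      using pot_abs_le[OF kato_class_add[OF Kh kato_class_cmult[OF K, of "-1"]] mu, of lam x] by simp
    also have "\<dots> \<le> \<bar>lam\<bar> * (LINT y|lborel. (cmod (d y) / sqrt (norm (x - y))) * ((cmod (f (y + h)) + cmod (f y)) / sqrt (norm (x - y))))"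
    proof (intro mult_left_mono integral_mono)
      have a: "(cmod (d y) / sqrt (norm (x - y)))\<^sup>2 = \<bar>\<sigma> y\<bar> / norm (x - y)" for y by (simp add: power_divide \<sigma>_def)
      have b: "((cmod (f (y + h)) + cmod (f y)) / sqrt (norm (x - y)))\<^sup>2 = \<bar>(cmod (f (y + h)) + cmod (f y))\<^sup>2\<bar> / norm (x - y)" for y
        by (simp add: power_divide)
      show "integrable lborel (\<lambda>y. (cmod (d y) / sqrt (norm (x - y))) * ((cmod (f (y + h)) + cmod (f y)) / sqrt (norm (x - y))))"
        by (rule cauchy_schwarz_integral(1)) (use kato_classD(3)[OF Ks, of x] kato_classD(3)[OF K2, of x] in \<open>simp_all add: a b\<close>)
      show "integrable lborel (\<lambda>y. \<bar>\<rho> (y + h) - \<rho> y\<bar> / norm (x - y))"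
        using kato_classD(3)[OF kato_class_add[OF Kh kato_class_cmult[OF K, of "-1"]], of x] by simp
      fix y
      have "\<bar>\<rho> (y + h) - \<rho> y\<bar> = \<bar>cmod (f (y + h)) - cmod (f y)\<bar> * (cmod (f (y + h)) + cmod (f y))"
      proof -
        have "\<rho> (y + h) - \<rho> y = (cmod (f (y + h)) - cmod (f y)) * (cmod (f (y + h)) + cmod (f y))"
          by (simp add: \<rho>_def power2_eq_square algebra_simps)
        then show ?thesis by (simp add: abs_mult)
      qed
      also have "\<dots> \<le> cmod (d y) * (cmod (f (y + h)) + cmod (f y))"
        unfolding d_def by (intro mult_right_mono norm_triangle_ineq3) simp
      finally have "\<bar>\<rho> (y + h) - \<rho> y\<bar> / norm (x - y) \<le> cmod (d y) * (cmod (f (y + h)) + cmod (f y)) / norm (x - y)"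
        by (rule divide_right_mono) simp
      also have "\<dots> = (cmod (d y) / sqrt (norm (x - y))) * ((cmod (f (y + h)) + cmod (f y)) / sqrt (norm (x - y)))"
        by simp
      finally show "\<bar>\<rho> (y + h) - \<rho> y\<bar> / norm (x - y) \<le> (cmod (d y) / sqrt (norm (x - y))) * ((cmod (f (y + h)) + cmod (f y)) / sqrt (norm (x - y)))" .
    qed simp
    finally have 1: "\<bar>\<phi> (x + h) - \<phi> x\<bar> \<le> \<bar>lam\<bar> * (LINT y|lborel. (cmod (d y) / sqrt (norm (x - y))) * ((cmod (f (y + h)) + cmod (f y)) / sqrt (norm (x - y))))"
      (is "_ \<le> _ * ?I") .
    have a: "(cmod (d y) / sqrt (norm (x - y)))\<^sup>2 = \<bar>\<sigma> y\<bar> / norm (x - y)" for y by (simp add: power_divide \<sigma>_def)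
    have b: "((cmod (f (y + h)) + cmod (f y)) / sqrt (norm (x - y)))\<^sup>2 = \<bar>(cmod (f (y + h)) + cmod (f y))\<^sup>2\<bar> / norm (x - y)" for y
      by (simp add: power_divide)
    have cs: "?I\<^sup>2 \<le> (LINT y|lborel. (cmod (d y) / sqrt (norm (x - y)))\<^sup>2) * (LINT y|lborel. ((cmod (f (y + h)) + cmod (f y)) / sqrt (norm (x - y)))\<^sup>2)"
      by (rule cauchy_schwarz_integral(2)) (use kato_classD(3)[OF Ks, of x] kato_classD(3)[OF K2, of x] in \<open>simp_all only: a b, simp_all\<close>)
    have "(\<phi> (x + h) - \<phi> x)\<^sup>2 \<le> (\<bar>lam\<bar> * ?I)\<^sup>2"
      using power_mono[OF 1 abs_ge_zero, of 2] by simp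
    also have "\<dots> = lam\<^sup>2 * ?I\<^sup>2" by (simp add: power_mult_distrib)
    also have "\<dots> \<le> lam\<^sup>2 * ((LINT y|lborel. \<bar>\<sigma> y\<bar> / norm (x - y)) * (LINT y|lborel. \<bar>(cmod (f (y + h)) + cmod (f y))\<^sup>2\<bar> / norm (x - y)))"
      using cs unfolding a b by (intro mult_left_mono) auto
    also have "\<dots> \<le> lam\<^sup>2 * ((LINT y|lborel. \<bar>\<sigma> y\<bar> / norm (x - y)) * (2 * pi * A))"
      by (intro mult_left_mono kato_classD(4)[OF K2]) auto
    finally show ?thesis by (simp add: \<sigma>_def mult_ac)
  qed
  have s_nn: "ennreal (LINT y|lborel. \<sigma> y / norm (x - y)) = (\<integral>\<^sup>+y. ennreal (\<sigma> y) * ennreal (1 / norm (x - y)) \<partial>lborel)" for x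
  proof -
    have i: "integrable lborel (\<lambda>y. \<sigma> y / norm (x - y))" using kato_classD(3)[OF Ks, of x] by (simp add: \<sigma>_def)
    show ?thesis by (subst nn_integral_eq_integral[symmetric, OF i]) (auto simp: \<sigma>_def ennreal_mult[symmetric])
  qed
  have r_nn: "(\<integral>\<^sup>+x. ennreal (\<rho> x) * ennreal (1 / norm (x - y)) \<partial>lborel) \<le> ennreal (pi / 2 * A)" for y
  proof -
    have i: "integrable lborel (\<lambda>x. \<rho> x / norm (y - x))" using kato_classD(3)[OF K, of y] by (simp add: \<rho>_def)
    have "(\<integral>\<^sup>+x. ennreal (\<rho> x) * ennreal (1 / norm (x - y)) \<partial>lborel) = (\<integral>\<^sup>+x. ennreal (\<rho> x / norm (y - x)) \<partial>lborel)"
      by (intro nn_integral_cong) (auto simp: \<rho>_def ennreal_mult[symmetric] norm_minus_commute)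
    also have "\<dots> = ennreal (LINT x|lborel. \<rho> x / norm (y - x))"
      by (rule nn_integral_eq_integral[OF i]) (auto simp: \<rho>_def)
    also have "\<dots> \<le> ennreal (pi / 2 * A)" using kato_classD(4)[OF K, of y] by (intro ennreal_leI) (simp add: \<rho>_def)
    finally show ?thesis .
  qed
  \<comment> \<open>Discrete product rule: the bounded potential times the difference of
    \<open>f\<close>, plus the difference of the potential times \<open>f\<close>.\<close>
  have pw: "ennreal ((cmod (nonlin lam mu f (x + h) - nonlin lam mu f x))\<^sup>2)
    \<le> ennreal (2 * (\<bar>lam\<bar> * (pi / 2 * A))\<^sup>2) * ennreal (\<sigma> x) + ennreal (2 * (lam\<^sup>2 * (2 * pi * A))) * (\<integral>\<^sup>+y. ennreal (\<sigma> y) * (ennreal (\<rho> x) * ennreal (1 / norm (x - y))) \<partial>lborel)" for x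
  proof -
    have "nonlin lam mu f (x + h) - nonlin lam mu f x = complex_of_real (\<phi> (x + h)) * d x + complex_of_real (\<phi> (x + h) - \<phi> x) * f x"
      by (simp add: nonlin_def \<phi>_def d_def algebra_simps)
    then have "(cmod (nonlin lam mu f (x + h) - nonlin lam mu f x))\<^sup>2 \<le> 2 * ((\<phi> (x + h))\<^sup>2 * \<sigma> x) + 2 * ((\<phi> (x + h) - \<phi> x)\<^sup>2 * \<rho> x)"
      using cmod_add_sq_le[of "complex_of_real (\<phi> (x + h)) * d x" "complex_of_real (\<phi> (x + h) - \<phi> x) * f x"]
      by (simp add: norm_mult power_mult_distrib \<sigma>_def \<rho>_def del: of_real_diff)
    also have "\<dots> \<le> 2 * ((\<bar>lam\<bar> * (pi / 2 * A))\<^sup>2 * \<sigma> x) + 2 * (lam\<^sup>2 * (2 * pi * A) * (LINT y|lborel. \<sigma> y / norm (x - y)) * \<rho> x)"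
      by (intro add_mono mult_left_mono mult_right_mono phi_b dphi) (auto simp: \<sigma>_def \<rho>_def)
    finally have le: "(cmod (nonlin lam mu f (x + h) - nonlin lam mu f x))\<^sup>2 \<le> 2 * ((\<bar>lam\<bar> * (pi / 2 * A))\<^sup>2 * \<sigma> x) + 2 * (lam\<^sup>2 * (2 * pi * A) * (LINT y|lborel. \<sigma> y / norm (x - y)) * \<rho> x)" .
    have I0: "(LINT y|lborel. \<sigma> y / norm (x - y)) \<ge> 0" by (intro Bochner_Integration.integral_nonneg) (simp add: \<sigma>_def)
    have "ennreal ((cmod (nonlin lam mu f (x + h) - nonlin lam mu f x))\<^sup>2) \<le> ennreal (2 * (\<bar>lam\<bar> * (pi / 2 * A))\<^sup>2) * ennreal (\<sigma> x) + ennreal (2 * (lam\<^sup>2 * (2 * pi * A))) * (ennreal (\<rho> x) * ennreal (LINT y|lborel. \<sigma> y / norm (x - y)))"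
      using ennreal_leI[OF le] I0 A0 by (simp add: ennreal_mult[symmetric] \<sigma>_def \<rho>_def mult_ac flip: ennreal_plus)
    also have "ennreal (\<rho> x) * ennreal (LINT y|lborel. \<sigma> y / norm (x - y)) = (\<integral>\<^sup>+y. ennreal (\<sigma> y) * (ennreal (\<rho> x) * ennreal (1 / norm (x - y))) \<partial>lborel)"
      unfolding s_nn by (subst nn_integral_cmult[symmetric], measurable) (simp only: mult_ac)
    finally show ?thesis .
  qed
  have "(\<integral>\<^sup>+x. ennreal ((cmod (nonlin lam mu f (x + h) - nonlin lam mu f x))\<^sup>2) \<partial>lborel) \<le>
    (\<integral>\<^sup>+x. ennreal (2 * (\<bar>lam\<bar> * (pi / 2 * A))\<^sup>2) * ennreal (\<sigma> x) + ennreal (2 * (lam\<^sup>2 * (2 * pi * A))) * (\<integral>\<^sup>+y. ennreal (\<sigma> y) * (ennreal (\<rho> x) * ennreal (1 / norm (x - y))) \<partial>lborel) \<partial>lborel)"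
    by (intro nn_integral_mono pw)
  also have "\<dots> = ennreal (2 * (\<bar>lam\<bar> * (pi / 2 * A))\<^sup>2) * (\<integral>\<^sup>+x. ennreal (\<sigma> x) \<partial>lborel)
     + ennreal (2 * (lam\<^sup>2 * (2 * pi * A))) * (\<integral>\<^sup>+x. \<integral>\<^sup>+y. ennreal (\<sigma> y) * (ennreal (\<rho> x) * ennreal (1 / norm (x - y))) \<partial>lborel \<partial>lborel)"
    by (subst nn_integral_add, measurable) (subst nn_integral_cmult, measurable)+
  \<comment> \<open>Exchanging the integrals moves the kernel onto \<open>\<rho>\<close>, where
    Kato's bound applies a second time and leaves only the integral of
    \<open>\<sigma>\<close>.\<close>
  also have "(\<integral>\<^sup>+x. \<integral>\<^sup>+y. ennreal (\<sigma> y) * (ennreal (\<rho> x) * ennreal (1 / norm (x - y))) \<partial>lborel \<partial>lborel)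
     = (\<integral>\<^sup>+y. \<integral>\<^sup>+x. ennreal (\<sigma> y) * (ennreal (\<rho> x) * ennreal (1 / norm (x - y))) \<partial>lborel \<partial>lborel)"
    by (rule lborel_pair.Fubini') measurable
  also have "\<dots> = (\<integral>\<^sup>+y. ennreal (\<sigma> y) * (\<integral>\<^sup>+x. ennreal (\<rho> x) * ennreal (1 / norm (x - y)) \<partial>lborel) \<partial>lborel)"
    by (intro nn_integral_cong nn_integral_cmult) measurable
  also have "\<dots> \<le> (\<integral>\<^sup>+y. ennreal (\<sigma> y) * ennreal (pi / 2 * A) \<partial>lborel)"
    by (intro nn_integral_mono mult_left_mono r_nn) simp
  also have "\<dots> = (\<integral>\<^sup>+y. ennreal (\<sigma> y) \<partial>lborel) * ennreal (pi / 2 * A)"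
    by (rule nn_integral_multc) measurable
  finally have "(\<integral>\<^sup>+x. ennreal ((cmod (nonlin lam mu f (x + h) - nonlin lam mu f x))\<^sup>2) \<partial>lborel)
     \<le> ennreal (2 * (\<bar>lam\<bar> * (pi / 2 * A))\<^sup>2) * (\<integral>\<^sup>+x. ennreal (\<sigma> x) \<partial>lborel)
       + ennreal (2 * (lam\<^sup>2 * (2 * pi * A))) * ((\<integral>\<^sup>+y. ennreal (\<sigma> y) \<partial>lborel) * ennreal (pi / 2 * A))"
    by (simp add: add_left_mono mult_left_mono)
  also have "\<dots> = (ennreal (2 * (\<bar>lam\<bar> * (pi / 2 * A))\<^sup>2) + ennreal (2 * (lam\<^sup>2 * (2 * pi * A))) * ennreal (pi / 2 * A)) * (\<integral>\<^sup>+x. ennreal (\<sigma> x) \<partial>lborel)"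
  proof -
    have "a * S + b * (S * c) = (a + b * c) * S" for a b c S :: ennreal by (simp add: distrib_left mult_ac)
    then show ?thesis .
  qed
  \<comment> \<open>\<open>5/2\<close> collects \<open>2 * (pi/2)^2 = pi^2 / 2\<close> from the
    first term and \<open>2 * (2 * pi) * (pi/2) = 2 * pi^2\<close> from the second.\<close>
  also have "ennreal (2 * (\<bar>lam\<bar> * (pi / 2 * A))\<^sup>2) + ennreal (2 * (lam\<^sup>2 * (2 * pi * A))) * ennreal (pi / 2 * A) = ennreal (5/2 * pi\<^sup>2 * lam\<^sup>2 * A\<^sup>2)"
  proof -
    have "ennreal (2 * (\<bar>lam\<bar> * (pi / 2 * A))\<^sup>2) + ennreal (2 * (lam\<^sup>2 * (2 * pi * A))) * ennreal (pi / 2 * A)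
       = ennreal (2 * (\<bar>lam\<bar> * (pi / 2 * A))\<^sup>2 + 2 * (lam\<^sup>2 * (2 * pi * A)) * (pi / 2 * A))"
      using A0 by (subst ennreal_mult[symmetric]) (simp_all flip: ennreal_plus)
    also have "2 * (\<bar>lam\<bar> * (pi / 2 * A))\<^sup>2 + 2 * (lam\<^sup>2 * (2 * pi * A)) * (pi / 2 * A) = 5/2 * pi\<^sup>2 * lam\<^sup>2 * A\<^sup>2"
      by (simp add: power_mult_distrib power_divide power2_eq_square)
    finally show ?thesis .
  qed
  finally show ?thesis unfolding \<sigma>_def d_def A_def .
qed

lemma kin_nonlin:
  assumes fg: "is_fourier f g" and g: "in_wL2 (1/2) g" and mu: "mu \<ge> 0"
    and FG: "is_fourier (nonlin lam mu f) G"
  shows "(\<integral>\<^sup>+\<xi>. ennreal (norm \<xi> * (cmod (G \<xi>))\<^sup>2) \<partial>lborel) \<le> ennreal (5/2 * pi\<^sup>2 * lam\<^sup>2 * (kin g)^3)"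
proof -
  have "(\<integral>\<^sup>+\<xi>. ennreal (norm \<xi> * (cmod (G \<xi>))\<^sup>2) \<partial>lborel) \<le> ennreal (5/2 * pi\<^sup>2 * lam\<^sup>2 * (kin g)\<^sup>2) * (\<integral>\<^sup>+\<xi>. ennreal (norm \<xi> * (cmod (g \<xi>))\<^sup>2) \<partial>lborel)"
    by (rule kinetic_shift_comparison[OF fg FG _ nonlin_shift_bound[OF fg g mu]]) simp
  also have "\<dots> = ennreal ((5/2 * pi\<^sup>2 * lam\<^sup>2 * (kin g)\<^sup>2) * kin g)"
    unfolding in_wL2_kin(1)[OF g] by (rule ennreal_mult[symmetric]) simp_all
  also have "(5/2 * pi\<^sup>2 * lam\<^sup>2 * (kin g)\<^sup>2) * kin g = 5/2 * pi\<^sup>2 * lam\<^sup>2 * (kin g)^3"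
    by (simp add: power2_eq_square power3_eq_cube)
  finally show ?thesis .
qed

lemma L2norm2_nonlin:
  assumes fg: "is_fourier f g" and g: "in_wL2 (1/2) g" and mu: "mu \<ge> 0"
  shows "L2norm2 (nonlin lam mu f) \<le> (\<bar>lam\<bar> * (pi / 2 * kin g))\<^sup>2 * L2norm2 f" "L2 (nonlin lam mu f)"
proof -
  note L = is_fourier_L2[OF fg]
  note [measurable] = L2_measurable[OF L(1)]
  note K = kato[OF fg g]
  have b: "cmod (nonlin lam mu f x) \<le> \<bar>lam\<bar> * (pi / 2 * kin g) * cmod (f x)" for x
    unfolding nonlin_def norm_mult hartree_pot_eq using pot_bound[OF K mu, of lam x] by (intro mult_right_mono) auto
  have [measurable]: "hartree_pot lam mu f \<in> borel_measurable borel" unfolding hartree_pot_eq by measurable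
  have m: "nonlin lam mu f \<in> borel_measurable borel" unfolding nonlin_def[abs_def] by measurable
  show l: "L2 (nonlin lam mu f)" by (rule L2_bound[OF L(1) m b])
  have "L2norm2 (nonlin lam mu f) \<le> (LINT x|lborel. (\<bar>lam\<bar> * (pi / 2 * kin g))\<^sup>2 * (cmod (f x))\<^sup>2)"
    unfolding L2norm2_eq[OF m]
  proof (intro integral_mono L2_integrable[OF l] integrable_mult_right L2_integrable[OF L(1)])
    show "(cmod (nonlin lam mu f x))\<^sup>2 \<le> (\<bar>lam\<bar> * (pi / 2 * kin g))\<^sup>2 * (cmod (f x))\<^sup>2" for x
      unfolding power_mult_distrib[symmetric] by (rule power_mono[OF b norm_ge_zero])
  qed
  then show "L2norm2 (nonlin lam mu f) \<le> (\<bar>lam\<bar> * (pi / 2 * kin g))\<^sup>2 * L2norm2 f"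
    by (simp add: L2norm2_eq)
qed

subsection \<open>The Sobolev scale as weighted square-integrable functions\<close>

text \<open>The fourth root, since the weight \<open>(1 + |xi|^2)^(1/2)\<close> of
  \<open>wnorm2 (1/2)\<close> multiplies squares. With it \<open>up\<close> and \<open>dn\<close>
  map \<open>H^(1/2)\<close> and \<open>H^(-1/2)\<close> isometrically to \<open>L2\<close>, which
  reduces the Sobolev scale to statements about \<open>L2\<close> and \<open>ip\<close>.\<close>

definition wt :: "real^3 \<Rightarrow> real" where
  "wt \<xi> = (1 + (norm \<xi>)\<^sup>2) powr (1/4)"

definition up :: "fn3 \<Rightarrow> fn3" where
  "up g = (\<lambda>\<xi>. complex_of_real (wt \<xi>) * g \<xi>)"

definition dn :: "fn3 \<Rightarrow> fn3" where
  "dn g = (\<lambda>\<xi>. complex_of_real (inverse (wt \<xi>)) * g \<xi>)"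

lemma wt_ge_1: "wt \<xi> \<ge> 1"
  unfolding wt_def by (rule ge_one_powr_ge_zero) auto

lemma wt_pos [simp]: "wt \<xi> > 0"
  using wt_ge_1[of \<xi>] by linarith

lemma wt_neq_0 [simp]: "wt \<xi> \<noteq> 0"
  using wt_pos[of \<xi>] by linarith

lemma wt_measurable [measurable]: "wt \<in> borel_measurable borel"
  unfolding wt_def[abs_def] by measurable

lemma one_plus_sq_pos: "1 + (norm \<xi>)\<^sup>2 > 0"
  by (simp add: add_pos_nonneg)

lemma wt_sq: "(wt \<xi>)\<^sup>2 = (1 + (norm \<xi>)\<^sup>2) powr (1/2)" "(wt \<xi>)\<^sup>2 = sqrt (1 + (norm \<xi>)\<^sup>2)"
proof -
  show "(wt \<xi>)\<^sup>2 = (1 + (norm \<xi>)\<^sup>2) powr (1/2)"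
    unfolding wt_def power2_eq_square powr_add[symmetric] by simp
  then show "(wt \<xi>)\<^sup>2 = sqrt (1 + (norm \<xi>)\<^sup>2)" using one_plus_sq_pos[of \<xi>] by (simp add: powr_half_sqrt)
qed

lemma wt_sq_inverse: "(inverse (wt \<xi>))\<^sup>2 = (1 + (norm \<xi>)\<^sup>2) powr (-1/2)"
  unfolding power_inverse wt_sq(1) by (simp add: powr_minus)

lemma up_measurable [measurable]: "g \<in> borel_measurable borel \<Longrightarrow> up g \<in> borel_measurable borel"
  unfolding up_def by measurable

lemma dn_measurable [measurable]: "g \<in> borel_measurable borel \<Longrightarrow> dn g \<in> borel_measurable borel"
  unfolding dn_def by measurable

lemma up_add: "up (\<lambda>\<xi>. a \<xi> + b \<xi>) = (\<lambda>\<xi>. up a \<xi> + up b \<xi>)"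
  by (simp add: up_def distrib_left)

lemma up_diff: "up (\<lambda>\<xi>. a \<xi> - b \<xi>) = (\<lambda>\<xi>. up a \<xi> - up b \<xi>)"
  by (simp add: up_def right_diff_distrib)

lemma dn_diff: "dn (\<lambda>\<xi>. a \<xi> - b \<xi>) = (\<lambda>\<xi>. dn a \<xi> - dn b \<xi>)"
  by (simp add: dn_def right_diff_distrib)

lemma wnorm2_half: "wnorm2 (1/2) g = (\<integral>\<^sup>+\<xi>. ennreal ((cmod (up g \<xi>))\<^sup>2) \<partial>lborel)"
  unfolding wnorm2_def up_def by (simp add: norm_mult power_mult_distrib wt_sq(1))

lemma wnorm2_minus_half: "wnorm2 (-1/2) g = (\<integral>\<^sup>+\<xi>. ennreal ((cmod (dn g \<xi>))\<^sup>2) \<partial>lborel)"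
  unfolding wnorm2_def dn_def norm_mult power_mult_distrib norm_of_real power2_abs wt_sq_inverse ..

lemma in_wL2_half_iff: "in_wL2 (1/2) g \<longleftrightarrow> g \<in> borel_measurable borel \<and> L2 (up g)"
  unfolding in_wL2_def L2_def wnorm2_half by auto

lemma in_wL2_minus_half_iff: "in_wL2 (-1/2) g \<longleftrightarrow> g \<in> borel_measurable borel \<and> L2 (dn g)"
  unfolding in_wL2_def L2_def wnorm2_minus_half by auto

lemma wnorm2_half_L2: "L2 (up g) \<Longrightarrow> wnorm2 (1/2) g = ennreal (L2norm2 (up g))"
  by (simp add: wnorm2_half nn_integral_L2)

lemma wnorm2_minus_half_L2: "L2 (dn g) \<Longrightarrow> wnorm2 (-1/2) g = ennreal (L2norm2 (dn g))"
  by (simp only: wnorm2_minus_half nn_integral_L2)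

lemma tendsto_L2norm2_up:
  assumes "((\<lambda>s. wnorm2 (1/2) (F s)) \<longlongrightarrow> 0) S" "\<forall>\<^sub>F s in S. L2 (up (F s))"
  shows "((\<lambda>s. L2norm2 (up (F s))) \<longlongrightarrow> 0) S"
proof -
  have "((\<lambda>s. ennreal (L2norm2 (up (F s)))) \<longlongrightarrow> 0) S"
    by (rule Lim_transform_eventually[OF assms(1)], rule eventually_mono[OF assms(2)], rule wnorm2_half_L2)
  then show ?thesis using tendsto_ennreal_iff[of "\<lambda>s. L2norm2 (up (F s))" S 0] by simp
qed

lemma tendsto_L2norm2_dn:
  assumes "((\<lambda>s. wnorm2 (-1/2) (F s)) \<longlongrightarrow> 0) S" "\<forall>\<^sub>F s in S. L2 (dn (F s))"
  shows "((\<lambda>s. L2norm2 (dn (F s))) \<longlongrightarrow> 0) S"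
proof -
  have "((\<lambda>s. ennreal (L2norm2 (dn (F s)))) \<longlongrightarrow> 0) S"
    by (rule Lim_transform_eventually[OF assms(1)], rule eventually_mono[OF assms(2)], rule wnorm2_minus_half_L2)
  then show ?thesis using tendsto_ennreal_iff[of "\<lambda>s. L2norm2 (dn (F s))" S 0] by simp
qed

lemma L2_of_up:
  assumes [measurable]: "g \<in> borel_measurable borel" and "L2 (up g)"
  shows "L2 g" "L2 (dn g)"
proof -
  have a: "cmod (g \<xi>) \<le> 1 * cmod (up g \<xi>)" for \<xi>
    using mult_right_mono[OF wt_ge_1[of \<xi>] norm_ge_zero[of "g \<xi>"]] by (simp add: up_def norm_mult abs_of_pos)
  show "L2 g" by (rule L2_bound[OF assms(2) assms(1) a])
  have b: "cmod (dn g \<xi>) \<le> 1 * cmod (g \<xi>)" for \<xi>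
  proof -
    have "inverse (wt \<xi>) \<le> 1" using wt_ge_1[of \<xi>] by (simp add: inverse_le_1_iff)
    from mult_right_mono[OF this norm_ge_zero[of "g \<xi>"]] show ?thesis by (simp add: dn_def norm_mult norm_inverse abs_of_pos)
  qed
  show "L2 (dn g)" by (rule L2_bound[OF \<open>L2 g\<close> _ b]) measurable
qed

text \<open>The weights cancel: \<open>ip\<close> of a \<open>dn\<close> and an \<open>up\<close> is
  the duality pairing of \<open>H^(-1/2)\<close> with \<open>H^(1/2)\<close>, even where neither
  argument of the plain \<open>ip X Y\<close> gains integrability from the other.\<close>

lemma ip_dn_up: "ip (dn X) (up Y) = ip X Y"
  unfolding ip_def dn_def up_def by (intro Bochner_Integration.integral_cong) (auto simp: of_real_inverse)

lemma integrable_dn_up: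
  assumes "L2 (dn X)" "L2 (up Y)"
  shows "integrable lborel (\<lambda>\<xi>. X \<xi> * cnj (Y \<xi>))"
proof -
  have "(\<lambda>\<xi>. dn X \<xi> * cnj (up Y \<xi>)) = (\<lambda>\<xi>. X \<xi> * cnj (Y \<xi>))"
    by (auto simp: dn_def up_def of_real_inverse)
  then show ?thesis using L2_mult_integrable(1)[OF assms] by simp
qed

lemma L2norm2_mono:
  assumes f: "L2 f" and [measurable]: "g \<in> borel_measurable borel" and le: "\<And>x. cmod (g x) \<le> c * cmod (f x)"
  shows "L2norm2 g \<le> c\<^sup>2 * L2norm2 f"
proof -
  have g: "L2 g" by (rule L2_bound[OF f _ le]) measurable
  have "L2norm2 g \<le> (LINT x|lborel. c\<^sup>2 * (cmod (f x))\<^sup>2)"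
    unfolding L2norm2_eq[OF L2_measurable[OF g]]
  proof (intro integral_mono L2_integrable[OF g] integrable_mult_right L2_integrable[OF f])
    show "(cmod (g x))\<^sup>2 \<le> c\<^sup>2 * (cmod (f x))\<^sup>2" for x
      unfolding power_mult_distrib[symmetric] by (rule power_mono[OF le norm_ge_zero])
  qed
  then show ?thesis by (simp add: L2norm2_eq L2_measurable[OF f])
qed

section \<open>Convergence of duality pairings\<close>

lemma L2norm2_cong_AE:
  assumes "f \<in> borel_measurable borel" "g \<in> borel_measurable borel" "AE x in lborel. f x = g x"
  shows "L2norm2 f = L2norm2 g"
  unfolding L2norm2_def using assms(3) by (intro arg_cong[where f=enn2real] nn_integral_cong_AE) auto

text \<open>Square integrability is known only at times in the existence interval, hence eventually
  along the filter; elsewhere the family is replaced by its limit.\<close>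

lemma L2_tendsto_ip_within:
  assumes f: "L2 f" "\<forall>\<^sub>F i in S. L2 (F i)" "((\<lambda>i. L2norm2 (\<lambda>x. F i x - f x)) \<longlongrightarrow> 0) S"
    and g: "L2 g" "\<forall>\<^sub>F i in S. L2 (G i)" "((\<lambda>i. L2norm2 (\<lambda>x. G i x - g x)) \<longlongrightarrow> 0) S"
  shows "((\<lambda>i. ip (F i) (G i)) \<longlongrightarrow> ip f g) S"
proof -
  let ?F = "\<lambda>i. if L2 (F i) then F i else f" and ?G = "\<lambda>i. if L2 (G i) then G i else g"
  have "((\<lambda>i. ip (?F i) (?G i)) \<longlongrightarrow> ip f g) S"
  proof (rule L2_tendsto_ip)
    show "((\<lambda>i. L2norm2 (\<lambda>x. ?F i x - f x)) \<longlongrightarrow> 0) S"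
      by (rule Lim_transform_eventually[OF f(3)]) (use f(2) in eventually_elim, simp)
    show "((\<lambda>i. L2norm2 (\<lambda>x. ?G i x - g x)) \<longlongrightarrow> 0) S"
      by (rule Lim_transform_eventually[OF g(3)]) (use g(2) in eventually_elim, simp)
  qed (use f g in auto)
  then show ?thesis
    by (rule Lim_transform_eventually) (use f(2) g(2) in eventually_elim, simp)
qed

lemma L2_tendsto_norm_within:
  assumes f: "L2 f" "\<forall>\<^sub>F i in S. L2 (F i)" "((\<lambda>i. L2norm2 (\<lambda>x. F i x - f x)) \<longlongrightarrow> 0) S"
  shows "((\<lambda>i. L2norm2 (F i)) \<longlongrightarrow> L2norm2 f) S"
proof -
  have "((\<lambda>i. Re (ip (F i) (F i))) \<longlongrightarrow> Re (ip f f)) S"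
    by (intro tendsto_Re L2_tendsto_ip_within f)
  then have "((\<lambda>i. Re (ip (F i) (F i))) \<longlongrightarrow> L2norm2 f) S"
    using f(1) by (simp add: ip_self L2_measurable)
  then show ?thesis
    by (rule Lim_transform_eventually) (use f(2) in eventually_elim, simp add: ip_self L2_measurable)
qed

lemma trunc_up_L2:
  assumes f: "L2 f"
  shows "L2 (\<lambda>\<xi>. complex_of_real ((wt \<xi>)\<^sup>2) * trunc R f \<xi>)"
proof (rule L2_bound[OF L2_trunc(1)[OF f]])
  note [measurable] = L2_measurable[OF L2_trunc(1)[OF f]]
  show "(\<lambda>\<xi>. complex_of_real ((wt \<xi>)\<^sup>2) * trunc R f \<xi>) \<in> borel_measurable borel" by measurable
  fix \<xi>
  show "cmod (complex_of_real ((wt \<xi>)\<^sup>2) * trunc R f \<xi>) \<le> sqrt (1 + R\<^sup>2) * cmod (trunc R f \<xi>)"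
  proof (cases "\<xi> \<in> ball 0 R")
    case True
    then have "norm \<xi> \<le> R" by simp
    then have "(norm \<xi>)\<^sup>2 \<le> R\<^sup>2" by (intro power_mono) auto
    then have "(wt \<xi>)\<^sup>2 \<le> sqrt (1 + R\<^sup>2)" unfolding wt_sq(2) by simp
    then show ?thesis unfolding norm_mult norm_of_real by (intro mult_right_mono) auto
  qed (simp add: trunc_def)
qed

text \<open>Boundedness in \<open>H^(1/2)\<close> together with convergence in
  \<open>H^(-1/2)\<close> amounts to weak convergence in \<open>H^(1/2)\<close>, which suffices
  against a strongly convergent factor. It is made for the nonlinearity, whose convergence in time
  is available only in the weaker norm.\<close>

lemma strong_weak_tendsto:
  assumes f: "L2 f" "\<forall>\<^sub>F i in S. L2 (F i)" "((\<lambda>i. L2norm2 (\<lambda>x. F i x - f x)) \<longlongrightarrow> 0) S"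
    and Y: "Y \<in> borel_measurable borel" "L2 (up Y)"
    and Yi: "\<forall>\<^sub>F i in S. Yi i \<in> borel_measurable borel" "\<forall>\<^sub>F i in S. L2 (up (Yi i))" "\<forall>\<^sub>F i in S. L2norm2 (up (Yi i)) \<le> C"
    and lim: "((\<lambda>i. L2norm2 (dn (\<lambda>\<xi>. Yi i \<xi> - Y \<xi>))) \<longlongrightarrow> 0) S"
  shows "((\<lambda>i. ip (F i) (up (Yi i))) \<longlongrightarrow> ip f (up Y)) S"
proof -
  define C' where "C' = 2 * \<bar>C\<bar> + 2 * L2norm2 (up Y) + 1"
  have C': "C' > 0" using L2norm2_nonneg[of "up Y"] unfolding C'_def by linarith
  define Z where "Z i = (\<lambda>\<xi>. Yi i \<xi> - Y \<xi>)" for i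
  have ev: "\<forall>\<^sub>F i in S. L2 (F i) \<and> L2 (up (Yi i)) \<and> L2 (up (Z i)) \<and> L2 (dn (Z i)) \<and> L2norm2 (up (Z i)) \<le> C' \<and> L2norm2 (up (Yi i)) \<le> C'"
    using f(2) Yi
  proof eventually_elim
    case (elim i)
    have [measurable]: "Z i \<in> borel_measurable borel" unfolding Z_def using elim(2) Y(1) by measurable
    have z: "L2 (up (Z i))" unfolding Z_def up_diff by (intro L2_diff elim Y)
    have "L2norm2 (up (Z i)) \<le> 2 * L2norm2 (up (Yi i)) + 2 * L2norm2 (up Y)"
      unfolding Z_def up_diff by (intro L2norm2_diff_le elim Y)
    moreover have "L2norm2 (up (Yi i)) \<ge> 0" by simp
    ultimately have "L2norm2 (up (Z i)) \<le> C'" "L2norm2 (up (Yi i)) \<le> C'" using elim(4) L2norm2_nonneg[of "up Y"] unfolding C'_def by linarith+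
    then show ?case using z L2_of_up[OF _ z] elim by auto
  qed
  have "((\<lambda>i. ip f (up (Z i))) \<longlongrightarrow> 0) S"
  proof (rule tendstoI)
    fix e :: real assume e: "e > 0"
    define e' where "e' = (e / 2)\<^sup>2 / C'"
    have e': "e' > 0" using e C' by (simp add: e'_def)
    from eventually_happens'[OF _ order_tendstoD(2)[OF trunc_tendsto[OF f(1)] e']]
    obtain n where n: "L2norm2 (\<lambda>x. trunc (real n) f x - f x) < e'" by auto
    \<comment> \<open>On a bounded set of frequencies the weight \<open>(wt \<xi>)^2\<close> is
      bounded, so it can be moved from \<open>up (Z i)\<close> to the truncated \<open>f\<close>,
      leaving \<open>dn (Z i)\<close>, which tends to 0.\<close>
    define k where "k = (\<lambda>\<xi>. complex_of_real ((wt \<xi>)\<^sup>2) * trunc (real n) f \<xi>)"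
    have k: "L2 k" unfolding k_def by (rule trunc_up_L2[OF f(1)])
    let ?d = "\<lambda>x. trunc (real n) f x - f x"
    have d: "L2 ?d" by (intro L2_diff L2_trunc(1) f(1))
    have "((\<lambda>i. sqrt (L2norm2 k * L2norm2 (dn (Z i)))) \<longlongrightarrow> sqrt (L2norm2 k * 0)) S"
      using lim unfolding Z_def by (intro tendsto_intros)
    then have "((\<lambda>i. sqrt (L2norm2 k * L2norm2 (dn (Z i)))) \<longlongrightarrow> 0) S" by simp
    then have "\<forall>\<^sub>F i in S. sqrt (L2norm2 k * L2norm2 (dn (Z i))) < e / 2" using e by (intro order_tendstoD(2)) auto
    with ev show "\<forall>\<^sub>F i in S. dist (ip f (up (Z i))) 0 < e"
    proof eventually_elim
      case (elim i)
      have "ip f (up (Z i)) = ip (trunc (real n) f) (up (Z i)) - ip ?d (up (Z i))"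
        using elim f(1) by (simp add: ip_diff_left L2_trunc(1))
      also have "ip (trunc (real n) f) (up (Z i)) = ip k (dn (Z i))"
        unfolding ip_def k_def up_def dn_def
        by (intro Bochner_Integration.integral_cong) (auto simp: of_real_inverse power2_eq_square)
      finally have "cmod (ip f (up (Z i))) \<le> cmod (ip k (dn (Z i))) + cmod (ip ?d (up (Z i)))"
        using norm_triangle_ineq4[of "ip k (dn (Z i))" "ip ?d (up (Z i))"] by (simp only:)
      also have "\<dots> < e / 2 + e / 2"
      proof (rule add_less_le_mono)
        show "cmod (ip k (dn (Z i))) < e / 2" using L2_cauchy_schwarz(2)[OF k, of "dn (Z i)"] elim by linarith
        have "cmod (ip ?d (up (Z i))) \<le> sqrt (L2norm2 ?d * L2norm2 (up (Z i)))" using elim by (intro L2_cauchy_schwarz(2) d) auto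
        also have "\<dots> \<le> sqrt (e' * C')" using n elim e' by (intro real_sqrt_le_mono mult_mono) auto
        also have "\<dots> = e / 2" using C' e by (simp add: e'_def)
        finally show "cmod (ip ?d (up (Z i))) \<le> e / 2" .
      qed
      finally show ?case by simp
    qed
  qed
  moreover have "((\<lambda>i. ip (\<lambda>x. F i x - f x) (up (Yi i))) \<longlongrightarrow> 0) S"
  proof (rule Lim_null_comparison)
    show "\<forall>\<^sub>F i in S. norm (ip (\<lambda>x. F i x - f x) (up (Yi i))) \<le> sqrt (L2norm2 (\<lambda>x. F i x - f x) * C')"
      using ev
    proof eventually_elim
      case (elim i)
      have "norm (ip (\<lambda>x. F i x - f x) (up (Yi i))) \<le> sqrt (L2norm2 (\<lambda>x. F i x - f x) * L2norm2 (up (Yi i)))"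
        using elim f(1) by (intro L2_cauchy_schwarz(2) L2_diff) auto
      also have "\<dots> \<le> sqrt (L2norm2 (\<lambda>x. F i x - f x) * C')"
        using elim by (intro real_sqrt_le_mono mult_left_mono) auto
      finally show ?case .
    qed
    have "((\<lambda>i. sqrt (L2norm2 (\<lambda>x. F i x - f x) * C')) \<longlongrightarrow> sqrt (0 * C')) S"
      by (intro tendsto_intros f)
    then show "((\<lambda>i. sqrt (L2norm2 (\<lambda>x. F i x - f x) * C')) \<longlongrightarrow> 0) S" by simp
  qed
  ultimately have "((\<lambda>i. ip (\<lambda>x. F i x - f x) (up (Yi i)) + ip f (up (Z i)) + ip f (up Y)) \<longlongrightarrow> 0 + 0 + ip f (up Y)) S"
    by (intro tendsto_intros)
  then have "((\<lambda>i. ip (\<lambda>x. F i x - f x) (up (Yi i)) + ip f (up (Z i)) + ip f (up Y)) \<longlongrightarrow> ip f (up Y)) S" by simp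
  then show ?thesis
  proof (rule Lim_transform_eventually)
    show "\<forall>\<^sub>F i in S. ip (\<lambda>x. F i x - f x) (up (Yi i)) + ip f (up (Z i)) + ip f (up Y) = ip (F i) (up (Yi i))"
      using ev
    proof eventually_elim
      case (elim i)
      have "ip f (up (Z i)) = ip f (up (Yi i)) - ip f (up Y)"
        unfolding Z_def up_diff using elim f(1) Y by (intro ip_diff_right) auto
      moreover have "ip (\<lambda>x. F i x - f x) (up (Yi i)) = ip (F i) (up (Yi i)) - ip f (up (Yi i))"
        using elim f(1) by (intro ip_diff_left) auto
      ultimately show ?case by simp
    qed
  qed
qed

lemma kin_le_up: "in_wL2 (1/2) g \<Longrightarrow> kin g \<le> L2norm2 (up g)"
  using in_wL2_kin(2)[of g] wnorm2_half_L2[of g] by (simp add: in_wL2_half_iff)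

lemma L2norm2_le_up: "in_wL2 (1/2) g \<Longrightarrow> L2norm2 g \<le> L2norm2 (up g)"
proof -
  assume "in_wL2 (1/2) g"
  then have g: "g \<in> borel_measurable borel" "L2 (up g)" by (auto simp: in_wL2_half_iff)
  have "cmod (g \<xi>) \<le> 1 * cmod (up g \<xi>)" for \<xi>
    using mult_right_mono[OF wt_ge_1[of \<xi>] norm_ge_zero[of "g \<xi>"]] by (simp add: up_def norm_mult abs_of_pos)
  from L2norm2_mono[OF g(2,1) this] show ?thesis by simp
qed

lemma wnorm2_half_le:
  assumes [measurable]: "g \<in> borel_measurable borel"
  shows "wnorm2 (1/2) g \<le> (\<integral>\<^sup>+\<xi>. ennreal ((cmod (g \<xi>))\<^sup>2) \<partial>lborel) + (\<integral>\<^sup>+\<xi>. ennreal (norm \<xi> * (cmod (g \<xi>))\<^sup>2) \<partial>lborel)"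
proof -
  have le: "(1 + (norm \<xi>)\<^sup>2) powr (1/2) \<le> 1 + norm \<xi>" for \<xi> :: "real^3"
  proof -
    have "sqrt (1 + (norm \<xi>)\<^sup>2) \<le> sqrt ((1 + norm \<xi>)\<^sup>2)" by (rule real_sqrt_le_mono) (simp add: power2_sum)
    then show ?thesis using one_plus_sq_pos[of \<xi>] by (simp add: powr_half_sqrt)
  qed
  have "wnorm2 (1/2) g \<le> (\<integral>\<^sup>+\<xi>. ennreal ((cmod (g \<xi>))\<^sup>2) + ennreal (norm \<xi> * (cmod (g \<xi>))\<^sup>2) \<partial>lborel)"
    unfolding wnorm2_def
  proof (rule nn_integral_mono)
    fix \<xi> :: "real^3"
    have "(1 + (norm \<xi>)\<^sup>2) powr (1/2) * (cmod (g \<xi>))\<^sup>2 \<le> (1 + norm \<xi>) * (cmod (g \<xi>))\<^sup>2"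
      by (rule mult_right_mono[OF le]) simp
    from ennreal_leI[OF this]
    show "ennreal ((1 + (norm \<xi>)\<^sup>2) powr (1/2) * (cmod (g \<xi>))\<^sup>2) \<le> ennreal ((cmod (g \<xi>))\<^sup>2) + ennreal (norm \<xi> * (cmod (g \<xi>))\<^sup>2)"
      by (simp add: distrib_right)
  qed
  then show ?thesis by (simp add: nn_integral_add)
qed

text \<open>The mass of the nonlinearity is controlled by the bounded potential and its kinetic
  energy by \<open>kin_nonlin\<close>; \<open>11/4\<close> is \<open>(1/2)^2 + 5/2\<close>.\<close>

lemma nonlin_in_wL2:
  assumes fg: "is_fourier f g" and g: "in_wL2 (1/2) g" and mu: "mu \<ge> 0"
    and FG: "is_fourier (nonlin lam mu f) G"
  shows "in_wL2 (1/2) G" "L2norm2 (up G) \<le> 11/4 * pi\<^sup>2 * lam\<^sup>2 * (L2norm2 (up g))^3"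
proof -
  note G = is_fourier_L2(2)[OF FG]
  note [measurable] = L2_measurable[OF G]
  let ?N = "L2norm2 (up g)"
  have k: "kin g \<le> ?N" by (rule kin_le_up[OF g])
  have "wnorm2 (1/2) G \<le> ennreal (L2norm2 G) + ennreal (5/2 * pi\<^sup>2 * lam\<^sup>2 * (kin g)^3)"
    using add_mono[OF order_refl kin_nonlin[OF fg g mu FG], of "ennreal (L2norm2 G)"] wnorm2_half_le[OF L2_measurable[OF G]]
    unfolding nn_integral_L2[OF G] by (rule order_trans[rotated])
  also have "\<dots> \<le> ennreal (11/4 * pi\<^sup>2 * lam\<^sup>2 * ?N^3)"
  proof -
    have "L2norm2 G \<le> (\<bar>lam\<bar> * (pi / 2 * kin g))\<^sup>2 * L2norm2 f"
      using L2norm2_nonlin(1)[OF fg g mu, of lam] plancherel[OF FG] by simp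
    also have "\<dots> \<le> (\<bar>lam\<bar> * (pi / 2 * ?N))\<^sup>2 * ?N"
      using k L2norm2_le_up[OF g] plancherel[OF fg]
      by (intro mult_mono power_mono mult_left_mono) auto
    finally have 1: "L2norm2 G \<le> (\<bar>lam\<bar> * (pi / 2 * ?N))\<^sup>2 * ?N" .
    have "5/2 * pi\<^sup>2 * lam\<^sup>2 * (kin g)^3 \<le> 5/2 * pi\<^sup>2 * lam\<^sup>2 * ?N^3"
      by (intro mult_left_mono power_mono k) auto
    with 1 have "L2norm2 G + 5/2 * pi\<^sup>2 * lam\<^sup>2 * (kin g)^3 \<le> (\<bar>lam\<bar> * (pi / 2 * ?N))\<^sup>2 * ?N + 5/2 * pi\<^sup>2 * lam\<^sup>2 * ?N^3" by linarith
    also have "\<dots> = 11/4 * pi\<^sup>2 * lam\<^sup>2 * ?N^3"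
      by (simp add: power_mult_distrib power_divide power2_eq_square power3_eq_cube)
    finally have "ennreal (L2norm2 G + 5/2 * pi\<^sup>2 * lam\<^sup>2 * (kin g)^3) \<le> ennreal (11/4 * pi\<^sup>2 * lam\<^sup>2 * ?N^3)"
      by (rule ennreal_leI)
    moreover have "ennreal (L2norm2 G + 5/2 * pi\<^sup>2 * lam\<^sup>2 * (kin g)^3) = ennreal (L2norm2 G) + ennreal (5/2 * pi\<^sup>2 * lam\<^sup>2 * (kin g)^3)"
      by (rule ennreal_plus) simp_all
    ultimately show ?thesis by (simp only:)
  qed
  finally have le: "wnorm2 (1/2) G \<le> ennreal (11/4 * pi\<^sup>2 * lam\<^sup>2 * ?N^3)" .
  then show "in_wL2 (1/2) G" unfolding in_wL2_def by (auto simp: order_le_less_trans)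
  then have "L2 (up G)" by (simp add: in_wL2_half_iff)
  from le[unfolded wnorm2_half_L2[OF this]] show "L2norm2 (up G) \<le> 11/4 * pi\<^sup>2 * lam\<^sup>2 * ?N^3"
    by (subst (asm) ennreal_le_iff) auto
qed

subsection \<open>Conservation laws\<close>

definition potential_energy :: "real \<Rightarrow> real \<Rightarrow> fn3 \<Rightarrow> real" where
  "potential_energy lam mu f = (LINT x|lborel. hartree_pot lam mu f x * (cmod (f x))\<^sup>2)"

definition symb :: "real \<Rightarrow> real^3 \<Rightarrow> real" where
  "symb m \<xi> = sqrt ((norm \<xi>)\<^sup>2 + m\<^sup>2)"

lemma symb_measurable [measurable]: "symb m \<in> borel_measurable borel"
  unfolding symb_def[abs_def] by measurable

lemma symb_nonneg [simp]: "symb m \<xi> \<ge> 0"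
  by (simp add: symb_def)

lemma norm_le_symb: "norm \<xi> \<le> symb m \<xi>"
  unfolding symb_def by (rule real_le_rsqrt) simp

lemma symb_le: "m \<ge> 0 \<Longrightarrow> symb m \<xi> \<le> (1 + m) * (wt \<xi>)\<^sup>2"
proof -
  assume m: "m \<ge> 0"
  have "(norm \<xi>)\<^sup>2 + m\<^sup>2 \<le> (1 + m)\<^sup>2 * (1 + (norm \<xi>)\<^sup>2)"
  proof -
    have "1 * (norm \<xi>)\<^sup>2 \<le> (1 + m)\<^sup>2 * (norm \<xi>)\<^sup>2" using m by (intro mult_right_mono) (auto simp: power2_sum)
    moreover have "m\<^sup>2 \<le> (1 + m)\<^sup>2" using m by (intro power_mono) auto
    ultimately show ?thesis by (simp add: distrib_left)
  qed
  then have "symb m \<xi> \<le> sqrt ((1 + m)\<^sup>2 * (1 + (norm \<xi>)\<^sup>2))"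
    unfolding symb_def by (rule real_sqrt_le_mono)
  also have "\<dots> = (1 + m) * (wt \<xi>)\<^sup>2" using m by (simp add: real_sqrt_mult wt_sq(2))
  finally show ?thesis .
qed

text \<open>An exact formula in place of a Taylor expansion: the linear term pairs
  \<open>a - b\<close> with nonlinearities in \<open>H^(1/2)\<close>, and the remainder is quadratic
  in \<open>a - b\<close> in \<open>L2\<close>. Thus difference quotients in time remain meaningful
  for quotients converging only in \<open>H^(-1/2)\<close>.\<close>

lemma potential_energy_diff:
  assumes a: "is_fourier a A" "in_wL2 (1/2) A" and b: "is_fourier b B" "in_wL2 (1/2) B" and mu: "mu \<ge> 0"
  shows "potential_energy lam mu a - potential_energy lam mu b
    = 2 * Re (ip (\<lambda>x. a x - b x) (\<lambda>x. nonlin lam mu a x + nonlin lam mu b x))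
      - (LINT x|lborel. (hartree_pot lam mu a x - hartree_pot lam mu b x) * (cmod (a x - b x))\<^sup>2)"
    and "\<bar>LINT x|lborel. (hartree_pot lam mu a x - hartree_pot lam mu b x) * (cmod (a x - b x))\<^sup>2\<bar>
      \<le> \<bar>lam\<bar> * (pi / 2 * kin A + pi / 2 * kin B) * L2norm2 (\<lambda>x. a x - b x)"
proof -
  note La = is_fourier_L2(1)[OF a(1)] and Lb = is_fourier_L2(1)[OF b(1)]
  note [measurable] = L2_measurable[OF La] L2_measurable[OF Lb]
  note Ka = kato[OF a] and Kb = kato[OF b]
  let ?ra = "\<lambda>x. (cmod (a x))\<^sup>2" and ?rb = "\<lambda>x. (cmod (b x))\<^sup>2"
  let ?pa = "pot lam mu ?ra" and ?pb = "pot lam mu ?rb"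
  have Ld: "L2 (\<lambda>x. a x - b x)" by (rule L2_diff[OF La Lb])
  have i: "integrable lborel (\<lambda>x. ?pa x * ?ra x)" "integrable lborel (\<lambda>x. ?pb x * ?rb x)"
    "integrable lborel (\<lambda>x. ?pa x * ?rb x)" "integrable lborel (\<lambda>x. ?pb x * ?ra x)"
    by (intro pot_mult_integrable[OF Ka _ mu] pot_mult_integrable[OF Kb _ mu] L2_integrable La Lb)+
  have id: "integrable lborel (\<lambda>x. ?pa x * (cmod (a x - b x))\<^sup>2)" "integrable lborel (\<lambda>x. ?pb x * (cmod (a x - b x))\<^sup>2)"
    by (intro pot_mult_integrable[OF Ka _ mu] pot_mult_integrable[OF Kb _ mu] L2_integrable Ld)+
  then have id': "integrable lborel (\<lambda>x. (?pa x - ?pb x) * (cmod (a x - b x))\<^sup>2)"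
    by (simp add: left_diff_distrib)
  have LN: "L2 (\<lambda>x. nonlin lam mu a x + nonlin lam mu b x)"
    by (intro L2_add L2norm2_nonlin(2)[OF a mu] L2norm2_nonlin(2)[OF b mu])
  have iip: "integrable lborel (\<lambda>x. (a x - b x) * cnj (nonlin lam mu a x + nonlin lam mu b x))"
    by (rule L2_mult_integrable(1)[OF Ld LN])
  have sym: "(LINT x|lborel. ?pa x * ?rb x) = (LINT x|lborel. ?pb x * ?ra x)"
    by (rule pot_symmetric[OF Ka Kb mu])
  \<comment> \<open>Twice \<open>?pa x * a x + ?pb x * b x\<close> equals \<open>(?pa x + ?pb x) *
    (a x + b x) + (?pa x - ?pb x) * (a x - b x)\<close>. Symmetry of the potential makes the two
    mixed terms on the left cancel after integration.\<close>
  have pw: "?pa x * ?ra x - ?pb x * ?rb x - ?pa x * ?rb x + ?pb x * ?ra x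
    = 2 * Re ((a x - b x) * cnj (nonlin lam mu a x + nonlin lam mu b x)) - (?pa x - ?pb x) * (cmod (a x - b x))\<^sup>2" for x
    unfolding nonlin_def hartree_pot_eq cmod_power2
    by (simp add: power2_eq_square algebra_simps)
  have "potential_energy lam mu a - potential_energy lam mu b
    = (LINT x|lborel. ?pa x * ?ra x - ?pb x * ?rb x - ?pa x * ?rb x + ?pb x * ?ra x)"
    unfolding potential_energy_def hartree_pot_eq using i sym by simp
  also have "\<dots> = 2 * (LINT x|lborel. Re ((a x - b x) * cnj (nonlin lam mu a x + nonlin lam mu b x)))
     - (LINT x|lborel. (?pa x - ?pb x) * (cmod (a x - b x))\<^sup>2)"
    unfolding pw by (subst Bochner_Integration.integral_diff[OF integrable_mult_right[OF integrable_Re[OF iip]] id']) (simp only: integral_mult_right_zero)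
  also have "(LINT x|lborel. Re ((a x - b x) * cnj (nonlin lam mu a x + nonlin lam mu b x))) = Re (ip (\<lambda>x. a x - b x) (\<lambda>x. nonlin lam mu a x + nonlin lam mu b x))"
    unfolding ip_def by (rule integral_Re[OF iip])
  finally show "potential_energy lam mu a - potential_energy lam mu b
    = 2 * Re (ip (\<lambda>x. a x - b x) (\<lambda>x. nonlin lam mu a x + nonlin lam mu b x))
      - (LINT x|lborel. (hartree_pot lam mu a x - hartree_pot lam mu b x) * (cmod (a x - b x))\<^sup>2)"
    unfolding hartree_pot_eq .
  let ?c = "\<bar>lam\<bar> * (pi / 2 * kin A + pi / 2 * kin B)"
  have "\<bar>LINT x|lborel. (?pa x - ?pb x) * (cmod (a x - b x))\<^sup>2\<bar> \<le> (LINT x|lborel. \<bar>(?pa x - ?pb x) * (cmod (a x - b x))\<^sup>2\<bar>)"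
    using integral_norm_bound[of lborel "\<lambda>x. (?pa x - ?pb x) * (cmod (a x - b x))\<^sup>2"] by (simp only: real_norm_def)
  also have "\<dots> \<le> (LINT x|lborel. ?c * (cmod (a x - b x))\<^sup>2)"
  proof (intro integral_mono integrable_abs id' integrable_mult_right L2_integrable[OF Ld])
    fix x
    have "\<bar>?pa x - ?pb x\<bar> \<le> ?c"
      using pot_bound[OF Ka mu, of lam x] pot_bound[OF Kb mu, of lam x] unfolding distrib_left by linarith
    then show "\<bar>(?pa x - ?pb x) * (cmod (a x - b x))\<^sup>2\<bar> \<le> ?c * (cmod (a x - b x))\<^sup>2"
      unfolding abs_mult abs_power2 by (intro mult_right_mono) auto
  qed
  also have "\<dots> = ?c * L2norm2 (\<lambda>x. a x - b x)"
    unfolding L2norm2_eq[OF L2_measurable[OF Ld]] by (rule integral_mult_right_zero)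
  finally show "\<bar>LINT x|lborel. (hartree_pot lam mu a x - hartree_pot lam mu b x) * (cmod (a x - b x))\<^sup>2\<bar>
      \<le> ?c * L2norm2 (\<lambda>x. a x - b x)"
    unfolding hartree_pot_eq .
qed

text \<open>\<open>S\<close> stands for the existence interval, bounded or not; what matters is that
  it contains the compact interval from 0 to each of its points. \<open>G\<close> makes the
  transform of the nonlinearity a function of time.\<close>

locale hartree_flow =
  fixes m lam mu :: real and S :: "real set" and u U W G :: "real \<Rightarrow> fn3"
  assumes m: "m \<ge> 0" and mu: "mu \<ge> 0"
    and S0: "\<And>t. t \<in> S \<Longrightarrow> t \<ge> 0" and S_interval: "\<And>t. t \<in> S \<Longrightarrow> {0..t} \<subseteq> S"
    and U: "\<And>t. t \<in> S \<Longrightarrow> is_fourier (u t) (U t)" "\<And>t. t \<in> S \<Longrightarrow> in_wL2 (1/2) (U t)"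
    and W: "\<And>t. t \<in> S \<Longrightarrow> in_wL2 (-1/2) (W t)"
    and cont_U: "\<And>t. t \<in> S \<Longrightarrow> ((\<lambda>s. wnorm2 (1/2) (\<lambda>\<xi>. U s \<xi> - U t \<xi>)) \<longlongrightarrow> 0) (at t within S)"
    and deriv_U: "\<And>t. t \<in> S \<Longrightarrow> ((\<lambda>s. wnorm2 (-1/2) (\<lambda>\<xi>. (U s \<xi> - U t \<xi>) / complex_of_real (s - t) - W t \<xi>)) \<longlongrightarrow> 0) (at t within S)"
    and cont_W: "\<And>t. t \<in> S \<Longrightarrow> ((\<lambda>s. wnorm2 (-1/2) (\<lambda>\<xi>. W s \<xi> - W t \<xi>)) \<longlongrightarrow> 0) (at t within S)"
    and G: "\<And>t. t \<in> S \<Longrightarrow> is_fourier (nonlin lam mu (u t)) (G t)"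
    and eq: "\<And>t. t \<in> S \<Longrightarrow> AE \<xi> in lborel. \<i> * W t \<xi> = complex_of_real (symb m \<xi>) * U t \<xi> + G t \<xi>"
begin

lemma meas:
  assumes "t \<in> S"
  shows U_meas: "U t \<in> borel_measurable borel" and W_meas: "W t \<in> borel_measurable borel" and G_meas: "G t \<in> borel_measurable borel"
  using U(2)[OF assms] W[OF assms] L2_measurable[OF is_fourier_L2(2)[OF G[OF assms]]] by (auto simp: in_wL2_def)

lemma upU: "t \<in> S \<Longrightarrow> L2 (up (U t))"
  using U(2)[of t] by (simp add: in_wL2_half_iff)

lemma dnW: "t \<in> S \<Longrightarrow> L2 (dn (W t))"
  using W[of t] by (simp only: in_wL2_minus_half_iff)

lemma G_wL2: 
  assumes "t \<in> S"
  shows "in_wL2 (1/2) (G t)" "L2 (up (G t))" "L2norm2 (up (G t)) \<le> 11/4 * pi\<^sup>2 * lam\<^sup>2 * (L2norm2 (up (U t)))^3"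
  using nonlin_in_wL2[OF U[OF assms] mu G[OF assms]] by (auto simp: in_wL2_half_iff)

lemma dnU: "t \<in> S \<Longrightarrow> L2 (dn (U t))"
  by (rule L2_of_up(2)[OF U_meas upU])

section \<open>Difference quotients in time and their limits\<close>

definition quot :: "real \<Rightarrow> real \<Rightarrow> fn3" where
  "quot t s = (\<lambda>\<xi>. complex_of_real (inverse (s - t)) * (U s \<xi> - U t \<xi>))"

lemma in_S_within: "\<forall>\<^sub>F s in at t within S. s \<in> S \<and> s \<noteq> t"
  unfolding eventually_at_filter by simp

lemma dn_quot: "s \<in> S \<Longrightarrow> t \<in> S \<Longrightarrow> L2 (dn (quot t s))"
proof -
  assume s: "s \<in> S" and t: "t \<in> S"
  have "dn (quot t s) = (\<lambda>\<xi>. complex_of_real (inverse (s - t)) * (dn (U s) \<xi> - dn (U t) \<xi>))"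
    by (auto simp: dn_def quot_def algebra_simps)
  then show ?thesis using L2_cmult[OF L2_diff[OF dnU[OF s] dnU[OF t]]] by simp
qed

lemma tendsto_upU:
  assumes t: "t \<in> S"
  shows "((\<lambda>s. L2norm2 (\<lambda>\<xi>. up (U s) \<xi> - up (U t) \<xi>)) \<longlongrightarrow> 0) (at t within S)"
proof -
  have "\<forall>\<^sub>F s in at t within S. L2 (up (\<lambda>\<xi>. U s \<xi> - U t \<xi>))"
    by (rule eventually_mono[OF in_S_within]) (auto simp: up_diff intro: L2_diff upU t)
  from tendsto_L2norm2_up[OF cont_U[OF t] this] show ?thesis unfolding up_diff .
qed

lemma tendsto_dnW:
  assumes t: "t \<in> S"
  shows "((\<lambda>s. L2norm2 (\<lambda>\<xi>. dn (W s) \<xi> - dn (W t) \<xi>)) \<longlongrightarrow> 0) (at t within S)"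
proof -
  have "\<forall>\<^sub>F s in at t within S. L2 (dn (\<lambda>\<xi>. W s \<xi> - W t \<xi>))"
    by (rule eventually_mono[OF in_S_within]) (auto simp: dn_diff intro: L2_diff dnW t)
  from tendsto_L2norm2_dn[OF cont_W[OF t] this] show ?thesis unfolding dn_diff .
qed

lemma tendsto_dn_quot:
  assumes t: "t \<in> S"
  shows "((\<lambda>s. L2norm2 (\<lambda>\<xi>. dn (quot t s) \<xi> - dn (W t) \<xi>)) \<longlongrightarrow> 0) (at t within S)"
proof -
  have q: "(\<lambda>\<xi>. (U s \<xi> - U t \<xi>) / complex_of_real (s - t) - W t \<xi>) = (\<lambda>\<xi>. quot t s \<xi> - W t \<xi>)" for s
    by (auto simp: quot_def divide_inverse mult.commute)
  have "\<forall>\<^sub>F s in at t within S. L2 (dn (\<lambda>\<xi>. quot t s \<xi> - W t \<xi>))"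
    by (rule eventually_mono[OF in_S_within]) (auto simp: dn_diff intro: L2_diff dn_quot dnW t)
  from tendsto_L2norm2_dn[OF deriv_U[OF t, unfolded q] this] show ?thesis unfolding dn_diff .
qed

lemma ev_L2:
  assumes t: "t \<in> S"
  shows "\<forall>\<^sub>F s in at t within S. L2 (up (U s))" "\<forall>\<^sub>F s in at t within S. L2 (dn (quot t s))" "\<forall>\<^sub>F s in at t within S. L2 (dn (W s))"
    "\<forall>\<^sub>F s in at t within S. L2 (up (G s))" "\<forall>\<^sub>F s in at t within S. G s \<in> borel_measurable borel"
  by (rule eventually_mono[OF in_S_within], use t upU dn_quot dnW G_wL2(2) G_meas in blast)+

lemma norm_upU_tendsto: "t \<in> S \<Longrightarrow> ((\<lambda>s. L2norm2 (up (U s))) \<longlongrightarrow> L2norm2 (up (U t))) (at t within S)"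
  by (rule L2_tendsto_norm_within[OF upU ev_L2(1) tendsto_upU])

text \<open>The increment of the quadratic form pairs \<open>U s - U t\<close> with \<open>a\<close>
  times \<open>U s + U t\<close>; after division by \<open>s - t\<close> the first factor converges
  in \<open>H^(-1/2)\<close>. The bound on \<open>a\<close> keeps the second factor convergent in
  \<open>H^(1/2)\<close>, so the unbounded kinetic symbol must be cut off first.\<close>

lemma has_derivative_of_multiplier:
  assumes t: "t \<in> S" and [measurable]: "a \<in> borel_measurable borel" and a: "\<And>\<xi>. \<bar>a \<xi>\<bar> \<le> c"
  shows "((\<lambda>s. LINT \<xi>|lborel. a \<xi> * (cmod (U s \<xi>))\<^sup>2) has_real_derivative
    2 * Re (ip (W t) (\<lambda>\<xi>. complex_of_real (a \<xi>) * U t \<xi>))) (at t within S)"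
proof -
  let ?a = "\<lambda>f \<xi>. complex_of_real (a \<xi>) * f \<xi>"
  have c0: "c \<ge> 0" using a[of 0] by linarith
  have ab: "cmod (?a f \<xi>) \<le> c * cmod (f \<xi>)" for f \<xi>
    unfolding norm_mult norm_of_real by (intro mult_right_mono a) simp
  have aL: "L2 (?a f)" if "L2 f" for f
  proof (rule L2_bound[OF that, where c=c])
    note [measurable] = L2_measurable[OF that]
    show "?a f \<in> borel_measurable borel" by measurable
  qed (rule ab)
  have aN: "L2norm2 (?a f) \<le> c\<^sup>2 * L2norm2 f" if "L2 f" for f
  proof (rule L2norm2_mono[OF that])
    note [measurable] = L2_measurable[OF that]
    show "?a f \<in> borel_measurable borel" by measurable
  qed (rule ab)
  define k where "k s = (LINT \<xi>|lborel. a \<xi> * (cmod (U s \<xi>))\<^sup>2)" for s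
  have up_a: "up (?a f) = ?a (up f)" for f by (auto simp: up_def)
  have kd: "(k s - k t) / (s - t) = Re (ip (dn (quot t s)) (\<lambda>\<xi>. ?a (up (U s)) \<xi> + ?a (up (U t)) \<xi>))" if s: "s \<in> S" "s \<noteq> t" for s
  proof -
    note Us = is_fourier_L2(2)[OF U(1)[OF s(1)]] and Ut = is_fourier_L2(2)[OF U(1)[OF t]]
    have ki: "k r = Re (ip (U r) (?a (U r))) \<and> integrable lborel (\<lambda>\<xi>. a \<xi> * (cmod (U r \<xi>))\<^sup>2)" if "r \<in> S" for r
    proof -
      note Ur = is_fourier_L2(2)[OF U(1)[OF that]]
      have "Re (U r \<xi> * cnj (?a (U r) \<xi>)) = a \<xi> * (cmod (U r \<xi>))\<^sup>2" for \<xi>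
        unfolding cmod_power2 by (simp add: power2_eq_square algebra_simps)
      then show ?thesis
        using integral_Re[OF L2_mult_integrable(1)[OF Ur aL[OF Ur]]] integrable_Re[OF L2_mult_integrable(1)[OF Ur aL[OF Ur]]]
        unfolding k_def ip_def by simp
    qed
    have e1: "Re (ip (\<lambda>\<xi>. U s \<xi> - U t \<xi>) (\<lambda>\<xi>. ?a (U s) \<xi> + ?a (U t) \<xi>)) = k s - k t"
    proof -
      have "ip (?a (U s)) (U t) = ip (U s) (?a (U t))"
        unfolding ip_def by (intro Bochner_Integration.integral_cong) auto
      then have "ip (U t) (?a (U s)) = cnj (ip (U s) (?a (U t)))"
        using ip_commute[of "U t" "?a (U s)"] by simp
      then show ?thesis
        using ki[OF s(1)] ki[OF t] Us Ut by (simp add: ip_diff_left ip_add_right L2_add L2_diff aL)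
    qed
    have "ip (dn (quot t s)) (\<lambda>\<xi>. ?a (up (U s)) \<xi> + ?a (up (U t)) \<xi>) = ip (quot t s) (\<lambda>\<xi>. ?a (U s) \<xi> + ?a (U t) \<xi>)"
    proof -
      have "(\<lambda>\<xi>. ?a (up (U s)) \<xi> + ?a (up (U t)) \<xi>) = up (\<lambda>\<xi>. ?a (U s) \<xi> + ?a (U t) \<xi>)"
        by (auto simp: up_def algebra_simps)
      then show ?thesis by (simp only: ip_dn_up)
    qed
    then have e2: "ip (dn (quot t s)) (\<lambda>\<xi>. ?a (up (U s)) \<xi> + ?a (up (U t)) \<xi>)
        = complex_of_real (inverse (s - t)) * ip (\<lambda>\<xi>. U s \<xi> - U t \<xi>) (\<lambda>\<xi>. ?a (U s) \<xi> + ?a (U t) \<xi>)"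
      unfolding quot_def ip_cmult_left .
    have re: "Re (complex_of_real r * z) = r * Re z" for r z by simp
    show ?thesis unfolding e2 re e1 divide_inverse by (rule mult.commute)
  qed
  have lim: "((\<lambda>s. Re (ip (dn (quot t s)) (\<lambda>\<xi>. ?a (up (U s)) \<xi> + ?a (up (U t)) \<xi>))) \<longlongrightarrow>
      Re (ip (dn (W t)) (\<lambda>\<xi>. ?a (up (U t)) \<xi> + ?a (up (U t)) \<xi>))) (at t within S)"
  proof (intro tendsto_Re L2_tendsto_ip_within dnW t ev_L2 tendsto_dn_quot L2_add aL upU)
    show "\<forall>\<^sub>F s in at t within S. L2 (\<lambda>\<xi>. ?a (up (U s)) \<xi> + ?a (up (U t)) \<xi>)"
      using ev_L2(1)[OF t] by eventually_elim (rule L2_add, rule aL, assumption, rule aL[OF upU[OF t]])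
    show "((\<lambda>s. L2norm2 (\<lambda>\<xi>. ?a (up (U s)) \<xi> + ?a (up (U t)) \<xi> - (?a (up (U t)) \<xi> + ?a (up (U t)) \<xi>))) \<longlongrightarrow> 0) (at t within S)"
    proof (rule tendsto_sandwich[OF _ _ tendsto_const])
      show "((\<lambda>s. c\<^sup>2 * L2norm2 (\<lambda>\<xi>. up (U s) \<xi> - up (U t) \<xi>)) \<longlongrightarrow> 0) (at t within S)"
        by (rule tendsto_mult_right_zero[OF tendsto_upU[OF t]])
      show "\<forall>\<^sub>F s in at t within S. L2norm2 (\<lambda>\<xi>. ?a (up (U s)) \<xi> + ?a (up (U t)) \<xi> - (?a (up (U t)) \<xi> + ?a (up (U t)) \<xi>)) \<le> c\<^sup>2 * L2norm2 (\<lambda>\<xi>. up (U s) \<xi> - up (U t) \<xi>)"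
        using ev_L2(1)[OF t]
      proof eventually_elim
        case (elim s)
        have "(\<lambda>\<xi>. ?a (up (U s)) \<xi> + ?a (up (U t)) \<xi> - (?a (up (U t)) \<xi> + ?a (up (U t)) \<xi>)) = ?a (\<lambda>\<xi>. up (U s) \<xi> - up (U t) \<xi>)"
          by (auto simp: algebra_simps)
        then show ?case using aN[OF L2_diff[OF elim upU[OF t]]] by (simp only:)
      qed
    qed simp
  qed
  have val: "Re (ip (dn (W t)) (\<lambda>\<xi>. ?a (up (U t)) \<xi> + ?a (up (U t)) \<xi>)) = 2 * Re (ip (W t) (?a (U t)))"
  proof -
    have "ip (dn (W t)) (\<lambda>\<xi>. ?a (up (U t)) \<xi> + ?a (up (U t)) \<xi>) = ip (dn (W t)) (?a (up (U t))) + ip (dn (W t)) (?a (up (U t)))"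
      by (intro ip_add_right aL upU dnW t)
    also have "ip (dn (W t)) (?a (up (U t))) = ip (W t) (?a (U t))"
      unfolding up_a[symmetric] by (rule ip_dn_up)
    finally show ?thesis by simp
  qed
  have "((\<lambda>s. (k s - k t) / (s - t)) \<longlongrightarrow> 2 * Re (ip (W t) (?a (U t)))) (at t within S)"
  proof (rule Lim_transform_eventually[OF lim[unfolded val]])
    show "\<forall>\<^sub>F s in at t within S. Re (ip (dn (quot t s)) (\<lambda>\<xi>. ?a (up (U s)) \<xi> + ?a (up (U t)) \<xi>)) = (k s - k t) / (s - t)"
      by (rule eventually_mono[OF in_S_within]) (rule kd[symmetric], auto)
  qed
  then show ?thesis unfolding k_def[symmetric] has_field_derivative_iff .
qed

lemma integrable_WU: "t \<in> S \<Longrightarrow> integrable lborel (\<lambda>\<xi>. W t \<xi> * cnj (U t \<xi>))"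
  by (intro integrable_dn_up dnW upU)

lemma integrable_WG: "t \<in> S \<Longrightarrow> integrable lborel (\<lambda>\<xi>. W t \<xi> * cnj (G t \<xi>))"
  by (intro integrable_dn_up dnW G_wL2(2))

text \<open>Solve the equation for \<open>W\<close>; the terms with \<open>|U|^2\<close> and
  \<open>|G|^2\<close> are purely imaginary and drop out. Both real parts then involve the same flux
  \<open>Im (G cnj U)\<close>, and the opposite signs are the source of energy conservation.\<close>

lemma AE_W:
  assumes t: "t \<in> S"
  shows "AE \<xi> in lborel. Re (W t \<xi> * cnj (U t \<xi>)) = Im (G t \<xi> * cnj (U t \<xi>))
    \<and> Re (W t \<xi> * cnj (G t \<xi>)) = - (symb m \<xi> * Im (G t \<xi> * cnj (U t \<xi>)))"
  using eq[OF t]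
proof eventually_elim
  case (elim \<xi>)
  have "W t \<xi> = - \<i> * (\<i> * W t \<xi>)" by simp
  also have "\<dots> = - \<i> * (complex_of_real (symb m \<xi>) * U t \<xi> + G t \<xi>)" unfolding elim ..
  finally have w: "W t \<xi> = - \<i> * (complex_of_real (symb m \<xi>) * U t \<xi> + G t \<xi>)" .
  show ?case unfolding w by (simp add: algebra_simps)
qed

text \<open>The multiplier lemma with the constant symbol 1. By Parseval the derivative is the
  imaginary part of the pairing of the nonlinearity with \<open>u\<close>, and this vanishes because
  the potential is real.\<close>

lemma mass_conservation:
  assumes t: "t \<in> S"
  shows "L2norm2 (u t) = L2norm2 (u 0)"
proof -
  have 0: "0 \<in> S" using S_interval[OF t] S0[OF t] by auto
  have M: "L2norm2 (u s) = (LINT \<xi>|lborel. 1 * (cmod (U s \<xi>))\<^sup>2)" if "s \<in> S" for s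
    using plancherel[OF U(1)[OF that]] by (simp add: L2norm2_eq U_meas[OF that])
  have "Re (ip (W s) (\<lambda>\<xi>. complex_of_real 1 * U s \<xi>)) = 0" if s: "s \<in> S" for s
  proof -
    have "Re (ip (W s) (U s)) = (LINT \<xi>|lborel. Re (W s \<xi> * cnj (U s \<xi>)))"
      unfolding ip_def by (rule integral_Re[OF integrable_WU[OF s], symmetric])
    also have "\<dots> = (LINT \<xi>|lborel. Im (G s \<xi> * cnj (U s \<xi>)))"
      using AE_W[OF s] U_meas[OF s] W_meas[OF s] G_meas[OF s] by (intro integral_cong_AE) auto
    also have "\<dots> = Im (ip (G s) (U s))"
      unfolding ip_def by (rule integral_Im) (intro L2_mult_integrable(1) is_fourier_L2(2)[OF U(1)[OF s]] is_fourier_L2(2)[OF G[OF s]])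
    also have "ip (G s) (U s) = ip (nonlin lam mu (u s)) (u s)" by (rule parseval[OF G[OF s] U(1)[OF s], symmetric])
    also have "Im \<dots> = (LINT x|lborel. Im (nonlin lam mu (u s) x * cnj (u s x)))"
      unfolding ip_def by (rule integral_Im[symmetric]) (intro L2_mult_integrable(1) is_fourier_L2(1)[OF U(1)[OF s]] is_fourier_L2(1)[OF G[OF s]])
    also have "\<dots> = 0" by (simp add: nonlin_def)
    finally show ?thesis by simp
  qed
  then have "((\<lambda>s. LINT \<xi>|lborel. 1 * (cmod (U s \<xi>))\<^sup>2) has_real_derivative 0) (at s within S)" if "s \<in> S" for s
    using has_derivative_of_multiplier[OF that, of "\<lambda>_. 1" 1] that by simp
  then have "((\<lambda>s. LINT \<xi>|lborel. 1 * (cmod (U s \<xi>))\<^sup>2) has_vector_derivative 0) (at s within {0..t})" if "s \<in> {0..t}" for s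
    unfolding has_real_derivative_iff_has_vector_derivative[symmetric]
    using S_interval[OF t] that by (intro DERIV_subset[OF _ S_interval[OF t]]) auto
  then have "((\<lambda>_. 0) has_integral ((LINT \<xi>|lborel. 1 * (cmod (U t \<xi>))\<^sup>2) - (LINT \<xi>|lborel. 1 * (cmod (U 0 \<xi>))\<^sup>2))) {0..t}"
    by (intro fundamental_theorem_of_calculus S0 t) auto
  from has_integral_unique[OF this has_integral_0] show ?thesis using M[OF t] M[OF 0] by simp
qed

text \<open>The factor 4 has two sources: 2 from the real part in
  \<open>potential_energy_diff\<close>, and 2 because the two nonlinearities in it coincide in the
  limit. \<open>AE_W\<close> then replaces the pairing of \<open>W\<close> with \<open>G\<close> by
  the flux.\<close>

lemma has_derivative_potential_energy:
  assumes t: "t \<in> S"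
  shows "((\<lambda>s. potential_energy lam mu (u s)) has_real_derivative
    - 4 * (LINT \<xi>|lborel. symb m \<xi> * Im (G t \<xi> * cnj (U t \<xi>)))) (at t within S)"
    and "integrable lborel (\<lambda>\<xi>. symb m \<xi> * Im (G t \<xi> * cnj (U t \<xi>)))"
proof -
  let ?F = "at t within S"
  let ?P = "\<lambda>s. potential_energy lam mu (u s)"
  let ?r = "\<lambda>s. LINT x|lborel. (hartree_pot lam mu (u s) x - hartree_pot lam mu (u t) x) * (cmod (u s x - u t x))\<^sup>2"
  let ?N = "\<lambda>s. L2norm2 (up (U s))"
  let ?Y = "\<lambda>s \<xi>. G s \<xi> + G t \<xi>"
  have NB: "\<forall>\<^sub>F s in ?F. ?N s \<le> ?N t + 1"
    using order_tendstoD(2)[OF norm_upU_tendsto[OF t], of "?N t + 1"] by (auto elim: eventually_mono)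
  have Pd: "(?P s - ?P t) / (s - t) = 2 * Re (ip (dn (quot t s)) (up (?Y s))) - ?r s / (s - t)" if s: "s \<in> S" "s \<noteq> t" for s
  proof -
    have "ip (\<lambda>x. u s x - u t x) (\<lambda>x. nonlin lam mu (u s) x + nonlin lam mu (u t) x) = ip (\<lambda>\<xi>. U s \<xi> - U t \<xi>) (?Y s)"
      by (intro parseval is_fourier_diff is_fourier_add U G s t)
    then have "?P s - ?P t = 2 * Re (ip (\<lambda>\<xi>. U s \<xi> - U t \<xi>) (?Y s)) - ?r s"
      using potential_energy_diff(1)[OF U[OF s(1)] U[OF t] mu, of lam] by simp
    moreover have "ip (dn (quot t s)) (up (?Y s)) = complex_of_real (inverse (s - t)) * ip (\<lambda>\<xi>. U s \<xi> - U t \<xi>) (?Y s)"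
      unfolding ip_dn_up unfolding quot_def ip_cmult_left ..
    moreover have "Re (complex_of_real r * z) = r * Re z" for r z by simp
    ultimately show ?thesis by (simp only: diff_divide_distrib) (simp only: divide_inverse mult_ac)
  qed
  \<comment> \<open>The remainder is bounded by \<open>L2norm2 (U s - U t) / |s - t|\<close>, which
    is the modulus of the pairing of the quotient with \<open>U s - U t\<close>: one factor stays
    bounded in \<open>H^(-1/2)\<close>, the other vanishes in \<open>H^(1/2)\<close>.\<close>
  have r0: "((\<lambda>s. ?r s / (s - t)) \<longlongrightarrow> 0) ?F"
  proof (rule Lim_null_comparison)
    let ?c = "\<bar>lam\<bar> * (pi / 2 * (?N t + 1) + pi / 2 * ?N t)"
    show "\<forall>\<^sub>F s in ?F. norm (?r s / (s - t)) \<le> ?c * sqrt (L2norm2 (dn (quot t s)) * L2norm2 (\<lambda>\<xi>. up (U s) \<xi> - up (U t) \<xi>))"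
      using in_S_within NB
    proof eventually_elim
      case (elim s)
      then have s: "s \<in> S" "s \<noteq> t" by auto
      let ?d = "\<lambda>\<xi>. U s \<xi> - U t \<xi>"
      have fd: "is_fourier (\<lambda>x. u s x - u t x) ?d" by (intro is_fourier_diff U s t)
      note Ld = is_fourier_L2(2)[OF fd]
      have "\<bar>lam\<bar> * (pi / 2 * kin (U s) + pi / 2 * kin (U t)) \<le> ?c"
        using kin_le_up[OF U(2)[OF s(1)]] kin_le_up[OF U(2)[OF t]] elim(2)
        by (intro mult_left_mono add_mono) auto
      then have "\<bar>?r s\<bar> \<le> ?c * L2norm2 (\<lambda>x. u s x - u t x)"
        using potential_energy_diff(2)[OF U[OF s(1)] U[OF t] mu, of lam] by (meson L2norm2_nonneg mult_right_mono order_trans)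
      also have "L2norm2 (\<lambda>x. u s x - u t x) = L2norm2 ?d" by (rule plancherel[OF fd, symmetric])
      finally have "\<bar>?r s\<bar> / \<bar>s - t\<bar> \<le> ?c * (L2norm2 ?d / \<bar>s - t\<bar>)" by (simp add: divide_right_mono)
      also have "L2norm2 ?d / \<bar>s - t\<bar> \<le> sqrt (L2norm2 (dn (quot t s)) * L2norm2 (\<lambda>\<xi>. up (U s) \<xi> - up (U t) \<xi>))"
      proof -
        have "complex_of_real (L2norm2 ?d) = ip ?d ?d" by (simp add: ip_self L2_measurable Ld)
        then have "complex_of_real (inverse (s - t) * L2norm2 ?d) = ip (dn (quot t s)) (up ?d)"
          unfolding ip_dn_up unfolding quot_def ip_cmult_left by simp
        then have "\<bar>inverse (s - t) * L2norm2 ?d\<bar> = cmod (ip (dn (quot t s)) (up ?d))" by (metis norm_of_real)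
        also have "\<dots> \<le> sqrt (L2norm2 (dn (quot t s)) * L2norm2 (up ?d))"
          by (intro L2_cauchy_schwarz(2) dn_quot s t) (simp add: up_diff L2_diff upU s t)
        finally show ?thesis unfolding up_diff by (simp add: abs_mult divide_inverse mult.commute)
      qed
      finally show ?case by (simp add: mult_left_mono)
    qed
    have "((\<lambda>s. L2norm2 (dn (quot t s))) \<longlongrightarrow> L2norm2 (dn (W t))) ?F"
      by (rule L2_tendsto_norm_within[OF dnW[OF t] ev_L2(2)[OF t] tendsto_dn_quot[OF t]])
    then have "((\<lambda>s. ?c * sqrt (L2norm2 (dn (quot t s)) * L2norm2 (\<lambda>\<xi>. up (U s) \<xi> - up (U t) \<xi>))) \<longlongrightarrow> ?c * sqrt (L2norm2 (dn (W t)) * 0)) ?F"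
      by (intro tendsto_intros tendsto_upU t)
    then show "((\<lambda>s. ?c * sqrt (L2norm2 (dn (quot t s)) * L2norm2 (\<lambda>\<xi>. up (U s) \<xi> - up (U t) \<xi>))) \<longlongrightarrow> 0) ?F" by simp
  qed
  have lim: "((\<lambda>s. ip (dn (quot t s)) (up (?Y s))) \<longlongrightarrow> ip (dn (W t)) (up (?Y t))) ?F"
  proof (rule strong_weak_tendsto[OF dnW[OF t] ev_L2(2)[OF t] tendsto_dn_quot[OF t]])
    note [measurable] = G_meas[OF t]
    show "?Y t \<in> borel_measurable borel" by measurable
    show "L2 (up (?Y t))" unfolding up_add by (intro L2_add G_wL2(2) t)
    show "\<forall>\<^sub>F s in ?F. ?Y s \<in> borel_measurable borel"
      using ev_L2(5)[OF t] by eventually_elim (rule borel_measurable_add, assumption, rule G_meas[OF t])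
    show "\<forall>\<^sub>F s in ?F. L2 (up (?Y s))" unfolding up_add using ev_L2(4)[OF t] by eventually_elim (rule L2_add, assumption, rule G_wL2(2)[OF t])
    let ?C = "11/4 * pi\<^sup>2 * lam\<^sup>2 * (?N t + 1)^3"
    show "\<forall>\<^sub>F s in ?F. L2norm2 (up (?Y s)) \<le> 2 * ?C + 2 * ?C"
      using in_S_within NB
    proof eventually_elim
      case (elim s)
      then have s: "s \<in> S" by auto
      have "L2norm2 (up (G r)) \<le> ?C" if "r \<in> S" "?N r \<le> ?N t + 1" for r
        by (rule order_trans[OF G_wL2(3)[OF that(1)]]) (use that in \<open>intro mult_left_mono power_mono, auto\<close>)
      from this[OF s elim(2)] this[OF t] have "L2norm2 (up (G s)) \<le> ?C" "L2norm2 (up (G t)) \<le> ?C" by auto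
      moreover have "L2norm2 (up (?Y s)) \<le> 2 * L2norm2 (up (G s)) + 2 * L2norm2 (up (G t))"
        unfolding up_add by (intro L2norm2_add_le G_wL2(2) s t)
      ultimately show ?case by linarith
    qed
    \<comment> \<open>Continuity of the nonlinearity in \<open>H^(-1/2)\<close> is read off the
      equation: \<open>G\<close> is \<open>\<i> W\<close> minus the symbol times \<open>U\<close>,
      and both are continuous in that norm.\<close>
    show "((\<lambda>s. L2norm2 (dn (\<lambda>\<xi>. ?Y s \<xi> - ?Y t \<xi>))) \<longlongrightarrow> 0) ?F"
    proof (rule tendsto_sandwich[OF _ _ tendsto_const])
      have "((\<lambda>s. 2 * L2norm2 (\<lambda>\<xi>. dn (W s) \<xi> - dn (W t) \<xi>) + 2 * ((1 + m)\<^sup>2 * L2norm2 (\<lambda>\<xi>. up (U s) \<xi> - up (U t) \<xi>))) \<longlongrightarrow> 2 * 0 + 2 * ((1 + m)\<^sup>2 * 0)) ?F"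
        by (intro tendsto_intros tendsto_dnW tendsto_upU t)
      then show "((\<lambda>s. 2 * L2norm2 (\<lambda>\<xi>. dn (W s) \<xi> - dn (W t) \<xi>) + 2 * ((1 + m)\<^sup>2 * L2norm2 (\<lambda>\<xi>. up (U s) \<xi> - up (U t) \<xi>))) \<longlongrightarrow> 0) ?F" by simp
      show "\<forall>\<^sub>F s in ?F. L2norm2 (dn (\<lambda>\<xi>. ?Y s \<xi> - ?Y t \<xi>)) \<le> 2 * L2norm2 (\<lambda>\<xi>. dn (W s) \<xi> - dn (W t) \<xi>) + 2 * ((1 + m)\<^sup>2 * L2norm2 (\<lambda>\<xi>. up (U s) \<xi> - up (U t) \<xi>))"
        using in_S_within
      proof eventually_elim
        case (elim s)
        then have s: "s \<in> S" by auto
        note [measurable] = G_meas[OF s] U_meas[OF s] W_meas[OF s] U_meas[OF t] W_meas[OF t]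
        let ?DW = "\<lambda>\<xi>. dn (W s) \<xi> - dn (W t) \<xi>"
        let ?DU = "\<lambda>\<xi>. complex_of_real (symb m \<xi> * (inverse (wt \<xi>))\<^sup>2) * (up (U s) \<xi> - up (U t) \<xi>)"
        have LDW: "L2 ?DW" by (intro L2_diff dnW s t)
        have LD: "L2 (\<lambda>\<xi>. up (U s) \<xi> - up (U t) \<xi>)" by (intro L2_diff upU s t)
        have b: "cmod (?DU \<xi>) \<le> (1 + m) * cmod (up (U s) \<xi> - up (U t) \<xi>)" for \<xi>
        proof -
          have "symb m \<xi> * (inverse (wt \<xi>))\<^sup>2 \<le> (1 + m) * (wt \<xi>)\<^sup>2 * (inverse (wt \<xi>))\<^sup>2"
            by (intro mult_right_mono symb_le m) simp
          also have "\<dots> = 1 + m" by (simp add: power_inverse)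
          finally show ?thesis unfolding norm_mult norm_of_real by (intro mult_right_mono) auto
        qed
        have LDU: "L2 ?DU" by (rule L2_bound[OF LD _ b]) measurable
        have NDU: "L2norm2 ?DU \<le> (1 + m)\<^sup>2 * L2norm2 (\<lambda>\<xi>. up (U s) \<xi> - up (U t) \<xi>)"
          by (rule L2norm2_mono[OF LD _ b]) measurable
        have "L2norm2 (dn (\<lambda>\<xi>. ?Y s \<xi> - ?Y t \<xi>)) = L2norm2 (\<lambda>\<xi>. \<i> * ?DW \<xi> - ?DU \<xi>)"
        proof (rule L2norm2_cong_AE)
          show "AE \<xi> in lborel. dn (\<lambda>\<xi>. ?Y s \<xi> - ?Y t \<xi>) \<xi> = \<i> * ?DW \<xi> - ?DU \<xi>"
            using eq[OF s] eq[OF t]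
          proof eventually_elim
            case (elim \<xi>)
            have g: "G s \<xi> - G t \<xi> = \<i> * (W s \<xi> - W t \<xi>) - complex_of_real (symb m \<xi>) * (U s \<xi> - U t \<xi>)"
              using elim by (simp add: algebra_simps)
            have du: "?DU \<xi> = complex_of_real (inverse (wt \<xi>)) * (complex_of_real (symb m \<xi>) * (U s \<xi> - U t \<xi>))"
              by (simp add: up_def power2_eq_square of_real_inverse field_simps)
            have "dn (\<lambda>\<xi>. ?Y s \<xi> - ?Y t \<xi>) \<xi> = complex_of_real (inverse (wt \<xi>)) * (G s \<xi> - G t \<xi>)"
              by (simp add: dn_def)
            also have "\<dots> = \<i> * ?DW \<xi> - complex_of_real (inverse (wt \<xi>)) * (complex_of_real (symb m \<xi>) * (U s \<xi> - U t \<xi>))"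
              unfolding g by (simp add: dn_def algebra_simps)
            finally show ?case unfolding du .
          qed
        qed measurable
        also have "\<dots> \<le> 2 * L2norm2 (\<lambda>\<xi>. \<i> * ?DW \<xi>) + 2 * L2norm2 ?DU"
          by (intro L2norm2_diff_le L2_cmult LDW LDU)
        also have "L2norm2 (\<lambda>\<xi>. \<i> * ?DW \<xi>) = L2norm2 ?DW"
          by (subst L2norm2_cmult[OF L2_measurable[OF LDW]]) simp
        finally show ?case using NDU by linarith
      qed
    qed simp
  qed
  have WG: "Re (ip (W t) (G t)) = - (LINT \<xi>|lborel. symb m \<xi> * Im (G t \<xi> * cnj (U t \<xi>)))"
    and int: "integrable lborel (\<lambda>\<xi>. symb m \<xi> * Im (G t \<xi> * cnj (U t \<xi>)))"
  proof -
    note [measurable] = G_meas[OF t] U_meas[OF t] W_meas[OF t]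
    have ae: "AE \<xi> in lborel. Re (W t \<xi> * cnj (G t \<xi>)) = - (symb m \<xi> * Im (G t \<xi> * cnj (U t \<xi>)))"
      using AE_W[OF t] by eventually_elim simp
    have "integrable lborel (\<lambda>\<xi>. - (symb m \<xi> * Im (G t \<xi> * cnj (U t \<xi>))))"
      by (rule integrable_cong_AE_imp[OF integrable_Re[OF integrable_WG[OF t]]]) (use ae in \<open>auto elim: eventually_mono\<close>)
    then show "integrable lborel (\<lambda>\<xi>. symb m \<xi> * Im (G t \<xi> * cnj (U t \<xi>)))" by simp
    have "Re (ip (W t) (G t)) = (LINT \<xi>|lborel. Re (W t \<xi> * cnj (G t \<xi>)))"
      unfolding ip_def by (rule integral_Re[OF integrable_WG[OF t], symmetric])
    also have "\<dots> = (LINT \<xi>|lborel. - (symb m \<xi> * Im (G t \<xi> * cnj (U t \<xi>))))"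
      by (intro integral_cong_AE ae) measurable
    finally show "Re (ip (W t) (G t)) = - (LINT \<xi>|lborel. symb m \<xi> * Im (G t \<xi> * cnj (U t \<xi>)))" by simp
  qed
  show "integrable lborel (\<lambda>\<xi>. symb m \<xi> * Im (G t \<xi> * cnj (U t \<xi>)))" by (rule int)
  have val: "Re (ip (dn (W t)) (up (?Y t))) = 2 * Re (ip (W t) (G t))"
  proof -
    have "ip (dn (W t)) (up (?Y t)) = ip (dn (W t)) (up (G t)) + ip (dn (W t)) (up (G t))"
      unfolding up_add by (intro ip_add_right dnW G_wL2(2) t)
    then show ?thesis unfolding ip_dn_up by simp
  qed
  have "((\<lambda>s. 2 * Re (ip (dn (quot t s)) (up (?Y s))) - ?r s / (s - t)) \<longlongrightarrow> 2 * Re (ip (dn (W t)) (up (?Y t))) - 0) ?F"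
    by (intro tendsto_intros lim r0)
  then have "((\<lambda>s. (?P s - ?P t) / (s - t)) \<longlongrightarrow> 2 * Re (ip (dn (W t)) (up (?Y t))) - 0) ?F"
  proof (rule Lim_transform_eventually)
    show "\<forall>\<^sub>F s in ?F. 2 * Re (ip (dn (quot t s)) (up (?Y s))) - ?r s / (s - t) = (?P s - ?P t) / (s - t)"
      by (rule eventually_mono[OF in_S_within]) (rule Pd[symmetric], auto)
  qed
  then show "(?P has_real_derivative - 4 * (LINT \<xi>|lborel. symb m \<xi> * Im (G t \<xi> * cnj (U t \<xi>)))) ?F"
    unfolding has_field_derivative_iff val WG by simp
qed

definition energy :: "real \<Rightarrow> real" where
  "energy t = (LINT \<xi>|lborel. symb m \<xi> * (cmod (U t \<xi>))\<^sup>2) / 2 + potential_energy lam mu (u t) / 4"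

lemma integrable_kinetic: "t \<in> S \<Longrightarrow> integrable lborel (\<lambda>\<xi>. symb m \<xi> * (cmod (U t \<xi>))\<^sup>2)"
proof (rule Bochner_Integration.integrable_bound)
  assume t: "t \<in> S"
  note [measurable] = U_meas[OF t]
  show "integrable lborel (\<lambda>\<xi>. (1 + m) * (cmod (up (U t) \<xi>))\<^sup>2)"
    by (intro integrable_mult_right L2_integrable upU t)
  show "(\<lambda>\<xi>. symb m \<xi> * (cmod (U t \<xi>))\<^sup>2) \<in> borel_measurable lborel" by measurable
  show "AE \<xi> in lborel. norm (symb m \<xi> * (cmod (U t \<xi>))\<^sup>2) \<le> norm ((1 + m) * (cmod (up (U t) \<xi>))\<^sup>2)"
    using mult_right_mono[OF symb_le[OF m], of "(cmod (U t _))\<^sup>2"] m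
    by (intro AE_I2) (simp add: up_def norm_mult power_mult_distrib mult.assoc)
qed

text \<open>The kinetic symbol is at most \<open>(1 + m) * (wt \<xi>)^2\<close>, and one weight goes
  to each of \<open>G\<close> and \<open>U\<close>. The bound depends on the \<open>H^(1/2)\<close>
  norm alone, hence is uniform on compact time intervals.\<close>

lemma flux_bound:
  assumes t: "t \<in> S"
  shows "(LINT \<xi>|lborel. \<bar>symb m \<xi> * Im (G t \<xi> * cnj (U t \<xi>))\<bar>)
    \<le> (1 + m) * sqrt (11/4 * pi\<^sup>2 * lam\<^sup>2 * (L2norm2 (up (U t)))^3 * L2norm2 (up (U t)))"
proof -
  note [measurable] = G_meas[OF t] U_meas[OF t]
  have "(LINT \<xi>|lborel. \<bar>symb m \<xi> * Im (G t \<xi> * cnj (U t \<xi>))\<bar>) \<le> (LINT \<xi>|lborel. (1 + m) * (cmod (up (G t) \<xi>) * cmod (up (U t) \<xi>)))"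
  proof (intro integral_mono integrable_abs has_derivative_potential_energy(2) t integrable_mult_right L2_mult_integrable(2) G_wL2(2) upU)
    fix \<xi>
    have "\<bar>Im (G t \<xi> * cnj (U t \<xi>))\<bar> \<le> cmod (G t \<xi>) * cmod (U t \<xi>)"
      using abs_Im_le_cmod[of "G t \<xi> * cnj (U t \<xi>)"] by (simp add: norm_mult)
    then have "\<bar>symb m \<xi> * Im (G t \<xi> * cnj (U t \<xi>))\<bar> \<le> ((1 + m) * (wt \<xi>)\<^sup>2) * (cmod (G t \<xi>) * cmod (U t \<xi>))"
      unfolding abs_mult using m by (intro mult_mono) (auto simp: symb_le)
    then show "\<bar>symb m \<xi> * Im (G t \<xi> * cnj (U t \<xi>))\<bar> \<le> (1 + m) * (cmod (up (G t) \<xi>) * cmod (up (U t) \<xi>))"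
      by (simp add: up_def norm_mult power2_eq_square mult_ac abs_of_pos)
  qed
  also have "\<dots> = (1 + m) * (LINT \<xi>|lborel. cmod (up (G t) \<xi>) * cmod (up (U t) \<xi>))" by (rule integral_mult_right_zero)
  also have "\<dots> \<le> (1 + m) * sqrt (L2norm2 (up (G t)) * L2norm2 (up (U t)))"
    using m by (intro mult_left_mono L2_cauchy_schwarz(1) G_wL2(2) upU t) auto
  also have "\<dots> \<le> (1 + m) * sqrt (11/4 * pi\<^sup>2 * lam\<^sup>2 * (L2norm2 (up (U t)))^3 * L2norm2 (up (U t)))"
    using m by (intro mult_left_mono real_sqrt_le_mono mult_right_mono G_wL2(3) t) auto
  finally show ?thesis .
qed

lemma upU_bounded:
  assumes t: "t \<in> S"
  obtains B where "B \<ge> 0" "\<And>s. s \<in> {0..t} \<Longrightarrow> L2norm2 (up (U s)) \<le> B"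
proof -
  have "continuous_on {0..t} (\<lambda>s. L2norm2 (up (U s)))"
    unfolding continuous_on_def
    using norm_upU_tendsto S_interval[OF t] by (blast intro: tendsto_within_subset)
  then have "compact ((\<lambda>s. L2norm2 (up (U s))) ` {0..t})" by (intro compact_continuous_image) auto
  then have "bounded ((\<lambda>s. L2norm2 (up (U s))) ` {0..t})" by (rule compact_imp_bounded)
  then obtain B where "\<And>s. s \<in> {0..t} \<Longrightarrow> norm (L2norm2 (up (U s))) \<le> B"
    unfolding bounded_iff by blast
  then show ?thesis using that[of "max B 0"] by fastforce
qed

text \<open>The equation only pairs with itself after a frequency cutoff of the kinetic energy; the energy flux
  through the cutoff is controlled because the nonlinearity lies in the energy space.\<close>
lemma energy_conservation:
  assumes t: "t \<in> S"
  shows "energy t = energy 0"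
proof -
  have 0: "0 \<in> S" and St: "{0..t} \<subseteq> S" using S_interval[OF t] S0[OF t] by auto
  \<comment> \<open>The symbol restricted to a ball is bounded, so the multiplier lemma applies to
    it.\<close>
  define a where "a n \<xi> = indicator (ball 0 (real n)) \<xi> * symb m \<xi>" for n :: nat and \<xi> :: "real^3"
  have a_meas [measurable]: "a n \<in> borel_measurable borel" for n
    unfolding a_def[abs_def] by (intro borel_measurable_times borel_measurable_indicator symb_measurable) simp
  have a_le: "0 \<le> a n \<xi>" "a n \<xi> \<le> symb m \<xi>" for n \<xi> by (auto simp: a_def indicator_def)
  have a_b: "\<bar>a n \<xi>\<bar> \<le> sqrt ((real n)\<^sup>2 + m\<^sup>2)" for n \<xi>
  proof (cases "\<xi> \<in> ball 0 (real n)")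
    case True
    then have "(norm \<xi>)\<^sup>2 \<le> (real n)\<^sup>2" by (intro power_mono) auto
    then show ?thesis using True by (simp add: a_def symb_def)
  qed (simp add: a_def)
  have a_lim: "(\<lambda>n. a n \<xi>) \<longlonglongrightarrow> symb m \<xi>" for \<xi>
  proof (rule tendsto_eventually)
    show "\<forall>\<^sub>F n in sequentially. a n \<xi> = symb m \<xi>"
      using eventually_gt_at_top[of "nat \<lceil>norm \<xi>\<rceil>"]
    proof eventually_elim
      case (elim n)
      then have "\<xi> \<in> ball 0 (real n)" by (simp, linarith)
      then show ?case by (simp add: a_def)
    qed
  qed
  define E where "E n s = (LINT \<xi>|lborel. a n \<xi> * (cmod (U s \<xi>))\<^sup>2) / 2 + potential_energy lam mu (u s) / 4" for n s
  let ?Im = "\<lambda>s \<xi>. Im (G s \<xi> * cnj (U s \<xi>))"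
  \<comment> \<open>The flux of the cut-off energy: the kinetic and potential contributions cancel
    inside the ball, and only high frequencies survive.\<close>
  define D where "D n s = (LINT \<xi>|lborel. (a n \<xi> - symb m \<xi>) * ?Im s \<xi>)" for n s
  have ai: "integrable lborel (\<lambda>\<xi>. a n \<xi> * ?Im s \<xi>)" if s: "s \<in> S" for n s
  proof (rule Bochner_Integration.integrable_bound[OF has_derivative_potential_energy(2)[OF s]])
    note [measurable] = G_meas[OF s] U_meas[OF s]
    show "(\<lambda>\<xi>. a n \<xi> * ?Im s \<xi>) \<in> borel_measurable lborel" by measurable
    show "AE \<xi> in lborel. norm (a n \<xi> * ?Im s \<xi>) \<le> norm (symb m \<xi> * ?Im s \<xi>)"
      unfolding norm_mult using a_le by (intro AE_I2 mult_right_mono) auto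
  qed
  have dE: "(E n has_real_derivative D n s) (at s within S)" if s: "s \<in> S" for n s
  proof -
    note [measurable] = G_meas[OF s] U_meas[OF s] W_meas[OF s]
    have L2a: "L2 (\<lambda>\<xi>. complex_of_real (a n \<xi>) * f \<xi>)" if f: "L2 f" for f
    proof (rule L2_bound[OF f])
      note [measurable] = L2_measurable[OF f]
      show "(\<lambda>\<xi>. complex_of_real (a n \<xi>) * f \<xi>) \<in> borel_measurable borel" by measurable
      show "cmod (complex_of_real (a n \<xi>) * f \<xi>) \<le> sqrt ((real n)\<^sup>2 + m\<^sup>2) * cmod (f \<xi>)" for \<xi>
        unfolding norm_mult norm_of_real by (intro mult_right_mono a_b) simp
    qed
    have upa: "up (\<lambda>\<xi>. complex_of_real (a n \<xi>) * U s \<xi>) = (\<lambda>\<xi>. complex_of_real (a n \<xi>) * up (U s) \<xi>)"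
      by (auto simp: up_def)
    have "integrable lborel (\<lambda>\<xi>. W s \<xi> * cnj (complex_of_real (a n \<xi>) * U s \<xi>))"
      by (intro integrable_dn_up dnW s) (simp add: upa L2a upU s)
    from integral_Re[OF this] have "Re (ip (W s) (\<lambda>\<xi>. complex_of_real (a n \<xi>) * U s \<xi>)) = (LINT \<xi>|lborel. Re (W s \<xi> * cnj (complex_of_real (a n \<xi>) * U s \<xi>)))"
      unfolding ip_def by simp
    also have "\<dots> = (LINT \<xi>|lborel. a n \<xi> * ?Im s \<xi>)"
    proof (rule integral_cong_AE)
      show "AE \<xi> in lborel. Re (W s \<xi> * cnj (complex_of_real (a n \<xi>) * U s \<xi>)) = a n \<xi> * ?Im s \<xi>"
        using AE_W[OF s]
      proof eventually_elim
        case (elim \<xi>)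
        have "Re (W s \<xi> * cnj (complex_of_real (a n \<xi>) * U s \<xi>)) = a n \<xi> * Re (W s \<xi> * cnj (U s \<xi>))"
          by (simp add: algebra_simps)
        then show ?case using elim by (simp only:)
      qed
    qed measurable
    finally have v: "Re (ip (W s) (\<lambda>\<xi>. complex_of_real (a n \<xi>) * U s \<xi>)) = (LINT \<xi>|lborel. a n \<xi> * ?Im s \<xi>)" .
    have "(E n has_real_derivative (2 * (LINT \<xi>|lborel. a n \<xi> * ?Im s \<xi>)) / 2 + (- 4 * (LINT \<xi>|lborel. symb m \<xi> * ?Im s \<xi>)) / 4) (at s within S)"
      unfolding E_def[abs_def] v[symmetric]
      by (intro DERIV_add DERIV_cdivide has_derivative_of_multiplier[OF s a_meas a_b] has_derivative_potential_energy(1) s)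
    also have "(2 * (LINT \<xi>|lborel. a n \<xi> * ?Im s \<xi>)) / 2 + (- 4 * (LINT \<xi>|lborel. symb m \<xi> * ?Im s \<xi>)) / 4 = D n s"
      unfolding D_def left_diff_distrib using ai[OF s, of n] has_derivative_potential_energy(2)[OF s] by simp
    finally show ?thesis .
  qed
  have I: "(D n has_integral (E n t - E n 0)) {0..t}" for n
  proof (rule fundamental_theorem_of_calculus[OF S0[OF t]])
    fix s assume "s \<in> {0..t}"
    then show "(E n has_vector_derivative D n s) (at s within {0..t})"
      unfolding has_real_derivative_iff_has_vector_derivative[symmetric]
      using dE St by (blast intro: DERIV_subset)
  qed
  obtain B where B: "B \<ge> 0" "\<And>s. s \<in> {0..t} \<Longrightarrow> L2norm2 (up (U s)) \<le> B" using upU_bounded[OF t] by blast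
  define C where "C = (1 + m) * sqrt (11/4 * pi\<^sup>2 * lam\<^sup>2 * B^3 * B)"
  have DC: "\<bar>D n s\<bar> \<le> C" if s: "s \<in> {0..t}" for n s
  proof -
    have sS: "s \<in> S" using s St by auto
    have "\<bar>D n s\<bar> \<le> (LINT \<xi>|lborel. \<bar>(a n \<xi> - symb m \<xi>) * ?Im s \<xi>\<bar>)"
      unfolding D_def using integral_norm_bound[of lborel "\<lambda>\<xi>. (a n \<xi> - symb m \<xi>) * ?Im s \<xi>"] by (simp only: real_norm_def)
    also have "\<dots> \<le> (LINT \<xi>|lborel. \<bar>symb m \<xi> * ?Im s \<xi>\<bar>)"
    proof (intro integral_mono integrable_abs has_derivative_potential_energy(2) sS)
      show "integrable lborel (\<lambda>\<xi>. (a n \<xi> - symb m \<xi>) * ?Im s \<xi>)"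
        unfolding left_diff_distrib using ai[OF sS] has_derivative_potential_energy(2)[OF sS] by (intro Bochner_Integration.integrable_diff)
      show "\<bar>(a n \<xi> - symb m \<xi>) * ?Im s \<xi>\<bar> \<le> \<bar>symb m \<xi> * ?Im s \<xi>\<bar>" for \<xi>
        unfolding abs_mult using a_le[of n \<xi>] by (intro mult_right_mono) auto
    qed
    also have "\<dots> \<le> (1 + m) * sqrt (11/4 * pi\<^sup>2 * lam\<^sup>2 * (L2norm2 (up (U s)))^3 * L2norm2 (up (U s)))" by (rule flux_bound[OF sS])
    also have "\<dots> \<le> C" unfolding C_def using m B(2)[OF s] B(1)
      by (intro mult_left_mono real_sqrt_le_mono mult_mono power_mono) auto
    finally show ?thesis .
  qed
  have D0: "(\<lambda>n. D n s) \<longlonglongrightarrow> 0" if s: "s \<in> {0..t}" for s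
  proof -
    have sS: "s \<in> S" using s St by auto
    note [measurable] = G_meas[OF sS] U_meas[OF sS]
    have "(\<lambda>n. D n s) \<longlonglongrightarrow> (LINT \<xi>|lborel. (symb m \<xi> - symb m \<xi>) * ?Im s \<xi>)"
      unfolding D_def
    proof (rule integral_dominated_convergence)
      show "integrable lborel (\<lambda>\<xi>. \<bar>symb m \<xi> * ?Im s \<xi>\<bar>)" by (intro integrable_abs has_derivative_potential_energy(2) sS)
      show "AE \<xi> in lborel. (\<lambda>n. (a n \<xi> - symb m \<xi>) * ?Im s \<xi>) \<longlonglongrightarrow> (symb m \<xi> - symb m \<xi>) * ?Im s \<xi>"
        by (intro AE_I2 tendsto_intros a_lim)
      show "AE \<xi> in lborel. norm ((a n \<xi> - symb m \<xi>) * ?Im s \<xi>) \<le> \<bar>symb m \<xi> * ?Im s \<xi>\<bar>" for n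
        unfolding norm_mult abs_mult real_norm_def using a_le[of n] by (intro AE_I2 mult_right_mono) auto
    qed measurable
    then show ?thesis by simp
  qed
  \<comment> \<open>Dominated convergence is used twice: in frequency for each fixed time, and here
    in time with the constant majorant \<open>C\<close>.\<close>
  have "(\<lambda>n. integral {0..t} (D n)) \<longlonglongrightarrow> integral {0..t} (\<lambda>_. 0::real)"
  proof (rule dominated_convergence(2))
    show "D n integrable_on {0..t}" for n using I[of n] by (rule has_integral_integrable)
    show "(\<lambda>_. C) integrable_on {0..t}" by (rule integrable_const_ivl)
    show "norm (D n s) \<le> C" if "s \<in> {0..t}" for n s using DC[OF that] by simp
  qed (use D0 in auto)
  then have l1: "(\<lambda>n. E n t - E n 0) \<longlonglongrightarrow> 0" using integral_unique[OF I] by simp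
  have l2: "(\<lambda>n. E n s) \<longlonglongrightarrow> energy s" if s: "s \<in> S" for s
  proof -
    note [measurable] = U_meas[OF s]
    have "(\<lambda>n. LINT \<xi>|lborel. a n \<xi> * (cmod (U s \<xi>))\<^sup>2) \<longlonglongrightarrow> (LINT \<xi>|lborel. symb m \<xi> * (cmod (U s \<xi>))\<^sup>2)"
    proof (rule integral_dominated_convergence)
      show "integrable lborel (\<lambda>\<xi>. symb m \<xi> * (cmod (U s \<xi>))\<^sup>2)" by (rule integrable_kinetic[OF s])
      show "AE \<xi> in lborel. (\<lambda>n. a n \<xi> * (cmod (U s \<xi>))\<^sup>2) \<longlonglongrightarrow> symb m \<xi> * (cmod (U s \<xi>))\<^sup>2"
        by (intro AE_I2 tendsto_intros a_lim)
      show "AE \<xi> in lborel. norm (a n \<xi> * (cmod (U s \<xi>))\<^sup>2) \<le> symb m \<xi> * (cmod (U s \<xi>))\<^sup>2" for n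
        using a_le by (intro AE_I2) (simp add: abs_mult mult_right_mono)
    qed measurable
    then show ?thesis unfolding E_def energy_def by (intro tendsto_intros) auto
  qed
  have "(\<lambda>n. E n t - E n 0) \<longlonglongrightarrow> energy t - energy 0" by (intro tendsto_diff l2 t 0)
  from LIMSEQ_unique[OF l1 this] show ?thesis by simp
qed

end

subsection \<open>The ground state\<close>

definition hf :: "fn3 \<Rightarrow> fn3" where
  "hf g = (\<lambda>\<xi>. complex_of_real (sqrt (norm \<xi>)) * g \<xi>)"

lemma kin_eq_hf:
  assumes g: "in_wL2 (1/2) g"
  shows "L2 (hf g)" "kin g = L2norm2 (hf g)"
proof -
  have [measurable]: "g \<in> borel_measurable borel" using g by (simp add: in_wL2_def)
  have eq: "(\<integral>\<^sup>+\<xi>. ennreal ((cmod (hf g \<xi>))\<^sup>2) \<partial>lborel) = (\<integral>\<^sup>+\<xi>. ennreal (norm \<xi> * (cmod (g \<xi>))\<^sup>2) \<partial>lborel)"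
    by (intro nn_integral_cong) (simp add: hf_def norm_mult power_mult_distrib)
  have "hf g \<in> borel_measurable borel" unfolding hf_def by measurable
  then show "L2 (hf g)" unfolding L2_def eq in_wL2_kin(1)[OF g] by simp
  show "kin g = L2norm2 (hf g)" unfolding L2norm2_def eq kin_def ..
qed

lemma in_wL2_cong_AE:
  assumes "in_wL2 s g" "f \<in> borel_measurable borel" "AE \<xi> in lborel. f \<xi> = g \<xi>"
  shows "in_wL2 s f" "wnorm2 s f = wnorm2 s g" "kin f = kin g"
proof -
  show "wnorm2 s f = wnorm2 s g" unfolding wnorm2_def using assms(3) by (intro nn_integral_cong_AE) auto
  then show "in_wL2 s f" using assms by (simp add: in_wL2_def)
  show "kin f = kin g" unfolding kin_def using assms(3) by (intro arg_cong[where f=enn2real] nn_integral_cong_AE) auto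
qed

lemma H_half_fourier:
  assumes "H_half f" "is_fourier f g" shows "in_wL2 (1/2) g"
proof -
  obtain g' where g': "is_fourier f g'" "in_wL2 (1/2) g'" using assms(1) by (auto simp: H_half_def)
  show ?thesis
    by (rule in_wL2_cong_AE(1)[OF g'(2) L2_measurable[OF is_fourier_L2(2)[OF assms(2)]] is_fourier_unique[OF assms(2) g'(1)]])
qed

lemma in_wL2_add:
  assumes "in_wL2 (1/2) f" "in_wL2 (1/2) g" shows "in_wL2 (1/2) (\<lambda>\<xi>. f \<xi> + g \<xi>)"
  using assms unfolding in_wL2_half_iff up_add by (auto intro: L2_add)

lemma in_wL2_cmult:
  assumes "in_wL2 (1/2) g" shows "in_wL2 (1/2) (\<lambda>\<xi>. c * g \<xi>)"
proof -
  have "up (\<lambda>\<xi>. c * g \<xi>) = (\<lambda>\<xi>. c * up g \<xi>)" by (auto simp: up_def)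
  then show ?thesis using assms unfolding in_wL2_half_iff by (auto intro: L2_cmult)
qed

lemma pot_nonneg: "lam \<ge> 0 \<Longrightarrow> (\<And>y. s y \<ge> 0) \<Longrightarrow> pot lam mu s x \<ge> 0"
  unfolding pot_def by (intro Bochner_Integration.integral_nonneg) simp

lemma pot_scale: "pot lam mu s x = lam * pot 1 mu s x"
  unfolding pot_def integral_mult_right_zero[symmetric] by (intro Bochner_Integration.integral_cong) auto

lemma potential_energy_nonneg: "lam \<ge> 0 \<Longrightarrow> potential_energy lam mu f \<ge> 0"
  unfolding potential_energy_def hartree_pot_eq
  by (intro Bochner_Integration.integral_nonneg mult_nonneg_nonneg pot_nonneg) auto

lemma K_functional_eq:
  assumes fg: "is_fourier f g" and g: "in_wL2 (1/2) g"
  shows "K_functional f = kin g * L2norm2 f / potential_energy 1 0 f"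
proof -
  let ?g = "SOME g. is_fourier f g"
  have g': "is_fourier f ?g" by (rule someI[where P="is_fourier f", OF fg])
  have "kin ?g = kin g"
    by (rule in_wL2_cong_AE(3)[OF g L2_measurable[OF is_fourier_L2(2)[OF g']] is_fourier_unique[OF g' fg]])
  moreover have "enn2real (\<integral>\<^sup>+x. ennreal (hartree_pot 1 0 f x * (cmod (f x))\<^sup>2) \<partial>lborel) = potential_energy 1 0 f"
  proof -
    note [measurable] = L2_measurable[OF is_fourier_L2(1)[OF fg]]
    show ?thesis unfolding potential_energy_def hartree_pot_eq
      by (intro integral_eq_nn_integral[symmetric] AE_I2 mult_nonneg_nonneg pot_nonneg) simp_all
  qed
  ultimately show ?thesis unfolding K_functional_def kin_def by simp
qed

text \<open>At every point \<open>heat r\<close> is at most \<open>weight r\<close>, whose tail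
  integral is known; the resulting bound is uniform in \<open>z\<close>, as the averaging argument
  below requires.\<close>

lemma tail_potential_decay:
  assumes s: "s > 0" shows "tail_potential s z \<le> ennreal (2 / sqrt s)"
proof -
  have "tail_potential s z \<le> (\<integral>\<^sup>+r. ennreal (weight r) * indicator {s..} r \<partial>lborel)"
    unfolding tail_potential_def
  proof (rule nn_integral_mono)
    fix r :: real
    have "heat r z \<le> weight r" if r: "r > s"
    proof -
      have r0: "r > 0" using r s by simp
      have "sqrt r \<le> sqrt (4 * pi * r)" using pi_gt3 r0 by (intro real_sqrt_le_mono) (simp add: mult_le_cancel_right1)
      then have "inverse (sqrt (4 * pi * r) ^ 3) \<le> inverse (sqrt r ^ 3)"
        using r0 by (intro le_imp_inverse_le power_mono) auto
      moreover have "exp (- (norm z)\<^sup>2 / (4 * r)) \<le> 1" using r0 by simp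
      ultimately show ?thesis unfolding heat_eq[OF r0] weight_def
        using mult_mono[of "inverse (sqrt (4 * pi * r) ^ 3)" "inverse (sqrt r ^ 3)" "exp (- (norm z)\<^sup>2 / (4 * r))" 1] r0 by simp
    qed
    then show "ennreal (heat r z) * indicator {s<..} r \<le> ennreal (weight r) * indicator {s..} r"
      by (auto simp: indicator_def intro: ennreal_leI)
  qed
  also have "\<dots> = ennreal (2 / sqrt s)" by (rule nn_integral_weight_atLeast[OF s])
  finally show ?thesis .
qed

text \<open>Averaging a Newton potential against the heat kernel at time \<open>s\<close> gives \<open>O(1 / sqrt s)\<close>.\<close>
lemma pot_not_constant:
  assumes fg: "is_fourier f g" and g: "in_wL2 (1/2) g" and c: "c > 0"
  shows "\<not> (AE x in lborel. pot 1 0 (\<lambda>y. (cmod (f y))\<^sup>2) x = c)"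
proof
  assume ae: "AE x in lborel. pot 1 0 (\<lambda>y. (cmod (f y))\<^sup>2) x = c"
  note L = is_fourier_L2(1)[OF fg]
  note [measurable] = L2_measurable[OF L]
  note K = kato[OF fg g]
  let ?M = "L2norm2 f"
  have nn: "ennreal (pot 1 0 (\<lambda>y. (cmod (f y))\<^sup>2) x) = (\<integral>\<^sup>+y. ennreal ((cmod (f y))\<^sup>2) * ennreal (1 / norm (x - y)) \<partial>lborel)" for x
  proof -
    have "pot 1 0 (\<lambda>y. (cmod (f y))\<^sup>2) x = (LINT y|lborel. \<bar>(cmod (f y))\<^sup>2\<bar> / norm (x - y))"
      unfolding pot_def by (intro Bochner_Integration.integral_cong) auto
    then show ?thesis
      by (simp only:) (subst nn_integral_eq_integral[symmetric, OF kato_classD(3)[OF K]], auto simp: ennreal_mult[symmetric])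
  qed
  have av: "(\<integral>\<^sup>+x. ennreal (heat s x) * ennreal (1 / norm (x - y)) \<partial>lborel) \<le> ennreal (8 * pi / sqrt s)" if s: "s > 0" for s y
  proof -
    have "(\<integral>\<^sup>+x. ennreal (heat s x) * ennreal (1 / norm (x - y)) \<partial>lborel)
       = (\<integral>\<^sup>+x. ennreal (4 * pi) * (ennreal (heat s (0 - x)) * tail_potential 0 (x - y)) \<partial>lborel)"
    proof (rule nn_integral_cong_AE)
      show "AE x in lborel. ennreal (heat s x) * ennreal (1 / norm (x - y)) = ennreal (4 * pi) * (ennreal (heat s (0 - x)) * tail_potential 0 (x - y))"
        using AE_lborel_singleton[of y]
        by eventually_elim (simp add: tail_potential_0 ennreal_mult[symmetric])
    qed
    also have "\<dots> = ennreal (4 * pi) * tail_potential s (0 - y)"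
      unfolding heat_tail_potential[OF s, symmetric] by (rule nn_integral_cmult) measurable
    also have "\<dots> \<le> ennreal (4 * pi) * ennreal (2 / sqrt s)"
      by (intro mult_left_mono tail_potential_decay s) simp
    also have "\<dots> = ennreal (8 * pi / sqrt s)" using s by (simp add: ennreal_mult[symmetric])
    finally show ?thesis .
  qed
  have bound: "c \<le> 8 * pi / sqrt s * ?M" if s: "s > 0" for s
  proof -
    have "ennreal c = (\<integral>\<^sup>+x. ennreal (heat s x) * ennreal c \<partial>lborel)"
      using nn_integral_heat(2)[OF s] by (simp add: nn_integral_multc)
    also have "\<dots> = (\<integral>\<^sup>+x. ennreal (heat s x) * (\<integral>\<^sup>+y. ennreal ((cmod (f y))\<^sup>2) * ennreal (1 / norm (x - y)) \<partial>lborel) \<partial>lborel)"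
      unfolding nn[symmetric] using ae by (intro nn_integral_cong_AE) (auto elim: eventually_mono)
    also have "\<dots> = (\<integral>\<^sup>+x. \<integral>\<^sup>+y. ennreal ((cmod (f y))\<^sup>2) * (ennreal (heat s x) * ennreal (1 / norm (x - y))) \<partial>lborel \<partial>lborel)"
    proof (rule nn_integral_cong)
      fix x
      show "ennreal (heat s x) * (\<integral>\<^sup>+y. ennreal ((cmod (f y))\<^sup>2) * ennreal (1 / norm (x - y)) \<partial>lborel) = (\<integral>\<^sup>+y. ennreal ((cmod (f y))\<^sup>2) * (ennreal (heat s x) * ennreal (1 / norm (x - y))) \<partial>lborel)"
        by (subst nn_integral_cmult[symmetric], measurable) (simp only: mult_ac)
    qed
    also have "\<dots> = (\<integral>\<^sup>+y. \<integral>\<^sup>+x. ennreal ((cmod (f y))\<^sup>2) * (ennreal (heat s x) * ennreal (1 / norm (x - y))) \<partial>lborel \<partial>lborel)"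
      by (rule lborel_pair.Fubini') measurable
    also have "\<dots> = (\<integral>\<^sup>+y. ennreal ((cmod (f y))\<^sup>2) * (\<integral>\<^sup>+x. ennreal (heat s x) * ennreal (1 / norm (x - y)) \<partial>lborel) \<partial>lborel)"
      by (intro nn_integral_cong nn_integral_cmult) measurable
    also have "\<dots> \<le> (\<integral>\<^sup>+y. ennreal ((cmod (f y))\<^sup>2) * ennreal (8 * pi / sqrt s) \<partial>lborel)"
      by (intro nn_integral_mono mult_left_mono av s) simp
    also have "\<dots> = ennreal ?M * ennreal (8 * pi / sqrt s)"
      by (subst nn_integral_multc) (simp_all add: nn_integral_L2[OF L])
    also have "\<dots> = ennreal (8 * pi / sqrt s * ?M)"
      using s by (simp add: ennreal_mult[symmetric] mult.commute)
    finally show ?thesis using s by (subst (asm) ennreal_le_iff) auto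
  qed
  \<comment> \<open>At time \<open>?r^2\<close> the averaged bound reads
    \<open>c * ?r \<le> 8 * pi * ?M\<close>, whereas \<open>c * ?r\<close> is
    \<open>8 * pi * ?M + c\<close>.\<close>
  let ?r = "8 * pi * ?M / c + 1"
  have r: "?r > 0" using c by (intro add_nonneg_pos) auto
  have "c \<le> 8 * pi / sqrt (?r\<^sup>2) * ?M" using r by (intro bound) simp
  also have "sqrt (?r\<^sup>2) = ?r" using r by simp
  finally have "c * ?r \<le> 8 * pi * ?M" using r by (simp add: pos_le_divide_eq)
  then show False using c by (simp add: distrib_left)
qed

text \<open>The hypothesis is \<open>K(Q) \<le> K(Q + e w)\<close> with denominators cleared, both
  sides polynomial in \<open>e\<close> and equal at 0. A minimum at 0 makes the linear coefficients
  agree.\<close>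

lemma quadratic_minimum:
  fixes A a1 a2 M m1 m2 B b1 b2 b3 b4 :: real
  assumes "\<And>e. A * M * (B + e * b1 + e^2 * b2 + e^3 * b3 + e^4 * b4) \<le> (A + 2 * e * a1 + e^2 * a2) * (M + 2 * e * m1 + e^2 * m2) * B"
  shows "2 * a1 * M * B + 2 * m1 * A * B = A * M * b1"
proof -
  define p where "p e = (A + 2 * e * a1 + e^2 * a2) * (M + 2 * e * m1 + e^2 * m2) * B - A * M * (B + e * b1 + e^2 * b2 + e^3 * b3 + e^4 * b4)" for e :: real
  have d: "(p has_real_derivative 2 * a1 * M * B + 2 * m1 * A * B - A * M * b1) (at 0)"
    unfolding p_def[abs_def] by (auto intro!: derivative_eq_intros simp: algebra_simps)
  have "p 0 \<le> p y" for y using assms[of y] by (simp add: p_def)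
  then have "2 * a1 * M * B + 2 * m1 * A * B - A * M * b1 = 0"
    by (intro DERIV_local_min[OF d zero_less_one]) auto
  then show ?thesis by simp
qed

text \<open>The aim is \<open>A = M\<close>, which together with \<open>A + M = |lam| B\<close>
  gives \<open>K(Q) = A M / B = |lam| M / 2\<close>. Optimality of \<open>Q\<close> then becomes the
  interaction bound, and Kato's inequality for \<open>Q\<close> becomes the lower bound for the
  mass.\<close>

lemma ground_state_identities:
  assumes gs: "ground_state lam Q" and lam: "lam < 0"
  shows "L2norm2 Q > 4 / (pi * \<bar>lam\<bar>)"
    and "\<And>v g. is_fourier v g \<Longrightarrow> in_wL2 (1/2) g \<Longrightarrow> \<bar>lam\<bar> * potential_energy 1 0 v * L2norm2 Q \<le> 2 * kin g * L2norm2 v"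
    and "L2norm2 Q > 0"
proof -
  obtain F G where FG: "is_fourier Q F" "is_fourier (nonlin lam 0 Q) G"
    "AE \<xi> in lborel. complex_of_real (norm \<xi>) * F \<xi> + G \<xi> = - F \<xi>"
    using gs unfolding ground_state_def by blast
  have HQ: "H_half Q" and Qpos: "\<And>x. Im (Q x) = 0" "\<And>x. Re (Q x) > 0" using gs unfolding ground_state_def by blast+
  have F: "in_wL2 (1/2) F" by (rule H_half_fourier[OF HQ FG(1)])
  have G: "in_wL2 (1/2) G" by (rule nonlin_in_wL2(1)[OF FG(1) F _ FG(2)]) simp
  note LQ = is_fourier_L2(1)[OF FG(1)] and LF = is_fourier_L2(2)[OF FG(1)] and LG = is_fourier_L2(2)[OF FG(2)]
  note [measurable] = L2_measurable[OF LQ] L2_measurable[OF LF] L2_measurable[OF LG]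
  define A where "A = kin F"
  define M where "M = L2norm2 Q"
  define B where "B = potential_energy 1 0 Q"
  define \<rho> where "\<rho> = (\<lambda>y. (cmod (Q y))\<^sup>2)"
  define \<phi> where "\<phi> = pot 1 0 \<rho>"
  have K: "kato_class (pi / 2 * A) \<rho>" unfolding \<rho>_def A_def by (rule kato[OF FG(1) F])
  have [measurable]: "\<rho> \<in> borel_measurable borel" "\<phi> \<in> borel_measurable borel" unfolding \<phi>_def \<rho>_def by measurable
  have Qne: "Q x \<noteq> 0" for x using Qpos(2)[of x] by auto
  have Qr: "Q x = complex_of_real (Re (Q x))" for x using Qpos(1)[of x] by (simp add: complex_eq_iff)
  have rpos: "\<rho> x > 0" for x using Qne[of x] by (simp add: \<rho>_def)
  have nl: "nonlin lam 0 Q x = complex_of_real (lam * \<phi> x) * Q x" for x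
    unfolding nonlin_def hartree_pot_eq \<phi>_def \<rho>_def by (subst pot_scale) simp
  have A0: "A \<ge> 0" by (simp add: A_def)
  have B_eq: "B = (LINT x|lborel. \<phi> x * \<rho> x)" unfolding B_def potential_energy_def hartree_pot_eq \<phi>_def \<rho>_def ..
  have Mpos: "M > 0"
  proof (rule ccontr)
    assume "\<not> M > 0"
    then have "L2norm2 Q = 0" using L2norm2_nonneg[of Q] unfolding M_def by linarith
    from L2norm2_eq_0[OF LQ this] have "AE x in lborel::(real^3) measure. False" using Qne by simp
    then show False by (simp add: eventually_False ae_filter_eq_bot_iff)
  qed
  then show "L2norm2 Q > 0" by (simp add: M_def)
  \<comment> \<open>The equation tested with an element of \<open>H^(1/2)\<close>, the operator
    \<open>sqrt(-Delta)\<close> being split evenly between the two arguments.\<close>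
  have weak: "Re (ip (hf F) (hf w)) = - Re (ip F w) - Re (ip G w)" if w: "in_wL2 (1/2) w" for w
  proof -
    have Lw: "L2 w" using w L2_of_up(1) by (auto simp: in_wL2_half_iff)
    note [measurable] = L2_measurable[OF Lw]
    have "ip (hf F) (hf w) = (LINT \<xi>|lborel. (complex_of_real (norm \<xi>) * F \<xi>) * cnj (w \<xi>))"
      unfolding ip_def hf_def by (intro Bochner_Integration.integral_cong) (auto simp: mult_ac simp flip: of_real_mult)
    also have "\<dots> = ip (\<lambda>\<xi>. (-1) * F \<xi> - G \<xi>) w"
      unfolding ip_def
    proof (rule integral_cong_AE)
      show "AE \<xi> in lborel. (complex_of_real (norm \<xi>) * F \<xi>) * cnj (w \<xi>) = ((-1) * F \<xi> - G \<xi>) * cnj (w \<xi>)"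
        using FG(3)
      proof eventually_elim
        case (elim \<xi>)
        then have "complex_of_real (norm \<xi>) * F \<xi> = (-1) * F \<xi> - G \<xi>" by (simp add: eq_diff_eq)
        then show ?case by (simp only:)
      qed
    qed measurable
    also have "\<dots> = (-1) * ip F w - ip G w"
      using LF LG Lw by (simp only: ip_diff_left L2_cmult ip_cmult_left)
    finally show ?thesis by simp
  qed
  have AM: "A + M = \<bar>lam\<bar> * B"
  proof -
    have "Re (ip (nonlin lam 0 Q) Q) = (LINT x|lborel. Re (nonlin lam 0 Q x * cnj (Q x)))"
      unfolding ip_def by (rule integral_Re[symmetric, OF L2_mult_integrable(1)[OF is_fourier_L2(1)[OF FG(2)] LQ]])
    also have "\<dots> = (LINT x|lborel. lam * (\<phi> x * \<rho> x))"
      unfolding nl \<rho>_def cmod_power2 by (intro Bochner_Integration.integral_cong) (auto simp: power2_eq_square algebra_simps)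
    also have "\<dots> = lam * B" unfolding B_eq by (rule integral_mult_right_zero)
    finally have "Re (ip G F) = lam * B" using parseval[OF FG(2,1)] by simp
    moreover have "Re (ip F F) = M" using plancherel[OF FG(1)] by (simp add: ip_self M_def)
    moreover have "Re (ip (hf F) (hf F)) = A"
      using kin_eq_hf[OF F] by (simp add: ip_self L2_measurable A_def)
    ultimately show ?thesis using weak[OF F] lam by simp
  qed
  have Bpos: "B > 0"
  proof -
    have "\<bar>lam\<bar> * B > 0" using AM A0 Mpos by linarith
    then show ?thesis using lam by (simp add: mult_less_0_iff)
  qed
  \<comment> \<open>Optimality with denominators cleared. Vanishing potential energy is a separate
    case because the quotient \<open>K_functional v\<close> is then only a default value.\<close>
  have opt: "A * M * potential_energy 1 0 v \<le> kin g * L2norm2 v * B" if vg: "is_fourier v g" "in_wL2 (1/2) g" for v g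
  proof (cases "potential_energy 1 0 v = 0")
    case True
    then show ?thesis using Bpos by simp
  next
    case False
    then have pv: "potential_energy 1 0 v > 0" using potential_energy_nonneg[of 1 0 v] by linarith
    have "\<not> (AE x in lborel. v x = 0)"
    proof
      assume "AE x in lborel. v x = 0"
      then have "potential_energy 1 0 v = 0" unfolding potential_energy_def
        by (intro integral_eq_zero_AE) (auto elim: eventually_mono)
      with False show False by simp
    qed
    moreover have "H_half v" using vg by (auto simp: H_half_def)
    ultimately have "K_functional Q \<le> K_functional v" using gs unfolding ground_state_def by blast
    then have "A * M / B \<le> kin g * L2norm2 v / potential_energy 1 0 v"
      unfolding K_functional_eq[OF FG(1) F] K_functional_eq[OF vg] A_def M_def B_def .
    then show ?thesis using Bpos pv by (simp add: divide_simps mult_ac)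
  qed
  have AeqM: "A = M"
  proof (rule ccontr)
    assume ne: "A \<noteq> M"
    \<comment> \<open>This is \<open>(M * \<phi> - B) Q\<close>, since the nonlinearity divided by
      \<open>lam\<close> is \<open>\<phi> Q\<close>. In the present form it visibly has a transform
      in \<open>H^(1/2)\<close>.\<close>
    define w where "w = (\<lambda>x. complex_of_real (M / lam) * nonlin lam 0 Q x - complex_of_real B * Q x)"
    define W where "W = (\<lambda>\<xi>. complex_of_real (M / lam) * G \<xi> - complex_of_real B * F \<xi>)"
    have wW: "is_fourier w W" unfolding w_def W_def by (intro is_fourier_diff is_fourier_cmult FG)
    have W: "in_wL2 (1/2) W"
    proof -
      have "W = (\<lambda>\<xi>. complex_of_real (M / lam) * G \<xi> + complex_of_real (- B) * F \<xi>)" by (simp add: W_def)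
      then show ?thesis by (simp only:) (intro in_wL2_add in_wL2_cmult F G)
    qed
    have w_eq: "w x = complex_of_real (M * \<phi> x - B) * Q x" for x
      unfolding w_def nl using lam by (simp add: algebra_simps)
    note Lw = is_fourier_L2(1)[OF wW] and LW = is_fourier_L2(2)[OF wW]
    note [measurable] = L2_measurable[OF Lw]
    define \<rho>1 where "\<rho>1 = (\<lambda>x. Re (Q x * cnj (w x)))"
    define \<rho>2 where "\<rho>2 = (\<lambda>y. (cmod (w y))\<^sup>2)"
    have [measurable]: "\<rho>1 \<in> borel_measurable borel" "\<rho>2 \<in> borel_measurable borel"
      unfolding \<rho>1_def \<rho>2_def by measurable
    have K2: "kato_class (pi / 2 * kin W) \<rho>2" unfolding \<rho>2_def by (rule kato[OF wW W])
    obtain C where K1: "kato_class C \<rho>1"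
    proof -
      have "\<bar>\<rho>1 y\<bar> \<le> \<rho> y + \<rho>2 y" for y
      proof -
        have "\<bar>\<rho>1 y\<bar> \<le> cmod (Q y) * cmod (w y)"
          unfolding \<rho>1_def using abs_Re_le_cmod[of "Q y * cnj (w y)"] by (simp add: norm_mult)
        also have "\<dots> \<le> \<rho> y + \<rho>2 y"
          unfolding \<rho>_def \<rho>2_def
          using sum_squares_bound[of "cmod (Q y)" "cmod (w y)"] mult_nonneg_nonneg[OF norm_ge_zero[of "Q y"] norm_ge_zero[of "w y"]]
          unfolding mult.assoc by linarith
        finally show ?thesis .
      qed
      then show ?thesis using kato_class_dominated[OF kato_class_add[OF K K2], of \<rho>1] that by auto
    qed
    let ?D = "\<lambda>s t. LINT x|lborel. pot 1 0 s x * t x"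
    have r1: "\<rho>1 x = (M * \<phi> x - B) * \<rho> x" for x
      unfolding \<rho>1_def w_eq \<rho>_def cmod_power2 by (simp add: power2_eq_square algebra_simps)
    have opt_e: "A * M * (B + e * (4 * ?D \<rho> \<rho>1) + e^2 * (2 * ?D \<rho> \<rho>2 + 4 * ?D \<rho>1 \<rho>1) + e^3 * (4 * ?D \<rho>1 \<rho>2) + e^4 * ?D \<rho>2 \<rho>2)
      \<le> (A + 2 * e * Re (ip (hf F) (hf W)) + e^2 * kin W) * (M + 2 * e * Re (ip Q w) + e^2 * L2norm2 w) * B" for e
    proof -
      define v where "v = (\<lambda>x. Q x + complex_of_real e * w x)"
      define g where "g = (\<lambda>\<xi>. F \<xi> + complex_of_real e * W \<xi>)"
      have vg: "is_fourier v g" unfolding v_def g_def by (intro is_fourier_add is_fourier_cmult FG wW)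
      have g: "in_wL2 (1/2) g" unfolding g_def by (intro in_wL2_add in_wL2_cmult F W)
      have kg: "kin g = A + 2 * e * Re (ip (hf F) (hf W)) + e^2 * kin W"
      proof -
        note hF = kin_eq_hf[OF F] and hW = kin_eq_hf[OF W]
        have "hf g = (\<lambda>\<xi>. hf F \<xi> + complex_of_real e * hf W \<xi>)" by (auto simp: hf_def g_def algebra_simps)
        then show ?thesis
          unfolding kin_eq_hf(2)[OF g] A_def hF(2) hW(2)
          using L2norm2_add[OF hF(1) L2_cmult[OF hW(1)], of "complex_of_real e"]
          by (simp add: L2norm2_cmult L2_measurable[OF hW(1)] ip_cmult_right)
      qed
      have mv: "L2norm2 v = M + 2 * e * Re (ip Q w) + e^2 * L2norm2 w"
        unfolding v_def M_def using L2norm2_add[OF LQ L2_cmult[OF Lw], of "complex_of_real e"]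
        by (simp add: L2norm2_cmult L2_measurable[OF Lw] ip_cmult_right)
      have pe: "potential_energy 1 0 v = B + e * (4 * ?D \<rho> \<rho>1) + e^2 * (2 * ?D \<rho> \<rho>2 + 4 * ?D \<rho>1 \<rho>1) + e^3 * (4 * ?D \<rho>1 \<rho>2) + e^4 * ?D \<rho>2 \<rho>2"
      proof -
        have rv: "(cmod (v x))\<^sup>2 = \<rho> x + (2 * e * \<rho>1 x + e^2 * \<rho>2 x)" for x
          unfolding v_def \<rho>_def \<rho>1_def \<rho>2_def cmod_power2 by (simp add: power2_eq_square algebra_simps)
        have pv: "pot 1 0 (\<lambda>x. (cmod (v x))\<^sup>2) x = pot 1 0 \<rho> x + (2 * e * pot 1 0 \<rho>1 x + e^2 * pot 1 0 \<rho>2 x)" for x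
          unfolding rv
          by (simp only: pot_add[OF K kato_class_add[OF kato_class_cmult[OF K1] kato_class_cmult[OF K2]] order_refl]
              pot_add[OF kato_class_cmult[OF K1] kato_class_cmult[OF K2] order_refl] pot_cmult)
        note i = kato_classD(2)[OF K] kato_classD(2)[OF K1] kato_classD(2)[OF K2]
        have ii: "integrable lborel (\<lambda>x. pot 1 0 s x * t x)" if "s \<in> {\<rho>, \<rho>1, \<rho>2}" "t \<in> {\<rho>, \<rho>1, \<rho>2}" for s t
          using that K K1 K2 i by (auto intro!: pot_mult_integrable)
        have "potential_energy 1 0 v = (LINT x|lborel. pot 1 0 \<rho> x * \<rho> x
            + (2 * e * (pot 1 0 \<rho> x * \<rho>1 x) + (2 * e * (pot 1 0 \<rho>1 x * \<rho> x) + (e^2 * (pot 1 0 \<rho> x * \<rho>2 x)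
            + (e^2 * (pot 1 0 \<rho>2 x * \<rho> x) + (4 * e^2 * (pot 1 0 \<rho>1 x * \<rho>1 x) + (2 * e^3 * (pot 1 0 \<rho>1 x * \<rho>2 x)
            + (2 * e^3 * (pot 1 0 \<rho>2 x * \<rho>1 x) + e^4 * (pot 1 0 \<rho>2 x * \<rho>2 x)))))))))"
          unfolding potential_energy_def hartree_pot_eq pv unfolding rv
          by (intro Bochner_Integration.integral_cong refl) (simp add: algebra_simps eval_nat_numeral)
        also have "\<dots> = ?D \<rho> \<rho> + (2 * e * ?D \<rho> \<rho>1 + (2 * e * ?D \<rho>1 \<rho> + (e^2 * ?D \<rho> \<rho>2
            + (e^2 * ?D \<rho>2 \<rho> + (4 * e^2 * ?D \<rho>1 \<rho>1 + (2 * e^3 * ?D \<rho>1 \<rho>2 + (2 * e^3 * ?D \<rho>2 \<rho>1 + e^4 * ?D \<rho>2 \<rho>2)))))))"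
          by (simp add: ii)
        also have "?D \<rho>1 \<rho> = ?D \<rho> \<rho>1" by (rule pot_symmetric[OF K1 K order_refl])
        also have "?D \<rho>2 \<rho> = ?D \<rho> \<rho>2" by (rule pot_symmetric[OF K2 K order_refl])
        also have "?D \<rho>2 \<rho>1 = ?D \<rho>1 \<rho>2" by (rule pot_symmetric[OF K2 K1 order_refl])
        also have "?D \<rho> \<rho> = B" unfolding B_eq \<phi>_def ..
        finally show ?thesis by (simp add: algebra_simps)
      qed
      show ?thesis using opt[OF vg g] unfolding kg mv pe .
    qed
    \<comment> \<open>The Euler-Lagrange equation of \<open>K\<close> tested with
      \<open>w\<close>.\<close>
    from quadratic_minimum[OF opt_e]
    have qm: "2 * Re (ip (hf F) (hf W)) * M * B + 2 * Re (ip Q w) * A * B = A * M * (4 * ?D \<rho> \<rho>1)" .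
    define m1 where "m1 = Re (ip Q w)"
    define d1 where "d1 = ?D \<rho> \<rho>1"
    have m1: "m1 = (LINT x|lborel. \<rho>1 x)"
      unfolding m1_def ip_def \<rho>1_def by (rule integral_Re[symmetric, OF L2_mult_integrable(1)[OF LQ Lw]])
    have GW: "Re (ip G W) = lam * d1"
    proof -
      have "Re (ip (nonlin lam 0 Q) w) = (LINT x|lborel. Re (nonlin lam 0 Q x * cnj (w x)))"
        unfolding ip_def by (rule integral_Re[symmetric, OF L2_mult_integrable(1)[OF is_fourier_L2(1)[OF FG(2)] Lw]])
      also have "\<dots> = (LINT x|lborel. lam * (\<phi> x * \<rho>1 x))"
        unfolding nl \<rho>1_def by (intro Bochner_Integration.integral_cong) (auto simp: algebra_simps)
      also have "\<dots> = lam * d1" unfolding d1_def \<phi>_def by (rule integral_mult_right_zero)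
      finally show ?thesis using parseval[OF FG(2) wW] by simp
    qed
    have "Re (ip F W) = m1" using parseval[OF FG(1) wW] by (simp add: m1_def)
    then have a1: "Re (ip (hf F) (hf W)) = - m1 - lam * d1" using weak[OF W] GW by simp
    have "2 * (- m1 - lam * d1) * M * B + 2 * m1 * A * B = A * M * (4 * d1)"
      using qm unfolding a1 m1_def[symmetric] d1_def[symmetric] .
    moreover have "lam * B = - (A + M)" using AM lam by simp
    \<comment> \<open>The equation for \<open>Q\<close> has replaced the half-derivative pairing and
      \<open>lam * B\<close> is \<open>- (A + M)\<close>; what is left of the Euler-Lagrange
      identity factors.\<close>
    ultimately have "(M - A) * (M * d1 - B * m1) = 0"
    proof -
      assume h: "2 * (- m1 - lam * d1) * M * B + 2 * m1 * A * B = A * M * (4 * d1)" "lam * B = - (A + M)"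
      have "2 * (- m1 - lam * d1) * M * B = - 2 * m1 * M * B - 2 * d1 * M * (lam * B)" by (simp add: algebra_simps)
      with h have "- 2 * m1 * M * B - 2 * d1 * M * (- (A + M)) + 2 * m1 * A * B = A * M * (4 * d1)" by simp
      then show ?thesis by (simp add: algebra_simps)
    qed
    with ne have z: "M * d1 - B * m1 = 0" by simp
    have i: "integrable lborel (\<lambda>x. (M * \<phi> x - B) * \<rho>1 x)"
      using pot_mult_integrable[OF K kato_classD(2)[OF K1] order_refl, of 1] kato_classD(2)[OF K1]
      unfolding \<phi>_def by (simp add: left_diff_distrib mult.assoc)
    \<comment> \<open>Because \<open>\<rho>1\<close> is \<open>(M * \<phi> - B) * \<rho>\<close>,
      the integrand is a square times the positive density. Its vanishing forces
      \<open>\<phi> = B / M\<close> almost everywhere.\<close>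
    have "(LINT x|lborel. (M * \<phi> x - B) * \<rho>1 x) = M * d1 - B * m1"
      using pot_mult_integrable[OF K kato_classD(2)[OF K1] order_refl, of 1] kato_classD(2)[OF K1]
      unfolding \<phi>_def d1_def m1 by (simp add: left_diff_distrib mult.assoc)
    then have "(LINT x|lborel. (M * \<phi> x - B) * \<rho>1 x) = 0" using z by simp
    moreover have nn: "0 \<le> (M * \<phi> x - B) * \<rho>1 x" for x
    proof -
      have "(M * \<phi> x - B) * \<rho>1 x = (M * \<phi> x - B)\<^sup>2 * \<rho> x" unfolding r1 by (simp add: power2_eq_square)
      then show ?thesis using rpos[of x] by simp
    qed
    ultimately have "AE x in lborel. (M * \<phi> x - B) * \<rho>1 x = 0"
      using integral_nonneg_eq_0_iff_AE[OF i] by simp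
    then have "AE x in lborel. pot 1 0 (\<lambda>y. (cmod (Q y))\<^sup>2) x = B / M"
    proof eventually_elim
      case (elim x)
      then have "M * \<phi> x - B = 0" unfolding r1 using rpos[of x] by simp
      then show ?case using Mpos unfolding \<phi>_def \<rho>_def by (simp add: field_simps)
    qed
    with pot_not_constant[OF FG(1) F, of "B / M"] Bpos Mpos show False by simp
  qed
  have B2: "\<bar>lam\<bar> * B = 2 * M" using AM AeqM by simp
  \<comment> \<open>Kato's inequality bounds \<open>\<phi>\<close> pointwise by
    \<open>pi / 2 * A\<close>; equality after averaging against the positive density would again
    make the potential constant.\<close>
  have strict: "B < pi / 2 * A * M"
  proof -
    have phi_le: "\<phi> x \<le> pi / 2 * A" for x
      using pot_bound[OF K order_refl, of 1 x] unfolding \<phi>_def by simp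
    have i1: "integrable lborel \<rho>" by (rule kato_classD(2)[OF K])
    have i2: "integrable lborel (\<lambda>x. \<phi> x * \<rho> x)" unfolding \<phi>_def by (rule pot_mult_integrable[OF K i1 order_refl])
    have i: "integrable lborel (\<lambda>x. (pi / 2 * A - \<phi> x) * \<rho> x)"
      unfolding left_diff_distrib using i1 i2 by (intro Bochner_Integration.integrable_diff integrable_mult_right)
    have v: "(LINT x|lborel. (pi / 2 * A - \<phi> x) * \<rho> x) = pi / 2 * A * M - B"
    proof -
      have "(LINT x|lborel. \<rho> x) = M" unfolding \<rho>_def M_def by (simp add: L2norm2_eq)
      then show ?thesis unfolding left_diff_distrib B_eq using i1 i2 by simp
    qed
    have nn: "0 \<le> (pi / 2 * A - \<phi> x) * \<rho> x" for x using phi_le[of x] rpos[of x] by (intro mult_nonneg_nonneg) auto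
    have "(LINT x|lborel. (pi / 2 * A - \<phi> x) * \<rho> x) \<noteq> 0"
    proof
      assume "(LINT x|lborel. (pi / 2 * A - \<phi> x) * \<rho> x) = 0"
      then have "AE x in lborel. (pi / 2 * A - \<phi> x) * \<rho> x = 0"
        using integral_nonneg_eq_0_iff_AE[OF i] nn by simp
      then have "AE x in lborel. pot 1 0 (\<lambda>y. (cmod (Q y))\<^sup>2) x = pi / 2 * A"
      proof eventually_elim
        case (elim x)
        then have "pi / 2 * A - \<phi> x = 0" using rpos[of x] by simp
        then show ?case unfolding \<phi>_def \<rho>_def by simp
      qed
      with pot_not_constant[OF FG(1) F, of "pi / 2 * A"] AeqM Mpos show False by simp
    qed
    moreover have "0 \<le> (LINT x|lborel. (pi / 2 * A - \<phi> x) * \<rho> x)" by (intro Bochner_Integration.integral_nonneg nn)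
    ultimately show ?thesis unfolding v by linarith
  qed
  show "L2norm2 Q > 4 / (pi * \<bar>lam\<bar>)"
  proof -
    have "\<bar>lam\<bar> * B < \<bar>lam\<bar> * (pi / 2 * A * M)"
      using lam by (intro mult_strict_left_mono strict) simp
    then have "2 * M < \<bar>lam\<bar> * (pi / 2 * M * M)" unfolding B2 AeqM .
    then have "2 * M < (\<bar>lam\<bar> * (pi / 2) * M) * M" by (simp add: mult_ac)
    then have "2 < \<bar>lam\<bar> * (pi / 2) * M" using Mpos by (simp only: mult_less_cancel_right)
    then have "4 < M * (pi * \<bar>lam\<bar>)" by (simp add: mult_ac)
    moreover have "pi * \<bar>lam\<bar> > 0" using lam by (intro mult_pos_pos) simp_all
    ultimately show ?thesis unfolding M_def by (simp only: pos_divide_less_eq)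
  qed
  show "\<bar>lam\<bar> * potential_energy 1 0 v * L2norm2 Q \<le> 2 * kin g * L2norm2 v" if "is_fourier v g" "in_wL2 (1/2) g" for v g
  proof -
    have "M * (M * (\<bar>lam\<bar> * potential_energy 1 0 v)) = \<bar>lam\<bar> * (A * M * potential_energy 1 0 v)" using AeqM by simp
    also have "\<dots> \<le> \<bar>lam\<bar> * (kin g * L2norm2 v * B)" by (intro mult_left_mono opt that) simp
    also have "\<dots> = M * (2 * kin g * L2norm2 v)" using B2 by (simp add: mult.left_commute[of "\<bar>lam\<bar>"] mult_ac)
    finally have "M * (\<bar>lam\<bar> * potential_energy 1 0 v) \<le> 2 * kin g * L2norm2 v" using Mpos by (simp only: mult_le_cancel_left_pos)
    then show ?thesis unfolding M_def by (simp add: mult_ac)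
  qed
qed

subsection \<open>Global existence\<close>

lemma H_half_norm_eq:
  assumes fg: "is_fourier f g" and g: "in_wL2 (1/2) g"
  shows "H_half_norm f = sqrt (L2norm2 (up g))"
proof -
  let ?g = "SOME g. is_fourier f g"
  have g': "is_fourier f ?g" by (rule someI[where P="is_fourier f", OF fg])
  have "wnorm2 (1/2) ?g = wnorm2 (1/2) g"
    by (rule in_wL2_cong_AE(2)[OF g L2_measurable[OF is_fourier_L2(2)[OF g']] is_fourier_unique[OF g' fg]])
  also have "\<dots> = ennreal (L2norm2 (up g))"
    using g by (intro wnorm2_half_L2) (simp add: in_wL2_half_iff)
  finally show ?thesis unfolding H_half_norm_def by simp
qed

lemma up_le_mass_kin:
  assumes g: "in_wL2 (1/2) g"
  shows "L2norm2 (up g) \<le> L2norm2 g + kin g"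
proof -
  have gm: "g \<in> borel_measurable borel" and Lg: "L2 (up g)" using g by (auto simp: in_wL2_half_iff)
  have L: "L2 g" by (rule L2_of_up(1)[OF gm Lg])
  have "ennreal (L2norm2 (up g)) \<le> ennreal (L2norm2 g) + ennreal (kin g)"
    using wnorm2_half_le[OF gm] unfolding wnorm2_half_L2[OF Lg] nn_integral_L2[OF L] in_wL2_kin(1)[OF g] .
  also have "\<dots> = ennreal (L2norm2 g + kin g)" by (rule ennreal_plus[symmetric]) simp_all
  finally show ?thesis by (subst (asm) ennreal_le_iff) simp_all
qed

text \<open>For a nonpositive coupling, screening only weakens the attraction, so the Coulomb bound
  obtained from the ground state covers every \<open>mu\<close>.\<close>

lemma potential_energy_ge:
  assumes fg: "is_fourier f g" and g: "in_wL2 (1/2) g" and lam: "lam \<le> 0" and mu: "mu \<ge> 0"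
  shows "potential_energy lam mu f \<ge> lam * potential_energy 1 0 f"
proof -
  note K = kato[OF fg g]
  note i = kato_classD(2)[OF K]
  let ?r = "\<lambda>y. (cmod (f y))\<^sup>2"
  have "pot lam 0 ?r x \<le> pot lam mu ?r x" for x
    unfolding pot_def
  proof (intro integral_mono pot_integrable[OF K] order_refl mu)
    fix y
    have "exp (- mu * norm (x - y)) / norm (x - y) * ?r y \<le> exp (- 0 * norm (x - y)) / norm (x - y) * ?r y"
      using mu by (intro mult_right_mono divide_right_mono) auto
    from mult_left_mono_neg[OF this lam]
    show "lam * exp (- 0 * norm (x - y)) / norm (x - y) * ?r y \<le> lam * exp (- mu * norm (x - y)) / norm (x - y) * ?r y"
      by (simp add: mult_ac)
  qed
  then have "(LINT x|lborel. pot lam 0 ?r x * ?r x) \<le> potential_energy lam mu f"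
    unfolding potential_energy_def hartree_pot_eq
    by (intro integral_mono pot_mult_integrable[OF K i] mult_right_mono order_refl mu) auto
  moreover have "(LINT x|lborel. pot lam 0 ?r x * ?r x) = (LINT x|lborel. lam * (pot 1 0 ?r x * ?r x))"
    by (subst pot_scale) (simp only: mult.assoc)
  moreover have "\<dots> = lam * potential_energy 1 0 f"
    unfolding potential_energy_def hartree_pot_eq by (rule integral_mult_right_zero)
  ultimately show ?thesis by linarith
qed

section \<open>A priori bounds for the \<open>H^(1/2)\<close> norm\<close>

context hartree_flow
begin

lemma kin_le_kinetic:
  assumes t: "t \<in> S"
  shows "kin (U t) \<le> (LINT \<xi>|lborel. symb m \<xi> * (cmod (U t \<xi>))\<^sup>2)"
proof -
  note [measurable] = U_meas[OF t]
  have "ennreal (kin (U t)) \<le> (\<integral>\<^sup>+\<xi>. ennreal (symb m \<xi> * (cmod (U t \<xi>))\<^sup>2) \<partial>lborel)"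
    unfolding in_wL2_kin(1)[OF U(2)[OF t], symmetric]
    by (intro nn_integral_mono ennreal_leI mult_right_mono norm_le_symb) simp
  also have "\<dots> = ennreal (LINT \<xi>|lborel. symb m \<xi> * (cmod (U t \<xi>))\<^sup>2)"
    by (rule nn_integral_eq_integral[OF integrable_kinetic[OF t]]) simp
  finally show ?thesis by (subst (asm) ennreal_le_iff) (auto intro: Bochner_Integration.integral_nonneg)
qed

lemma H_half_bound_of_kin:
  assumes t: "t \<in> S" and "kin (U t) \<le> C"
  shows "H_half_norm (u t) \<le> sqrt (L2norm2 (u 0) + C)"
proof -
  have "L2norm2 (U t) = L2norm2 (u 0)" using plancherel[OF U(1)[OF t]] mass_conservation[OF t] by simp
  then show ?thesis
    unfolding H_half_norm_eq[OF U[OF t]] using up_le_mass_kin[OF U(2)[OF t]] assms(2)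
    by (intro real_sqrt_le_mono) linarith
qed

lemma H_half_bounded_defocusing:
  assumes t: "t \<in> S" and lam: "lam \<ge> 0"
  shows "H_half_norm (u t) \<le> sqrt (L2norm2 (u 0) + 2 * energy 0)"
proof (rule H_half_bound_of_kin[OF t])
  have "k \<le> 2 * E" if "k \<le> K" "K / 2 + P / 4 = E" "0 \<le> P" for k K P E :: real using that by linarith
  from this[OF kin_le_kinetic[OF t] _ potential_energy_nonneg[OF lam]]
  show "kin (U t) \<le> 2 * energy 0"
    using energy_conservation[OF t] unfolding energy_def .
qed

text \<open>The attraction consumes at most the fraction \<open>L2norm2 (u 0) / L2norm2 Q\<close> of
  the kinetic energy. Mass conservation keeps this fraction fixed below 1, so the conserved energy
  controls the remaining share.\<close>

lemma H_half_bounded_focusing: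
  assumes t: "t \<in> S" and lam: "lam < 0" and gs: "ground_state lam Q" and small: "L2norm2 (u 0) < L2norm2 Q"
  shows "H_half_norm (u t) \<le> sqrt (L2norm2 (u 0) + 2 * energy 0 / (1 - L2norm2 (u 0) / L2norm2 Q))"
proof (rule H_half_bound_of_kin[OF t])
  let ?q = "1 - L2norm2 (u 0) / L2norm2 Q" and ?T = "LINT \<xi>|lborel. symb m \<xi> * (cmod (U t \<xi>))\<^sup>2"
  \<comment> \<open>\<open>K\<close> is the kinetic term, \<open>c\<close> the fraction of it that
    bounds the attraction, and \<open>y\<close> the remaining share; the coefficients 1/2 and 1/4 of
    the energy match the factor 2 in \<open>x \<le> 2 * c\<close>.\<close>
  have comb: "y \<le> 2 * (K / 2 + P / 4)" if "x \<le> 2 * c" "P \<ge> - x" "y = K - c" for K P c x y :: real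
    using that by (simp add: field_simps)
  note Q = ground_state_identities[OF gs lam]
  have q: "?q > 0" using small Q(3) by (simp add: divide_less_eq)
  have "\<bar>lam\<bar> * potential_energy 1 0 (u t) * L2norm2 Q \<le> 2 * kin (U t) * L2norm2 (u 0)"
    using Q(2)[OF U[OF t]] mass_conservation[OF t] by simp
  then have "\<bar>lam\<bar> * potential_energy 1 0 (u t) \<le> 2 * kin (U t) * (L2norm2 (u 0) / L2norm2 Q)"
    using Q(3) by (simp add: field_simps)
  also have "\<dots> \<le> 2 * ?T * (L2norm2 (u 0) / L2norm2 Q)"
    using kin_le_kinetic[OF t] by (intro mult_right_mono) auto
  finally have "\<bar>lam\<bar> * potential_energy 1 0 (u t) \<le> 2 * (?T * (L2norm2 (u 0) / L2norm2 Q))"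
    by (simp only: mult.assoc)
  moreover have "potential_energy lam mu (u t) \<ge> - (\<bar>lam\<bar> * potential_energy 1 0 (u t))"
    using potential_energy_ge[OF U[OF t] less_imp_le[OF lam] mu] lam by simp
  moreover have "?T * ?q = ?T - ?T * (L2norm2 (u 0) / L2norm2 Q)" by (simp add: right_diff_distrib)
  ultimately have "?T * ?q \<le> 2 * energy t" unfolding energy_def by (rule comb)
  then have "?T \<le> 2 * energy 0 / ?q" using q energy_conservation[OF t] by (simp add: pos_le_divide_eq)
  then show "kin (U t) \<le> 2 * energy 0 / ?q" using kin_le_kinetic[OF t] by linarith
qed

end

theorem theorem2:
  fixes m lam mu :: real and u0 :: fn3 and T :: ereal and u :: "real \<Rightarrow> fn3" and Q :: fn3
  assumes "m \<ge> 0" and "mu \<ge> 0" and "H_half u0"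
    and "is_solution m lam mu u0 T u"
    and "T < \<infinity> \<Longrightarrow> filterlim (\<lambda>t. H_half_norm (u t)) at_top (at_left (real_of_ereal T))"
    and "lam < 0 \<Longrightarrow> ground_state lam Q"
  shows "((lam \<ge> 0 \<or> (lam < 0 \<and> L2norm2 u0 < L2norm2 Q)) \<longrightarrow> T = \<infinity>) \<and>
         (lam < 0 \<longrightarrow> L2norm2 Q > 4 / (pi * \<bar>lam\<bar>))"
proof (intro conjI impI)
  assume "lam < 0"
  then show "L2norm2 Q > 4 / (pi * \<bar>lam\<bar>)" using ground_state_identities(1) assms(6) by blast
next
  assume cases: "lam \<ge> 0 \<or> (lam < 0 \<and> L2norm2 u0 < L2norm2 Q)"
  define S where "S = {t. 0 \<le> t \<and> ereal t < T}"
  obtain U W where T: "T > 0" and u0: "AE x in lborel. u 0 x = u0 x"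
    and sol: "\<forall>t\<in>S. is_fourier (u t) (U t) \<and> in_wL2 (1/2) (U t) \<and> in_wL2 (-1/2) (W t) \<and>
       ((\<lambda>s. wnorm2 (1/2) (\<lambda>\<xi>. U s \<xi> - U t \<xi>)) \<longlongrightarrow> 0) (at t within S) \<and>
       ((\<lambda>s. wnorm2 (-1/2) (\<lambda>\<xi>. (U s \<xi> - U t \<xi>) / complex_of_real (s - t) - W t \<xi>)) \<longlongrightarrow> 0) (at t within S) \<and>
       ((\<lambda>s. wnorm2 (-1/2) (\<lambda>\<xi>. W s \<xi> - W t \<xi>)) \<longlongrightarrow> 0) (at t within S) \<and>
       (\<exists>G. is_fourier (nonlin lam mu (u t)) G \<and>
          (AE \<xi> in lborel. \<i> * W t \<xi> = complex_of_real (sqrt ((norm \<xi>)\<^sup>2 + m\<^sup>2)) * U t \<xi> + G \<xi>))"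
    using assms(4) unfolding is_solution_def S_def by blast
  \<comment> \<open>The transform of the nonlinearity is given separately at each time; choice turns
    it into a function of time.\<close>
  obtain G where G: "\<And>t. t \<in> S \<Longrightarrow> is_fourier (nonlin lam mu (u t)) (G t) \<and>
          (AE \<xi> in lborel. \<i> * W t \<xi> = complex_of_real (sqrt ((norm \<xi>)\<^sup>2 + m\<^sup>2)) * U t \<xi> + G t \<xi>)"
    using bchoice[of S "\<lambda>t G. is_fourier (nonlin lam mu (u t)) G \<and>
          (AE \<xi> in lborel. \<i> * W t \<xi> = complex_of_real (sqrt ((norm \<xi>)\<^sup>2 + m\<^sup>2)) * U t \<xi> + G \<xi>)"] sol by blast
  have S_int: "{0..t} \<subseteq> S" if "t \<in> S" for t
  proof
    fix r assume "r \<in> {0..t}"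
    then have "0 \<le> r" "ereal r \<le> ereal t" by auto
    then show "r \<in> S" using that order_le_less_trans[of "ereal r" "ereal t" T] by (auto simp: S_def)
  qed
  interpret hartree_flow m lam mu S u U W G
    by unfold_locales (use assms(1,2) sol G S_int in \<open>auto simp: S_def symb_def\<close>)
  have M0: "L2norm2 (u 0) = L2norm2 u0"
    unfolding L2norm2_def using u0 by (intro arg_cong[where f=enn2real] nn_integral_cong_AE) auto
  obtain C where C: "\<And>t. t \<in> S \<Longrightarrow> H_half_norm (u t) \<le> C"
  proof (cases "lam \<ge> 0")
    case True
    then show ?thesis using that H_half_bounded_defocusing by blast
  next
    case False
    then have "lam < 0" "L2norm2 (u 0) < L2norm2 Q" using cases M0 by auto
    then show ?thesis using that H_half_bounded_focusing assms(6) by blast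
  qed
  show "T = \<infinity>"
  proof (rule ccontr)
    assume "T \<noteq> \<infinity>"
    then obtain \<tau> where \<tau>: "T = ereal \<tau>" using T by (cases T) auto
    have "\<tau> > 0" using T \<tau> by simp
    have "filterlim (\<lambda>t. H_half_norm (u t)) at_top (at_left \<tau>)" using assms(5) \<tau> by simp
    \<comment> \<open>Blow-up of the norm at \<open>\<tau>\<close> pushes it above the uniform bound
      \<open>C\<close> at times that still belong to \<open>S\<close>.\<close>
    then have "\<forall>\<^sub>F t in at_left \<tau>. H_half_norm (u t) > C" unfolding filterlim_at_top_dense by blast
    moreover have "\<forall>\<^sub>F t in at_left \<tau>. t \<in> S"
      using eventually_at_left_real[OF \<open>\<tau> > 0\<close>] by eventually_elim (simp add: S_def \<tau>)
    ultimately have "\<forall>\<^sub>F t in at_left \<tau>. False"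
    proof eventually_elim
      case (elim t)
      then show ?case using C[of t] by simp
    qed
    then show False by simp
  qed
qed

end
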